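(* Let $n\ge2$, $1^*=n/(n-1)$, let $w\in A_1^*$ on $\mathbb{R}^n$, and let $E$ be a set of finite $w$-perimeter in $\mathbb{R}^n$. Let $C_1>0$ be the constant in the Pérez–Rela weighted Gagliardo–Nirenberg–Sobolev inequality for the measure $d\mu=w\,dx$, i.e. a constant for which $$\lVert g\rVert_{L^{1^*}(\mathbb{R}^n;w)}\le C_1\lVert Dg\rVert_{L^1(\mathbb{R}^n;(Mw)^{1/1^*})}\quad\text{for all }g\in W^{1,1}(\mathbb{R}^n;w).$$ Then $$(w(E))^{1/1^*}\le C_1[w]_{A_1}^{2/1^*}\lVert\partial E\rVert_{w^{1/1^*}}(\mathbb{R}^n).$$ If, in addition, $\chi_E$ is $w^{1/1^*}$-approximable, then $$(w(E))^{1/1^*}\le C_1[w]_{A_1}^{1/1^*}\lVert\partial E\rVert_{w^{1/1^*}}(\mathbb{R}^n).$$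
   Context: $A_1^*$ weights (everywhere version): $w:\mathbb{R}^n\to[0,\infty]$ belongs to $A_1$ if $w\in L^1_{\mathrm{loc}}(\mathbb{R}^n)$ and there is $C>0$ with $\frac{1}{|B|}\int_B w\,dx\le C\inf_{x\in B}w(x)$ (a true infimum) for all balls $B\subseteq\mathbb{R}^n$; $[w]_{A_1}$ is the smallest such $C$. $w\in A_1^*$ means $w\in A_1$ and $w$ is lower semicontinuous. The case $w\equiv0$ is excluded, so $w>0$ everywhere. $w(E)=\int_E w\,dx$. For a measurable weight $v:\mathbb{R}^n\to(0,\infty]$ and $p\geq 1$, $\lVert f\rVert_{L^p(\mathbb{R}^n;v)}=(\int|f|^p v\,dx)^{1/p}$, and $$\lVert Df\rVert_v(\mathbb{R}^n):=\sup\left\{\int_{\mathbb{R}^n} f\operatorname{div}\varphi\,dx:\varphi\in\mathrm{Lip}_c(\mathbb{R}^n;\mathbb{R}^n),\ |\varphi|\le v\right\}\in[0,\infty],$$ where $\mathrm{Lip}_c$ denotes compactly supported Lipschitz maps; $\lVert\partial E\rVert_v(\mathbb{R}^n):=\lVert D\chi_E\rVert_v(\mathbb{R}^n)$. $BV(\mathbb{R}^n;w)$ is the space of $f\in L^1(\mathbb{R}^n;w)$ with $\lVert Df\rVert_w(\mathbb{R}^n)<\infty$. $E$ has finite $w$-perimeter in $\mathbb{R}^n$ if $\chi_E\in BV(\mathbb{R}^n;w)$. $W^{1,1}(\mathbb{R}^n;w)$ is the space of $f\in L^1(\mathbb{R}^n;w)$ with weak gradient $Df$ satisfying $|Df|\in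 L^1(\mathbb{R}^n;w)$. $M$ is the uncentered Hardy–Littlewood maximal operator over balls. The Pérez–Rela theorem states: if $\mu$ is a locally finite Borel measure on $\mathbb{R}^n$ with $M\mu<\infty$ a.e., then there is a constant $C_1>0$ such that $\lVert g\rVert_{L^{1^*}(\mathbb{R}^n;\mu)}\le C_1\lVert Dg\rVert_{L^1(\mathbb{R}^n;(M\mu)^{1/1^*})}$ for all $g\in W^{1,1}(\mathbb{R}^n;\mu)$; it applies to $d\mu=w\,dx$ with $w\in A_1$, where $M\mu=Mw$. Every $f\in BV(\mathbb{R}^n;w)$ lies in the classical space $BV_{\mathrm{loc}}(\mathbb{R}^n)$, and $\lVert Df\rVert$ denotes its classical (unweighted) total variation Radon measure. For a weight $v$, $f$ is called $v$-approximable if $$\lim_{\varepsilon\to0}\frac{1}{|B(x,\varepsilon)|}\int_{B(x,\varepsilon)}|v(y)-v(x)|\,dy=0\quad\text{for }\lVert Df\rVert\text{-a.e. }x.$$ *)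

theory Defs
  imports "HOL-Analysis.Analysis"
begin

section \<open>Extended nonnegative weights\<close>

text \<open>Power with exponent \<open>p > 0\<close>, so that \<open>0\<close> goes to \<open>0\<close> and \<open>\<infinity>\<close> to \<open>\<infinity>\<close>.\<close>

definition epowr :: "ennreal \<Rightarrow> real \<Rightarrow> ennreal" where
  "epowr a p = (if a = \<infinity> then \<infinity> else ennreal (enn2real a powr p))"

text \<open>The subtraction of \<^typ>\<open>ennreal\<close> is truncated at \<open>0\<close>, so one of the two summands
  vanishes, except that the distance of \<open>\<infinity>\<close> to itself is \<open>\<infinity>\<close>.\<close>

definition edist :: "ennreal \<Rightarrow> ennreal \<Rightarrow> ennreal" where
  "edist a b = (a - b) + (b - a)"

definition ball_mean :: "('a::euclidean_space \<Rightarrow> ennreal) \<Rightarrow> 'a \<Rightarrow> real \<Rightarrow> ennreal" where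
  "ball_mean u x r = (\<integral>\<^sup>+y\<in>ball x r. u y \<partial>lebesgue) / emeasure lebesgue (ball x r)"

text \<open>The uncentered Hardy--Littlewood maximal function: all balls containing \<open>x\<close> compete.\<close>

definition maximal_fun :: "('a::euclidean_space \<Rightarrow> ennreal) \<Rightarrow> 'a \<Rightarrow> ennreal" where
  "maximal_fun u x = (SUP (z, r) \<in> {(z, r). x \<in> ball z r}. ball_mean u z r)"

definition locally_integrable_weight :: "('a::euclidean_space \<Rightarrow> ennreal) \<Rightarrow> bool" where
  "locally_integrable_weight w \<longleftrightarrow>
     w \<in> borel_measurable lebesgue \<and> (\<forall>K. compact K \<longrightarrow> (\<integral>\<^sup>+x\<in>K. w x \<partial>lebesgue) < \<infinity>)"

definition A1_bound :: "('a::euclidean_space \<Rightarrow> ennreal) \<Rightarrow> real \<Rightarrow> bool" where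
  "A1_bound w C \<longleftrightarrow> C > 0 \<and>
     (\<forall>x r. r > 0 \<longrightarrow> ball_mean w x r \<le> ennreal C * (INF y\<in>ball x r. w y))"

definition A1_weight :: "('a::euclidean_space \<Rightarrow> ennreal) \<Rightarrow> bool" where
  "A1_weight w \<longleftrightarrow> locally_integrable_weight w \<and> (\<exists>C. A1_bound w C)"

definition A1_const :: "('a::euclidean_space \<Rightarrow> ennreal) \<Rightarrow> real" where
  "A1_const w = Inf {C. A1_bound w C}"

definition lower_semicontinuous :: "('a::topological_space \<Rightarrow> ennreal) \<Rightarrow> bool" where
  "lower_semicontinuous w \<longleftrightarrow> (\<forall>t. open {x. t < w x})"

definition A1_star_weight :: "('a::euclidean_space \<Rightarrow> ennreal) \<Rightarrow> bool" where
  "A1_star_weight w \<longleftrightarrow> A1_weight w \<and> lower_semicontinuous w \<and> w \<noteq> (\<lambda>_. 0)"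


section \<open>Weighted Lebesgue spaces\<close>

text \<open>Intended for \<open>p \<ge> 1\<close>; the convention \<open>0 * \<infinity> = 0\<close> is in force in the integrand.\<close>

definition weighted_Lp_norm ::
    "real \<Rightarrow> ('a::euclidean_space \<Rightarrow> ennreal) \<Rightarrow> ('a \<Rightarrow> 'b::real_normed_vector) \<Rightarrow> ennreal" where
  "weighted_Lp_norm p v f =
     epowr (\<integral>\<^sup>+x. ennreal (norm (f x) powr p) * v x \<partial>lebesgue) (1 / p)"

definition weighted_L1 ::
    "('a::euclidean_space \<Rightarrow> ennreal) \<Rightarrow> ('a \<Rightarrow> 'b::euclidean_space) set" where
  "weighted_L1 v = {f. f \<in> borel_measurable lebesgue \<and> weighted_Lp_norm 1 v f < \<infinity>}"

definition locally_integrable :: "('a::euclidean_space \<Rightarrow> 'b::euclidean_space) \<Rightarrow> bool" where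
  "locally_integrable f \<longleftrightarrow> (\<forall>K. compact K \<longrightarrow> set_integrable lebesgue K f)"


section \<open>Test functions, weak gradients and Sobolev functions\<close>

definition compactly_supported_in :: "('a::euclidean_space \<Rightarrow> 'b::zero) \<Rightarrow> 'a set \<Rightarrow> bool" where
  "compactly_supported_in \<phi> U \<longleftrightarrow>
     compact (closure {x. \<phi> x \<noteq> 0}) \<and> closure {x. \<phi> x \<noteq> 0} \<subseteq> U"

definition C1c :: "'a::euclidean_space set \<Rightarrow> ('a \<Rightarrow> 'b::euclidean_space) set" where
  "C1c U = {\<phi>. (\<exists>\<phi>'. (\<forall>x. (\<phi> has_derivative blinfun_apply (\<phi>' x)) (at x)) \<and> continuous_on UNIV \<phi>')
             \<and> compactly_supported_in \<phi> U}"

definition Lipc :: "('a::euclidean_space \<Rightarrow> 'b::euclidean_space) set" where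
  "Lipc = {\<phi>. (\<exists>L. L-lipschitz_on UNIV \<phi>) \<and> compactly_supported_in \<phi> UNIV}"

text \<open>For a Lipschitz map the partial derivatives exist outside a Lebesgue null set; the
  unspecified values that \<^const>\<open>deriv\<close> takes on it do not influence integrals.\<close>

definition partial_deriv :: "'a::euclidean_space \<Rightarrow> ('a \<Rightarrow> real) \<Rightarrow> 'a \<Rightarrow> real" where
  "partial_deriv i f x = deriv (\<lambda>t. f (x + t *\<^sub>R i)) 0"

definition divergence :: "('a::euclidean_space \<Rightarrow> 'a) \<Rightarrow> 'a \<Rightarrow> real" where
  "divergence \<phi> x = (\<Sum>i\<in>Basis. partial_deriv i (\<lambda>y. \<phi> y \<bullet> i) x)"

definition has_weak_gradient ::
    "('a::euclidean_space \<Rightarrow> real) \<Rightarrow> ('a \<Rightarrow> 'a) \<Rightarrow> bool" where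
  "has_weak_gradient g G \<longleftrightarrow> locally_integrable g \<and> locally_integrable G \<and>
     (\<forall>\<phi>\<in>C1c UNIV. \<forall>i\<in>Basis.
        (\<integral>x. g x * partial_deriv i \<phi> x \<partial>lebesgue) = - (\<integral>x. (G x \<bullet> i) * \<phi> x \<partial>lebesgue))"

definition weighted_W11 :: "('a::euclidean_space \<Rightarrow> ennreal) \<Rightarrow> ('a \<Rightarrow> real) set" where
  "weighted_W11 w = {g \<in> weighted_L1 w. \<exists>G. has_weak_gradient g G \<and> G \<in> weighted_L1 w}"


section \<open>Total variation and functions of bounded variation\<close>

text \<open>In the suprema below the field \<open>0\<close> is admissible, so cutting off negative integrals with
  \<^const>\<open>ennreal\<close> does not change their value.\<close>

definition weighted_variation ::
    "('a::euclidean_space \<Rightarrow> ennreal) \<Rightarrow> ('a \<Rightarrow> real) \<Rightarrow> ennreal" where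
  "weighted_variation v f =
     (SUP \<phi> \<in> {\<phi> \<in> Lipc. \<forall>x. ennreal (norm (\<phi> x)) \<le> v x}.
        ennreal (\<integral>x. f x * divergence \<phi> x \<partial>lebesgue))"

definition weighted_perimeter ::
    "('a::euclidean_space \<Rightarrow> ennreal) \<Rightarrow> 'a set \<Rightarrow> ennreal" where
  "weighted_perimeter v E = weighted_variation v (indicat_real E)"

definition weighted_BV :: "('a::euclidean_space \<Rightarrow> ennreal) \<Rightarrow> ('a \<Rightarrow> real) set" where
  "weighted_BV w = {f \<in> weighted_L1 w. weighted_variation w f < \<infinity>}"

definition finite_weighted_perimeter ::
    "('a::euclidean_space \<Rightarrow> ennreal) \<Rightarrow> 'a set \<Rightarrow> bool" where
  "finite_weighted_perimeter w E \<longleftrightarrow> indicat_real E \<in> weighted_BV w"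

definition variation_on :: "('a::euclidean_space \<Rightarrow> real) \<Rightarrow> 'a set \<Rightarrow> ennreal" where
  "variation_on f U =
     (SUP \<phi> \<in> {\<phi> \<in> C1c U. \<forall>x. norm (\<phi> x) \<le> 1}.
        ennreal (\<integral>x. f x * divergence \<phi> x \<partial>lebesgue))"

text \<open>The classical (unweighted) total variation measure: the values on open sets, extended to
  Borel sets by outer regularity. For a locally integrable \<open>f\<close> the set function given to
  \<^const>\<open>measure_of\<close> is countably additive on Borel sets (De Giorgi--Letta), so the measure
  has exactly these values; it is a Radon measure if \<open>f\<close> is locally of bounded variation.\<close>

definition variation_measure :: "('a::euclidean_space \<Rightarrow> real) \<Rightarrow> 'a measure" where
  "variation_measure f =
     measure_of UNIV (sets borel) (\<lambda>A. INF U \<in> {U. open U \<and> A \<subseteq> U}. variation_on f U)"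

definition approximable ::
    "('a::euclidean_space \<Rightarrow> ennreal) \<Rightarrow> ('a \<Rightarrow> real) \<Rightarrow> bool" where
  "approximable v f \<longleftrightarrow>
     (AE x in variation_measure f.
        ((\<lambda>\<epsilon>. ball_mean (\<lambda>y. edist (v y) (v x)) x \<epsilon>) \<longlongrightarrow> 0) (at_right 0))"

end

theory Submission
  imports Defs
begin

text \<open>Let \<open>p = 1 / s\<close>, \<open>c\<close> the A1 constant of \<open>w\<close> and \<open>v = w\<close> raised to \<open>p\<close>. The Sobolev inequality is
  applied to \<open>g = k * \<chi>\<^sub>E\<close> with smooth kernels \<open>k\<close> of radius tending to \<open>0\<close>. Since the maximal function of \<open>w\<close>
  is at most \<open>c * w\<close>, its right-hand side is at most \<open>C1 * c powr p\<close> times the integral of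
  \<open>norm (grad g) * v\<close> (\<open>sobolev_mollified_indicator\<close>). Along a subsequence \<open>g\<close> converges to \<open>1\<close> almost
  everywhere on bounded parts of \<open>E\<close>, so Fatou's lemma handles the left-hand side
  (\<open>weighted_measure_le_of_mollified\<close>). What remains is to bound the gradient integral by the weighted
  perimeter.

  This rests on duality (\<open>gradient_integral_dual\<close>): the gradient integral is a supremum of integrals of
  \<open>grad g \<bullet> \<psi>\<close> over bounded fields \<open>\<psi>\<close> of compact support with \<open>norm \<psi> \<le> v\<close>, and Fubini's theorem moves
  the kernel from \<open>\<chi>\<^sub>E\<close> to \<open>\<psi>\<close>. The mollified field \<open>k * \<psi>\<close> is a smooth test field for \<open>E\<close>, bounded by
  \<open>k * v\<close>. Using only continuously differentiable test fields avoids the differentiability theory of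
  Lipschitz maps.

  By Young's inequality \<open>v\<close> is an A1 weight with constant \<open>c powr p\<close>. The kernels are chosen below
  \<open>1 + \<delta>\<close> times the uniform density on a ball, hence \<open>k * v \<le> (1 + \<delta>) * c powr p * v\<close>. Scaling the test
  field bounds the gradient integral by \<open>(1 + \<delta>) * c powr p\<close> times the perimeter
  (\<open>gradient_integral_le_A1\<close>), and \<open>\<delta> \<rightarrow> 0\<close> gives the first inequality.

  For the second one the factor \<open>c powr p\<close> must not be spent on \<open>k * v\<close>. The gradient integral is at most
  the integral of \<open>k * v\<close> with respect to the total variation measure \<open>\<mu>\<close> of \<open>\<chi>\<^sub>E\<close>. Approximability says
  that \<open>k * v \<rightarrow> v\<close> holds \<open>\<mu>\<close>-almost everywhere, the A1 bound provides domination, and so the limit is at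
  most the integral of \<open>v\<close> with respect to \<open>\<mu>\<close>, which lower semicontinuity of \<open>v\<close> bounds by the weighted
  perimeter (\<open>gradient_integral_eventually_le\<close>). This needs \<open>\<mu>\<close> to be a Borel measure with the prescribed
  values on open sets, which is the theorem of De Giorgi and Letta (\<open>variation_measure_props\<close>), and the
  comparison of the pairing of \<open>\<chi>\<^sub>E\<close> and a field with an integral over \<open>\<mu>\<close> (\<open>div_pairing_le_integral\<close>,
  \<open>integral_le_weighted_variation\<close>).\<close>


section \<open>Powers of extended weights\<close>

lemma epowr_ennreal: "0 \<le> x \<Longrightarrow> epowr (ennreal x) p = ennreal (x powr p)"
  by (simp add: epowr_def)

lemma epowr_top [simp]: "epowr \<infinity> p = \<infinity>" "epowr top p = top"
  by (simp_all add: epowr_def)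

lemma epowr_less_mono:
  assumes "0 < p" and "a < b"
  shows "epowr a p < epowr b p"
proof (cases b)
  case (real y)
  then obtain x where x: "a = ennreal x" "0 \<le> x"
    using assms(2) by (cases a) auto
  have "x < y"
    using assms(2) real x by (simp add: ennreal_less_iff)
  then have "x powr p < y powr p"
    using assms(1) x(2) by (simp add: powr_less_mono2)
  then show ?thesis
    using real x by (simp add: epowr_ennreal ennreal_less_iff)
next
  case top
  then show ?thesis
    using assms(2) by (cases a) (auto simp: epowr_ennreal)
qed

lemma epowr_mono: "0 < p \<Longrightarrow> a \<le> b \<Longrightarrow> epowr a p \<le> epowr b p"
  using epowr_less_mono[of p a b] by (cases "a = b") (auto simp: less_le)

lemma epowr_epowr: "epowr (epowr a p) q = epowr a (p * q)"
  by (cases a) (auto simp: epowr_ennreal powr_powr)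

lemma epowr_one [simp]: "epowr a 1 = a"
  by (cases a) (auto simp: epowr_ennreal)

lemma less_epowr_iff:
  assumes "0 < p"
  shows "t < epowr a p \<longleftrightarrow> epowr t (1 / p) < a"
proof -
  have t: "epowr (epowr t (1 / p)) p = t" and a: "epowr (epowr a p) (1 / p) = a"
    using assms by (simp_all add: epowr_epowr)
  show ?thesis
    using epowr_less_mono[of p "epowr t (1 / p)" a] epowr_less_mono[of "1 / p" t "epowr a p"]
      assms t a by auto
qed

lemma epowr_le_iff:
  assumes "0 < p"
  shows "epowr a p \<le> t \<longleftrightarrow> a \<le> epowr t (1 / p)"
  using less_epowr_iff[of "1 / p" a t] less_epowr_iff[of p t a] assms by (auto simp: not_less[symmetric])

lemma epowr_cmult:
  assumes "0 < c"
  shows "epowr (ennreal c * a) p = ennreal (c powr p) * epowr a p"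
proof (cases a)
  case (real x)
  then show ?thesis
    using assms by (simp add: epowr_ennreal powr_mult ennreal_mult flip: ennreal_mult)
next
  case top
  then show ?thesis
    using assms by (simp add: ennreal_mult_top)
qed

lemma lower_semicontinuous_epowr:
  assumes "0 < p" and "lower_semicontinuous w"
  shows "lower_semicontinuous (\<lambda>x. epowr (w x) p)"
  using assms by (simp add: lower_semicontinuous_def less_epowr_iff)

lemma lower_semicontinuous_borel:
  "lower_semicontinuous w \<Longrightarrow> w \<in> borel_measurable borel"
  by (auto simp: lower_semicontinuous_def intro!: borel_measurableI_greater)


section \<open>Weights of class A1\<close>

lemma ennreal_divide_le_iff: "0 < m \<Longrightarrow> a / ennreal m \<le> b \<longleftrightarrow> a \<le> b * ennreal m"
proof
  assume m: "0 < m" and "a / ennreal m \<le> b"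
  then have "a / ennreal m * ennreal m \<le> b * ennreal m"
    by (intro mult_right_mono) auto
  also have "a / ennreal m * ennreal m = a"
    using m by (simp add: ennreal_divide_times)
  finally show "a \<le> b * ennreal m" .
next
  assume "0 < m" and "a \<le> b * ennreal m"
  then show "a / ennreal m \<le> b"
    by (intro divide_le_posI_ennreal) (auto simp: mult.commute)
qed

lemma ennreal_le_divide_iff: "0 < m \<Longrightarrow> b \<le> a / ennreal m \<longleftrightarrow> b * ennreal m \<le> a"
  using divide_less_ennreal[of "ennreal m" a b] by (simp flip: not_less)

lemma emeasure_ball_eq:
  fixes x :: "'a::euclidean_space"
  shows "emeasure lebesgue (ball x r) = ennreal (measure lborel (ball (0::'a) r))"
    and "emeasure lborel (ball x r) = ennreal (measure lborel (ball (0::'a) r))"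
proof -
  show *: "emeasure lborel (ball x r) = ennreal (measure lborel (ball (0::'a) r))"
  proof (cases "0 \<le> r")
    case True
    then show ?thesis
      by (simp add: emeasure_ball content_ball)
  qed (simp add: ball_empty)
  then show "emeasure lebesgue (ball x r) = ennreal (measure lborel (ball (0::'a) r))"
    by simp
qed

lemma ball_mean_eq:
  fixes x :: "'a::euclidean_space"
  shows "ball_mean u x r = (\<integral>\<^sup>+y\<in>ball x r. u y \<partial>lborel) / ennreal (measure lborel (ball (0::'a) r))"
  unfolding ball_mean_def emeasure_ball_eq by (simp add: nn_integral_completion)

lemma ball_mean_le_iff:
  fixes x :: "'a::euclidean_space"
  assumes "0 < r"
  shows "ball_mean u x r \<le> a \<longleftrightarrow>
    (\<integral>\<^sup>+y\<in>ball x r. u y \<partial>lborel) \<le> a * ennreal (measure lborel (ball (0::'a) r))"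
  unfolding ball_mean_eq using content_ball_pos[OF assms, of "0::'a"]
  by (rule ennreal_divide_le_iff)

lemma A1_boundD:
  fixes x :: "'a::euclidean_space"
  assumes "A1_bound w C" "y \<in> ball x r"
  shows "ball_mean w x r \<le> ennreal C * w y"
proof -
  have "0 < r"
    using assms(2) by (metis ball_eq_empty empty_iff not_le)
  then have "ball_mean w x r \<le> ennreal C * (INF y\<in>ball x r. w y)"
    using assms(1) by (simp add: A1_bound_def)
  also have "\<dots> \<le> ennreal C * w y"
    by (intro mult_left_mono INF_lower assms(2)) simp
  finally show ?thesis .
qed

lemma maximal_fun_le: "A1_bound w C \<Longrightarrow> maximal_fun w x \<le> ennreal C * w x"
  unfolding maximal_fun_def by (intro SUP_least) (auto intro: A1_boundD)

lemma lower_semicontinuous_integral_pos: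
  fixes w :: "'a::euclidean_space \<Rightarrow> ennreal"
  assumes "lower_semicontinuous w" "open U" "x \<in> U" "0 < w x"
  shows "0 < (\<integral>\<^sup>+y\<in>U. w y \<partial>lborel)"
proof -
  obtain t where t: "0 < t" "t < w x"
    using assms(4) dense by blast
  have "open (U \<inter> {y. t < w y})"
    using assms(1,2) by (auto simp: lower_semicontinuous_def)
  then obtain e where e: "0 < e" "ball x e \<subseteq> U \<inter> {y. t < w y}"
    using assms(3) t(2) openE by blast
  have "0 < t * emeasure lborel (ball x e)"
    using t(1) e(1) unfolding emeasure_ball_eq
    by (simp add: ennreal_zero_less_mult_iff content_ball_pos)
  also have "\<dots> = (\<integral>\<^sup>+y. t * indicator (ball x e) y \<partial>lborel)"
    by (simp add: nn_integral_cmult_indicator)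
  also have "\<dots> \<le> (\<integral>\<^sup>+y\<in>U. w y \<partial>lborel)"
    using e(2) by (intro nn_integral_mono) (auto simp: indicator_def dest!: subsetD intro: less_imp_le)
  finally show ?thesis .
qed

lemma A1_star_weight_integrable_ball:
  fixes w :: "'a::euclidean_space \<Rightarrow> ennreal"
  assumes "A1_star_weight w"
  shows "(\<integral>\<^sup>+y\<in>ball x r. w y \<partial>lborel) < \<infinity>"
proof -
  have "(\<integral>\<^sup>+y\<in>ball x r. w y \<partial>lborel) \<le> (\<integral>\<^sup>+y\<in>cball x r. w y \<partial>lborel)"
    by (intro nn_integral_mono) (auto simp: indicator_def)
  also have "\<dots> < \<infinity>"
    using assms by (simp add: A1_star_weight_def A1_weight_def locally_integrable_weight_def
        nn_integral_completion)
  finally show ?thesis .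
qed

text \<open>If \<open>w\<close> vanishes at one point, the A1 bound makes its integral over every ball around that
  point vanish, whereas lower semicontinuity spreads a positive value over a ball.\<close>

lemma A1_star_weight_pos:
  fixes w :: "'a::euclidean_space \<Rightarrow> ennreal"
  assumes "A1_star_weight w"
  shows "0 < w z"
proof (rule ccontr)
  assume z: "\<not> 0 < w z"
  obtain C where C: "A1_bound w C"
    using assms by (auto simp: A1_star_weight_def A1_weight_def)
  obtain x where x: "0 < w x"
    using assms by (force simp: A1_star_weight_def zero_less_iff_neq_zero)
  define r where "r = dist x z + 1"
  have r: "z \<in> ball x r" "0 < r"
    by (auto simp: r_def add_nonneg_pos)
  then have "ball_mean w x r \<le> 0"
    using A1_boundD[OF C r(1)] z by simp
  then have "(\<integral>\<^sup>+y\<in>ball x r. w y \<partial>lborel) = 0"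
    using ball_mean_le_iff[OF r(2), of w x 0] by simp
  moreover have "0 < (\<integral>\<^sup>+y\<in>ball x r. w y \<partial>lborel)"
    using assms x r(2) by (intro lower_semicontinuous_integral_pos[of w _ x])
      (auto simp: A1_star_weight_def)
  ultimately show False
    by simp
qed

lemma A1_star_weight_INF_ball:
  fixes w :: "'a::euclidean_space \<Rightarrow> ennreal"
  assumes "A1_star_weight w" "0 < r"
  shows "0 < (INF y\<in>ball x r. w y)" "(INF y\<in>ball x r. w y) < \<infinity>"
    "(INF y\<in>ball x r. w y) \<le> ball_mean w x r"
proof -
  define I where "I = (INF y\<in>ball x r. w y)"
  define m where "m = measure lborel (ball (0::'a) r)"
  have m: "0 < m"
    using assms(2) by (simp add: m_def content_ball_pos)
  have int_pos: "0 < (\<integral>\<^sup>+y\<in>ball x r. w y \<partial>lborel)"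
    using assms A1_star_weight_pos[OF assms(1), of x]
    by (intro lower_semicontinuous_integral_pos[of w _ x]) (auto simp: A1_star_weight_def)
  have int_fin: "(\<integral>\<^sup>+y\<in>ball x r. w y \<partial>lborel) < \<infinity>"
    by (rule A1_star_weight_integrable_ball[OF assms(1)])
  obtain C where C: "A1_bound w C"
    using assms by (auto simp: A1_star_weight_def A1_weight_def)
  then have le: "ball_mean w x r \<le> ennreal C * I"
    using assms(2) by (simp add: A1_bound_def I_def)
  have "I * ennreal m = (\<integral>\<^sup>+y. I * indicator (ball x r) y \<partial>lborel)"
    using emeasure_ball_eq(2)[of x r] by (simp add: nn_integral_cmult_indicator m_def)
  also have "\<dots> \<le> (\<integral>\<^sup>+y\<in>ball x r. w y \<partial>lborel)"
    by (intro nn_integral_mono) (auto simp: indicator_def I_def intro: INF_lower)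
  finally have Im: "I * ennreal m \<le> (\<integral>\<^sup>+y\<in>ball x r. w y \<partial>lborel)" .
  then have "I * ennreal m < \<infinity>"
    using int_fin by (rule le_less_trans)
  then show "(INF y\<in>ball x r. w y) < \<infinity>"
    using m unfolding I_def[symmetric] by (auto simp: ennreal_mult_less_top)
  show "(INF y\<in>ball x r. w y) \<le> ball_mean w x r"
    using Im unfolding I_def[symmetric] ball_mean_eq m_def[symmetric] ennreal_le_divide_iff[OF m] .
  have "I \<noteq> 0"
  proof
    assume "I = 0"
    then have "ball_mean w x r \<le> 0"
      using le by simp
    then show False
      using int_pos ball_mean_le_iff[OF assms(2), of w x 0] by simp
  qed
  then show "0 < (INF y\<in>ball x r. w y)"
    unfolding I_def[symmetric] by (simp add: zero_less_iff_neq_zero)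
qed

lemma A1_bound_ge_1:
  fixes w :: "'a::euclidean_space \<Rightarrow> ennreal"
  assumes w: "A1_star_weight w" and C: "A1_bound w C"
  shows "1 \<le> C"
proof (rule ccontr)
  assume "\<not> 1 \<le> C"
  obtain i where i: "(INF y\<in>ball (0::'a) 1. w y) = ennreal i" "0 < i"
    using A1_star_weight_INF_ball(1,2)[OF w, of 1 0]
    by (cases "INF y\<in>ball (0::'a) 1. w y") auto
  have "ennreal i \<le> ball_mean w 0 1"
    using A1_star_weight_INF_ball(3)[OF w, of 1 0] i by simp
  also have "\<dots> \<le> ennreal C * ennreal i"
    using C i by (metis A1_bound_def zero_less_one)
  finally have "i \<le> C * i"
    using i(2) C by (simp add: A1_bound_def flip: ennreal_mult)
  then show False
    using i(2) \<open>\<not> 1 \<le> C\<close> by simp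
qed

text \<open>The infimum defining the A1 constant is attained, because for each fixed ball the admissible
  constants form a closed half line.\<close>

lemma A1_bound_A1_const:
  fixes w :: "'a::euclidean_space \<Rightarrow> ennreal"
  assumes w: "A1_star_weight w"
  shows "A1_bound w (A1_const w)" "1 \<le> A1_const w"
proof -
  have ne: "{C. A1_bound w C} \<noteq> {}"
    using w by (auto simp: A1_star_weight_def A1_weight_def)
  show ge1: "1 \<le> A1_const w"
    unfolding A1_const_def using A1_bound_ge_1[OF w] by (intro cInf_greatest[OF ne]) auto
  show "A1_bound w (A1_const w)"
    unfolding A1_bound_def
  proof (intro conjI allI impI)
    show "0 < A1_const w"
      using ge1 by simp
    fix x :: 'a and r :: real
    assume r: "0 < r"
    obtain i where i: "(INF y\<in>ball x r. w y) = ennreal i" "0 < i"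
      using A1_star_weight_INF_ball(1,2)[OF w r, of x]
      by (cases "INF y\<in>ball x r. w y") auto
    have le: "ball_mean w x r \<le> ennreal C * ennreal i" if "A1_bound w C" for C
      using that r i by (metis A1_bound_def)
    have "ball_mean w x r < \<infinity>"
      using ne le by (metis (no_types, lifting) Collect_empty_eq ennreal_less_top ennreal_mult''
          i(2) infinity_ennreal_def le_less_trans less_eq_real_def)
    then obtain m where m: "ball_mean w x r = ennreal m" "0 \<le> m"
      by (cases "ball_mean w x r") auto
    have "m / i \<le> C" if "A1_bound w C" for C
      using le[OF that] m i(2) that
      by (simp add: A1_bound_def divide_le_eq flip: ennreal_mult)
    then have "m / i \<le> A1_const w"
      unfolding A1_const_def by (intro cInf_greatest[OF ne]) auto
    then have "m \<le> A1_const w * i"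
      using i(2) by (simp add: divide_le_eq)
    then show "ball_mean w x r \<le> ennreal (A1_const w) * (INF y\<in>ball x r. w y)"
      using i m ge1 by (simp flip: ennreal_mult)
  qed
qed

text \<open>Jensen's inequality for the concave power \<open>p < 1\<close>, obtained by integrating Young's inequality
  \<open>t powr p * a powr (1 - p) \<le> p * t + (1 - p) * a\<close> in \<open>t = u y\<close> for an upper bound \<open>a\<close> of the mean.\<close>

lemma ball_mean_epowr_le:
  fixes u :: "'a::euclidean_space \<Rightarrow> ennreal"
  assumes u [measurable]: "u \<in> borel_measurable borel" and p: "0 < p" "p < 1" and r: "0 < r"
    and a: "0 < a" "ball_mean u x r \<le> ennreal a"
  shows "ball_mean (\<lambda>y. epowr (u y) p) x r \<le> ennreal (a powr p)"
proof -
  define m where "m = measure lborel (ball (0::'a) r)"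
  have m: "0 < m"
    using r by (simp add: m_def content_ball_pos)
  have young: "epowr t p \<le> ennreal (p * a powr (p - 1)) * t + ennreal ((1 - p) * a powr p)" for t
  proof (cases t)
    case (real z)
    have "z powr p * a powr (1 - p) \<le> p * z + (1 - p) * a"
    proof (cases "z = 0")
      case False
      then show ?thesis
        using Youngs_inequality_0[of p "1 - p" z a] p a(1) real by simp
    qed (use p a(1) in simp)
    then have "z powr p * a powr (1 - p) * a powr (p - 1) \<le> (p * z + (1 - p) * a) * a powr (p - 1)"
      by (intro mult_right_mono) auto
    moreover have "a powr (1 - p) * a powr (p - 1) = 1" "a * a powr (p - 1) = a powr p"
      using a(1) powr_mult_base[of a "p - 1"] by (simp_all flip: powr_add)
    moreover from this have "a * (p * a powr (p - 1)) = p * a powr p"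
      by (simp add: mult.left_commute)
    ultimately have "z powr p \<le> p * a powr (p - 1) * z + (1 - p) * a powr p"
      by (simp add: algebra_simps)
    then show ?thesis
      using real p a(1) by (simp add: epowr_ennreal flip: ennreal_mult ennreal_plus)
  next
    case top
    then show ?thesis
      using p a(1) by (simp add: ennreal_mult_top)
  qed
  have [measurable]: "ball x r \<in> sets borel"
    by simp
  have split: "(\<integral>\<^sup>+y. K * (u y * indicator (ball x r) y) + L * indicator (ball x r) y \<partial>lborel)
      = K * (\<integral>\<^sup>+y\<in>ball x r. u y \<partial>lborel) + L * ennreal m" for K L
  proof -
    have "(\<integral>\<^sup>+y. L * indicator (ball x r) y \<partial>lborel) = L * ennreal m"
      unfolding m_def emeasure_ball_eq(2)[of x r, symmetric]
      by (rule nn_integral_cmult_indicator) simp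
    moreover have "(\<integral>\<^sup>+y. K * (u y * indicator (ball x r) y) \<partial>lborel)
        = K * (\<integral>\<^sup>+y\<in>ball x r. u y \<partial>lborel)"
      by (rule nn_integral_cmult) measurable
    ultimately show ?thesis
      by (subst nn_integral_add) auto
  qed
  have "(\<integral>\<^sup>+y\<in>ball x r. epowr (u y) p \<partial>lborel)
      \<le> (\<integral>\<^sup>+y. ennreal (p * a powr (p - 1)) * (u y * indicator (ball x r) y)
            + ennreal ((1 - p) * a powr p) * indicator (ball x r) y \<partial>lborel)"
    using young by (intro nn_integral_mono) (auto simp: indicator_def)
  also have "\<dots> = ennreal (p * a powr (p - 1)) * (\<integral>\<^sup>+y\<in>ball x r. u y \<partial>lborel)
      + ennreal ((1 - p) * a powr p) * ennreal m"
    by (rule split)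
  also have "\<dots> \<le> ennreal (p * a powr (p - 1)) * (ennreal a * ennreal m)
      + ennreal ((1 - p) * a powr p) * ennreal m"
    using a(2) ball_mean_le_iff[OF r] by (intro add_mono mult_left_mono) (auto simp: m_def)
  also have "\<dots> = ennreal (p * a powr (p - 1) * (a * m) + (1 - p) * a powr p * m)"
    using p a(1) m by (simp add: ennreal_mult)
  also have "p * a powr (p - 1) * (a * m) + (1 - p) * a powr p * m
      = p * (a * a powr (p - 1)) * m + (1 - p) * a powr p * m"
    by simp
  also have "\<dots> = a powr p * m"
    using a(1) powr_mult_base[of a "p - 1"] by (simp add: left_diff_distrib)
  also have "ennreal (a powr p * m) = ennreal (a powr p) * ennreal m"
    using m by (simp add: ennreal_mult)
  finally show ?thesis
    unfolding ball_mean_le_iff[OF r] m_def .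
qed

lemma A1_bound_epowr:
  fixes w :: "'a::euclidean_space \<Rightarrow> ennreal"
  assumes w: "w \<in> borel_measurable borel" "\<And>x. 0 < w x" and p: "0 < p" "p < 1"
    and C: "A1_bound w C"
  shows "A1_bound (\<lambda>x. epowr (w x) p) (C powr p)"
  unfolding A1_bound_def
proof (intro conjI allI impI)
  have "0 < C"
    using C by (simp add: A1_bound_def)
  then show Cp: "0 < C powr p"
    by simp
  fix x :: 'a and r :: real
  assume r: "0 < r"
  have le: "ball_mean (\<lambda>y. epowr (w y) p) x r \<le> ennreal (C powr p) * epowr (w y) p"
    if "y \<in> ball x r" for y
  proof (cases "w y")
    case (real z)
    then have z: "0 < z"
      using w(2)[of y] by simp
    have "ball_mean w x r \<le> ennreal (C * z)"
      using A1_boundD[OF C that] real \<open>0 < C\<close> by (simp add: ennreal_mult)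
    then have "ball_mean (\<lambda>y. epowr (w y) p) x r \<le> ennreal ((C * z) powr p)"
      using ball_mean_epowr_le[OF w(1) p r] z \<open>0 < C\<close> by simp
    then show ?thesis
      using real \<open>0 < C\<close> by (simp add: epowr_ennreal powr_mult ennreal_mult)
  next
    case top
    then show ?thesis
      using \<open>0 < C\<close> by (simp add: ennreal_mult_top)
  qed
  have "ball_mean (\<lambda>y. epowr (w y) p) x r / ennreal (C powr p) \<le> (INF y\<in>ball x r. epowr (w y) p)"
    using le Cp by (intro INF_greatest divide_le_posI_ennreal) auto
  then show "ball_mean (\<lambda>y. epowr (w y) p) x r
      \<le> ennreal (C powr p) * (INF y\<in>ball x r. epowr (w y) p)"
    unfolding ennreal_divide_le_iff[OF Cp] by (simp add: mult.commute)
qed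


section \<open>Calculus of continuously differentiable maps\<close>

definition C1_map :: "('a::euclidean_space \<Rightarrow> 'b::euclidean_space) \<Rightarrow> bool" where
  "C1_map f \<longleftrightarrow>
     (\<exists>f'. (\<forall>x. (f has_derivative blinfun_apply (f' x)) (at x)) \<and> continuous_on UNIV f')"

lemma C1c_iff: "\<phi> \<in> C1c U \<longleftrightarrow> C1_map \<phi> \<and> compactly_supported_in \<phi> U"
  by (simp add: C1c_def C1_map_def)

text \<open>In finite dimension the derivative depends continuously on the base point as soon as its
  values on the basis vectors do.\<close>

lemma C1_mapI:
  fixes f :: "'a::euclidean_space \<Rightarrow> 'b::euclidean_space"
  assumes D: "\<And>x. (f has_derivative D x) (at x)"
    and cont: "\<And>i. i \<in> Basis \<Longrightarrow> continuous_on UNIV (\<lambda>x. D x i)"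
  shows "C1_map f"
proof -
  have eq: "blinfun_apply (Blinfun (D x)) = D x" for x
    using has_derivative_bounded_linear[OF D] by (rule bounded_linear_Blinfun_apply)
  show ?thesis
    unfolding C1_map_def
  proof (intro exI[of _ "\<lambda>x. Blinfun (D x)"] conjI allI)
    show "continuous_on UNIV (\<lambda>x. Blinfun (D x))"
      by (rule continuous_on_blinfun_componentwise) (simp add: eq cont)
  qed (simp add: eq D)
qed

lemma C1_mapE:
  fixes f :: "'a::euclidean_space \<Rightarrow> 'b::euclidean_space"
  assumes "C1_map f"
  obtains D where "\<And>x. (f has_derivative D x) (at x)" "\<And>h. continuous_on UNIV (\<lambda>x. D x h)"
proof -
  obtain f' where f': "\<And>x. (f has_derivative blinfun_apply (f' x)) (at x)" "continuous_on UNIV f'"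
    using assms by (auto simp: C1_map_def)
  show ?thesis
    by (rule that[OF f'(1)]) (intro continuous_intros f'(2))
qed

lemma C1_map_continuous: "C1_map f \<Longrightarrow> continuous_on UNIV f"
  by (metis C1_mapE has_derivative_continuous continuous_at_imp_continuous_on)

lemma C1_map_const: "C1_map (\<lambda>x. c)"
  by (rule C1_mapI[where D = "\<lambda>_ _. 0"]) auto

lemma C1_map_add:
  assumes "C1_map f" "C1_map g"
  shows "C1_map (\<lambda>x. f x + g x)"
proof -
  obtain D where D: "\<And>x. (f has_derivative D x) (at x)" "\<And>h. continuous_on UNIV (\<lambda>x. D x h)"
    using C1_mapE[OF assms(1)] by metis
  obtain D' where D': "\<And>x. (g has_derivative D' x) (at x)" "\<And>h. continuous_on UNIV (\<lambda>x. D' x h)"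
    using C1_mapE[OF assms(2)] by metis
  show ?thesis
    by (rule C1_mapI[where D = "\<lambda>x h. D x h + D' x h"])
      (auto intro!: has_derivative_add D D' continuous_intros)
qed

lemma C1_map_scaleR:
  fixes f :: "'a::euclidean_space \<Rightarrow> real"
  assumes "C1_map f" "C1_map g"
  shows "C1_map (\<lambda>x. f x *\<^sub>R g x)"
proof -
  obtain D where D: "\<And>x. (f has_derivative D x) (at x)" "\<And>h. continuous_on UNIV (\<lambda>x. D x h)"
    using C1_mapE[OF assms(1)] by metis
  obtain D' where D': "\<And>x. (g has_derivative D' x) (at x)" "\<And>h. continuous_on UNIV (\<lambda>x. D' x h)"
    using C1_mapE[OF assms(2)] by metis
  show ?thesis
    by (rule C1_mapI[where D = "\<lambda>x h. f x *\<^sub>R D' x h + D x h *\<^sub>R g x"])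
      (auto intro!: has_derivative_scaleR D D' continuous_intros
        C1_map_continuous[OF assms(1)] C1_map_continuous[OF assms(2)])
qed

lemma C1_map_mult: "C1_map f \<Longrightarrow> C1_map g \<Longrightarrow> C1_map (\<lambda>x. f x * g x :: real)"
  using C1_map_scaleR[of f g] by simp

lemma C1_map_diff: "C1_map f \<Longrightarrow> C1_map g \<Longrightarrow> C1_map (\<lambda>x. f x - g x)"
  using C1_map_add[of f "\<lambda>x. (-1) *\<^sub>R g x"] C1_map_scaleR[OF C1_map_const[of "-1::real"]] by auto

lemma C1_map_power: "C1_map f \<Longrightarrow> C1_map (\<lambda>x. f x ^ m :: real)"
  by (induction m) (auto intro: C1_map_const C1_map_mult)

lemma directional_derivative:
  assumes "(f has_derivative D) (at x)"
  shows "((\<lambda>t. f (x + t *\<^sub>R i)) has_real_derivative D i) (at 0)"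
proof -
  have "((\<lambda>t. x + t *\<^sub>R i) has_derivative (\<lambda>t. t *\<^sub>R i)) (at (0::real))"
    by (auto intro!: derivative_eq_intros)
  then have "((\<lambda>t. f (x + t *\<^sub>R i)) has_derivative (\<lambda>t. D (t *\<^sub>R i))) (at 0)"
    by (rule has_derivative_compose) (use assms in simp)
  moreover have "(\<lambda>t. D (t *\<^sub>R i)) = (*) (D i)"
    using has_derivative_bounded_linear[OF assms]
    by (auto simp: linear_simps(5) fun_eq_iff)
  ultimately show ?thesis
    by (simp add: has_field_derivative_def)
qed

lemma partial_deriv_eq:
  assumes "(f has_derivative D) (at x)"
  shows "partial_deriv i f x = D i"
  unfolding partial_deriv_def by (intro DERIV_imp_deriv directional_derivative assms)

lemma divergence_eq:
  assumes "(\<phi> has_derivative D) (at x)"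
  shows "divergence \<phi> x = (\<Sum>i\<in>Basis. D i \<bullet> i)"
  unfolding divergence_def
  by (intro sum.cong refl partial_deriv_eq has_derivative_inner_left assms)

lemma divergence_add:
  assumes "C1_map \<phi>" "C1_map \<psi>"
  shows "divergence (\<lambda>x. \<phi> x + \<psi> x) x = divergence \<phi> x + divergence \<psi> x"
proof -
  obtain D where D: "\<And>x. (\<phi> has_derivative D x) (at x)"
    using C1_mapE[OF assms(1)] by metis
  obtain D' where D': "\<And>x. (\<psi> has_derivative D' x) (at x)"
    using C1_mapE[OF assms(2)] by metis
  show ?thesis
    by (simp add: divergence_eq[OF has_derivative_add[OF D D']] divergence_eq[OF D]
        divergence_eq[OF D'] inner_add_left sum.distrib)
qed

lemma divergence_scaleR:
  assumes "C1_map \<phi>"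
  shows "divergence (\<lambda>x. c *\<^sub>R \<phi> x) x = c * divergence \<phi> x"
proof -
  obtain D where D: "\<And>x. (\<phi> has_derivative D x) (at x)"
    using C1_mapE[OF assms] by metis
  show ?thesis
    by (simp add: divergence_eq[OF has_derivative_scaleR_right[OF D]] divergence_eq[OF D]
        sum_distrib_left)
qed

lemma continuous_divergence:
  assumes "C1_map \<phi>"
  shows "continuous_on UNIV (divergence \<phi>)"
proof -
  obtain D where D: "\<And>x. (\<phi> has_derivative D x) (at x)" "\<And>h. continuous_on UNIV (\<lambda>x. D x h)"
    using C1_mapE[OF assms] by metis
  have "divergence \<phi> = (\<lambda>x. \<Sum>i\<in>Basis. D x i \<bullet> i)"
    using divergence_eq[OF D(1)] by auto
  then show ?thesis
    by (auto intro!: continuous_intros D)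
qed

lemma C1c_mono: "\<phi> \<in> C1c U \<Longrightarrow> U \<subseteq> W \<Longrightarrow> \<phi> \<in> C1c W"
  by (auto simp: C1c_iff compactly_supported_in_def)

lemma C1c_zero_outside: "\<phi> \<in> C1c U \<Longrightarrow> x \<notin> U \<Longrightarrow> \<phi> x = 0"
  using closure_subset[of "{x. \<phi> x \<noteq> 0}"] by (fastforce simp: C1c_iff compactly_supported_in_def)

lemma C1cI:
  assumes "C1_map \<phi>" "compact K" "K \<subseteq> U" "\<And>x. x \<notin> K \<Longrightarrow> \<phi> x = 0"
  shows "\<phi> \<in> C1c U"
proof -
  have "closure {x. \<phi> x \<noteq> 0} \<subseteq> K"
    using assms(2,4) by (intro closure_minimal) (auto intro: compact_imp_closed)
  then show ?thesis
    using assms(1-3) compact_Int_closed[of K "closure {x. \<phi> x \<noteq> 0}"]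
    by (auto simp: C1c_iff compactly_supported_in_def Int_absorb1)
qed

lemma C1cE:
  assumes "\<phi> \<in> C1c U"
  obtains K where "C1_map \<phi>" "compact K" "K \<subseteq> U" "\<And>x. x \<notin> K \<Longrightarrow> \<phi> x = 0"
proof -
  have "C1_map \<phi>" "compact (closure {x. \<phi> x \<noteq> 0})" "closure {x. \<phi> x \<noteq> 0} \<subseteq> U"
    using assms by (simp_all add: C1c_iff compactly_supported_in_def)
  then show ?thesis
    by (rule that) (use closure_subset[of "{x. \<phi> x \<noteq> 0}"] in blast)
qed

lemma C1c_zero: "(\<lambda>x. 0) \<in> C1c U"
  by (rule C1cI[of _ "{}"]) (auto intro: C1_map_const)

lemma C1c_add:
  assumes "\<phi> \<in> C1c U" "\<psi> \<in> C1c U"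
  shows "(\<lambda>x. \<phi> x + \<psi> x) \<in> C1c U"
proof -
  obtain K where K: "C1_map \<phi>" "compact K" "K \<subseteq> U" "\<And>x. x \<notin> K \<Longrightarrow> \<phi> x = 0"
    using C1cE[OF assms(1)] by metis
  obtain L where L: "C1_map \<psi>" "compact L" "L \<subseteq> U" "\<And>x. x \<notin> L \<Longrightarrow> \<psi> x = 0"
    using C1cE[OF assms(2)] by metis
  show ?thesis
    by (rule C1cI[of _ "K \<union> L"]) (use K L in \<open>auto intro: C1_map_add\<close>)
qed

lemma C1c_scaleR:
  assumes "C1_map \<zeta>" "\<phi> \<in> C1c U"
  shows "(\<lambda>x. \<zeta> x *\<^sub>R \<phi> x) \<in> C1c U"
proof -
  obtain K where K: "C1_map \<phi>" "compact K" "K \<subseteq> U" "\<And>x. x \<notin> K \<Longrightarrow> \<phi> x = 0"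
    using C1cE[OF assms(2)] by metis
  show ?thesis
    by (rule C1cI[of _ K]) (use K in \<open>auto intro: C1_map_scaleR assms\<close>)
qed

lemma C1c_cmult: "\<phi> \<in> C1c U \<Longrightarrow> (\<lambda>x. c *\<^sub>R \<phi> x) \<in> C1c U"
  by (rule C1c_scaleR[OF C1_map_const])

lemma C1c_sum:
  "finite I \<Longrightarrow> (\<And>i. i \<in> I \<Longrightarrow> \<phi> i \<in> C1c U) \<Longrightarrow> (\<lambda>x. \<Sum>i\<in>I. \<phi> i x) \<in> C1c U"
  by (induction I rule: finite_induct) (auto intro: C1c_zero C1c_add)

text \<open>One constant \<open>C\<close> bounds the map and its derivative and is a Lipschitz constant; these are the
  domination bounds behind every passage to the limit under an integral below.\<close>

lemma C1c_derivE:
  fixes \<phi> :: "'a::euclidean_space \<Rightarrow> 'b::euclidean_space"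
  assumes "\<phi> \<in> C1c U"
  obtains D K C where "\<And>x. (\<phi> has_derivative D x) (at x)" "\<And>h. continuous_on UNIV (\<lambda>x. D x h)"
    "compact K" "K \<subseteq> U" "\<And>x. x \<notin> K \<Longrightarrow> \<phi> x = 0" "\<And>x h. x \<notin> K \<Longrightarrow> D x h = 0"
    "0 \<le> C" "\<And>x h. norm (D x h) \<le> C * norm h" "\<And>x y. norm (\<phi> x - \<phi> y) \<le> C * norm (x - y)"
    "\<And>x. norm (\<phi> x) \<le> C"
proof -
  obtain f' where f': "\<And>x. (\<phi> has_derivative blinfun_apply (f' x)) (at x)" "continuous_on UNIV f'"
    using assms by (auto simp: C1c_iff C1_map_def)
  obtain K where K: "C1_map \<phi>" "compact K" "K \<subseteq> U" "\<And>x. x \<notin> K \<Longrightarrow> \<phi> x = 0"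
    using C1cE[OF assms] by metis
  have zero: "f' x = 0" if "x \<notin> K" for x
  proof -
    have "((\<lambda>_. 0) has_derivative blinfun_apply (f' x)) (at x)"
      by (rule has_derivative_transform_within_open[OF f'(1), of "- K"])
        (use K that in \<open>auto intro: compact_imp_closed\<close>)
    then have "blinfun_apply (f' x) = (\<lambda>_. 0)"
      by (rule has_derivative_unique) simp
    then show ?thesis
      by (simp add: blinfun_eqI)
  qed
  have "bounded (f' ` K)" "bounded (\<phi> ` K)"
    using K f' C1_map_continuous[OF K(1)]
    by (auto intro!: compact_imp_bounded compact_continuous_image elim: continuous_on_subset)
  then obtain C1 C2 where C: "\<And>x. x \<in> K \<Longrightarrow> norm (f' x) \<le> C1" "\<And>x. x \<in> K \<Longrightarrow> norm (\<phi> x) \<le> C2"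
    by (metis bounded_iff imageI)
  define C where "C = max 0 (max C1 C2)"
  have nf': "norm (f' x) \<le> C" and n\<phi>: "norm (\<phi> x) \<le> C" for x
    using C[of x] zero[of x] K(4)[of x] by (cases "x \<in> K"; force simp: C_def)+
  show ?thesis
  proof (rule that[of "\<lambda>x. blinfun_apply (f' x)" K C])
    show bound: "norm (f' x h) \<le> C * norm h" for x h
      by (rule order_trans[OF norm_blinfun mult_right_mono[OF nf']]) simp
    show "norm (\<phi> x - \<phi> y) \<le> C * norm (x - y)" for x y
      by (rule differentiable_bound[of UNIV _ "\<lambda>x. blinfun_apply (f' x)"])
        (use f' nf' in \<open>auto simp: norm_blinfun.rep_eq[symmetric]\<close>)
  qed (use f' K zero n\<phi> in \<open>auto intro!: continuous_intros simp: C_def\<close>)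
qed

lemma C1c_subset_Lipc:
  fixes \<phi> :: "'a::euclidean_space \<Rightarrow> 'b::euclidean_space"
  assumes "\<phi> \<in> C1c U"
  shows "\<phi> \<in> Lipc"
proof -
  obtain C where C: "0 \<le> C" "\<And>x y. norm (\<phi> x - \<phi> y) \<le> C * norm (x - y)"
    using C1c_derivE[OF assms] by metis
  then have "C-lipschitz_on UNIV \<phi>"
    by (auto intro!: lipschitz_onI simp: dist_norm)
  then show ?thesis
    using C1c_mono[OF assms, of UNIV] by (auto simp: Lipc_def C1c_iff)
qed

lemma divergence_zero_outside:
  assumes "\<phi> \<in> C1c U"
  obtains K where "compact K" "K \<subseteq> U" "\<And>x. x \<notin> K \<Longrightarrow> \<phi> x = 0" "\<And>x. x \<notin> K \<Longrightarrow> divergence \<phi> x = 0"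
proof -
  obtain D K where D: "\<And>x. (\<phi> has_derivative D x) (at x)" and K: "compact K" "K \<subseteq> U"
      "\<And>x. x \<notin> K \<Longrightarrow> \<phi> x = 0" "\<And>x h. x \<notin> K \<Longrightarrow> D x h = 0"
    using C1c_derivE[OF assms] by metis
  show ?thesis
    by (rule that[OF K(1-3)]) (auto simp: divergence_eq[OF D] K(4))
qed


section \<open>Mollification\<close>

definition mollify ::
    "('a::euclidean_space \<Rightarrow> real) \<Rightarrow> ('a \<Rightarrow> 'b::euclidean_space) \<Rightarrow> 'a \<Rightarrow> 'b" where
  "mollify k f x = (\<integral>y. k (x - y) *\<^sub>R f y \<partial>lborel)"

lemma compact_subset_cball: "compact K \<Longrightarrow> \<exists>R. K \<subseteq> cball (0::'a::euclidean_space) R"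
  using compact_imp_bounded[of K] by (auto simp: bounded_iff subset_iff)

lemma integrable_bounded_compact:
  fixes f :: "'a::euclidean_space \<Rightarrow> 'b::euclidean_space"
  assumes "f \<in> borel_measurable borel" "compact K" "\<And>x. norm (f x) \<le> B" "\<And>x. x \<notin> K \<Longrightarrow> f x = 0"
  shows "integrable lborel f"
  by (rule integrableI_bounded_set[where A = K and B = B])
    (use assms emeasure_bounded_finite[of K] in \<open>auto simp: compact_imp_bounded compact_imp_closed\<close>)

lemma integrable_continuous_compact:
  fixes g :: "'a::euclidean_space \<Rightarrow> real" and f :: "'a \<Rightarrow> 'b::euclidean_space"
  assumes g: "continuous_on UNIV g" "compact K" "\<And>x. x \<notin> K \<Longrightarrow> g x = 0"
    and f: "f \<in> borel_measurable borel" "\<And>x. norm (f x) \<le> M"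
  shows "integrable lborel (\<lambda>x. g x *\<^sub>R f x)"
proof -
  have "bounded (g ` K)"
    using g by (intro compact_imp_bounded compact_continuous_image) (auto elim: continuous_on_subset)
  then obtain B where B: "\<And>x. x \<in> K \<Longrightarrow> \<bar>g x\<bar> \<le> B"
    by (metis bounded_iff imageI real_norm_def)
  have "norm (g x *\<^sub>R f x) \<le> max 0 B * M" for x
    using B[of x] f(2)[of x] g(3)[of x] order_trans[OF norm_ge_zero f(2)[of x]]
    by (cases "x \<in> K") (auto intro!: mult_mono)
  then show ?thesis
    using g f borel_measurable_continuous_onI[OF g(1)]
    by (intro integrable_bounded_compact[of _ K "max 0 B * M"]) auto
qed

lemma shift_outside:
  fixes x y :: "'a::real_normed_vector"
  assumes "K \<subseteq> cball 0 R" "norm x \<le> S" "y \<notin> cball 0 (R + S)"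
  shows "x - y \<notin> K"
proof
  assume "x - y \<in> K"
  then have "norm (x - y) \<le> R"
    using assms(1) by auto
  then have "norm y \<le> R + S"
    using assms(2) norm_triangle_ineq2[of y x] by (simp add: norm_minus_commute)
  then show False
    using assms(3) by simp
qed

lemma integrable_shift:
  fixes g :: "'a::euclidean_space \<Rightarrow> real" and f :: "'a \<Rightarrow> 'b::euclidean_space"
  assumes g: "continuous_on UNIV g" "compact K" "\<And>x. x \<notin> K \<Longrightarrow> g x = 0"
    and f: "f \<in> borel_measurable borel" "\<And>x. norm (f x) \<le> M"
  shows "integrable lborel (\<lambda>y. g (x - y) *\<^sub>R f y)"
proof -
  obtain R where R: "K \<subseteq> cball 0 R"
    using compact_subset_cball[OF g(2)] by blast
  have "continuous_on UNIV (\<lambda>y. g (x - y))"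
    by (rule continuous_on_compose2[OF g(1)]) (auto intro!: continuous_intros)
  then show ?thesis
    using f shift_outside[OF R order_refl, of _ x] g(3)
    by (intro integrable_continuous_compact[of _ "cball 0 (R + norm x)"]) auto
qed

lemma tendsto_integral_bounded_compact:
  fixes f :: "'a::euclidean_space \<Rightarrow> 'b::euclidean_space" and q :: "nat \<Rightarrow> 'a \<Rightarrow> real"
  assumes q: "\<And>n. q n \<in> borel_measurable borel" "p \<in> borel_measurable borel"
      "\<And>n x. \<bar>q n x\<bar> \<le> B" "\<And>n x. x \<notin> L \<Longrightarrow> q n x = 0" "compact L"
      "\<And>x. (\<lambda>n. q n x) \<longlonglongrightarrow> p x"
    and f: "f \<in> borel_measurable borel" "\<And>x. norm (f x) \<le> M"
  shows "(\<lambda>n. \<integral>x. q n x *\<^sub>R f x \<partial>lborel) \<longlonglongrightarrow> (\<integral>x. p x *\<^sub>R f x \<partial>lborel)"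
proof (rule integral_dominated_convergence)
  have "0 \<le> B" "0 \<le> M"
    using order_trans[OF abs_ge_zero q(3)] order_trans[OF norm_ge_zero f(2)] by auto
  then show "AE x in lborel. norm (q n x *\<^sub>R f x) \<le> B * M * indicat_real L x" for n
    using q(3,4) f(2) by (auto intro!: mult_mono simp: indicator_def)
  show "integrable lborel (\<lambda>x. B * M * indicat_real L x)"
    using q(5) emeasure_bounded_finite[of L]
    by (auto intro!: integrable_real_indicator simp: compact_imp_bounded compact_imp_closed)
  show "AE x in lborel. (\<lambda>n. q n x *\<^sub>R f x) \<longlonglongrightarrow> p x *\<^sub>R f x"
    using q(6) by (auto intro!: tendsto_intros)
qed (use q f in measurable)

lemma continuous_on_mollify:
  fixes k :: "'a::euclidean_space \<Rightarrow> real" and f :: "'a \<Rightarrow> 'b::euclidean_space"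
  assumes k: "continuous_on UNIV k" "compact K" "\<And>z. z \<notin> K \<Longrightarrow> k z = 0"
    and f: "f \<in> borel_measurable borel" "\<And>x. norm (f x) \<le> M"
  shows "continuous_on UNIV (mollify k f)"
proof -
  obtain R where R: "K \<subseteq> cball 0 R"
    using compact_subset_cball[OF k(2)] by blast
  have "bounded (k ` K)"
    using k by (intro compact_imp_bounded compact_continuous_image) (auto elim: continuous_on_subset)
  then obtain B where B: "\<And>z. z \<in> K \<Longrightarrow> \<bar>k z\<bar> \<le> B"
    by (metis bounded_iff imageI real_norm_def)
  have kB: "\<bar>k z\<bar> \<le> max 0 B" for z
    using B[of z] k(3)[of z] by (cases "z \<in> K") auto
  have shift: "continuous_on UNIV (\<lambda>y. k (x - y))" for x
    by (rule continuous_on_compose2[OF k(1)]) (auto intro!: continuous_intros)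
  have lim: "(\<lambda>n. mollify k f (X n)) \<longlonglongrightarrow> mollify k f x" if X: "X \<longlonglongrightarrow> x" for X x
  proof -
    obtain S where S: "\<And>n. norm (X n) \<le> S"
      using convergent_imp_Bseq[OF convergentI[OF X]] by (auto simp: Bseq_def)
    have "(\<lambda>n. k (X n - y)) \<longlonglongrightarrow> k (x - y)" for y
      using k(1) X by (intro isCont_tendsto_compose[of _ k]) (auto simp: continuous_on_eq_continuous_at intro!: tendsto_intros)
    then show ?thesis
      unfolding mollify_def
      using kB shift_outside[OF R S] k(3) f
      by (intro tendsto_integral_bounded_compact[of _ _ "max 0 B" "cball 0 (R + S)"])
        (auto intro!: borel_measurable_continuous_onI shift)
  qed
  show ?thesis
    unfolding continuous_on_sequentially using lim by (auto simp: comp_def)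
qed

text \<open>Differentiation passes to the kernel: its difference quotients are bounded by the Lipschitz
  constant and supported in a common compact set, so dominated convergence applies even though
  \<open>f\<close> is only measurable.\<close>

lemma has_derivative_mollify:
  fixes k :: "'a::euclidean_space \<Rightarrow> real" and f :: "'a \<Rightarrow> 'b::euclidean_space"
  assumes k: "\<And>z. (k has_derivative D z) (at z)" "\<And>h. continuous_on UNIV (\<lambda>z. D z h)"
      "compact K" "\<And>z. z \<notin> K \<Longrightarrow> k z = 0" "\<And>z h. z \<notin> K \<Longrightarrow> D z h = 0"
      "\<And>z h. \<bar>D z h\<bar> \<le> C * norm h" "\<And>y z. \<bar>k y - k z\<bar> \<le> C * norm (y - z)"
    and f: "f \<in> borel_measurable borel" "\<And>x. norm (f x) \<le> M"
  shows "(mollify k f has_derivative (\<lambda>h. mollify (\<lambda>z. D z h) f x)) (at x)"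
  unfolding has_derivative_at_within
proof
  note intD = integrable_shift[OF k(2,3,5) f]
  have ck: "continuous_on UNIV k"
    by (intro continuous_at_imp_continuous_on ballI has_derivative_continuous[OF k(1)])
  note intk = integrable_shift[OF ck k(3,4) f]
  have lin: "linear (D z)" for z
    using has_derivative_linear[OF k(1)] .
  have "linear (\<lambda>h. mollify (\<lambda>z. D z h) f x)"
  proof (rule linearI)
    fix a b :: 'a and c :: real
    show "mollify (\<lambda>z. D z (a + b)) f x = mollify (\<lambda>z. D z a) f x + mollify (\<lambda>z. D z b) f x"
      unfolding mollify_def
      by (simp add: linear_add[OF lin] scaleR_add_left Bochner_Integration.integral_add intD)
    show "mollify (\<lambda>z. D z (c *\<^sub>R a)) f x = c *\<^sub>R mollify (\<lambda>z. D z a) f x"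
      unfolding mollify_def by (simp add: linear_scale[OF lin] flip: scaleR_scaleR)
  qed
  then show "bounded_linear (\<lambda>h. mollify (\<lambda>z. D z h) f x)"
    by (simp add: linear_conv_bounded_linear)
  obtain R where R: "K \<subseteq> cball 0 R"
    using compact_subset_cball[OF k(3)] by blast
  define Q where "Q y z = (k (y - z) - k (x - z) - D (x - z) (y - x)) /\<^sub>R norm (y - x)" for y z
  have quot: "(mollify k f y - mollify k f x - mollify (\<lambda>z. D z (y - x)) f x) /\<^sub>R norm (y - x)
      = (\<integral>z. Q y z *\<^sub>R f z \<partial>lborel)" for y
  proof -
    have "(\<integral>z. Q y z *\<^sub>R f z \<partial>lborel)
        = (\<integral>z. (k (y - z) *\<^sub>R f z - k (x - z) *\<^sub>R f z - D (x - z) (y - x) *\<^sub>R f z) /\<^sub>R norm (y - x) \<partial>lborel)"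
      by (intro Bochner_Integration.integral_cong refl)
        (simp add: Q_def scaleR_diff_left scaleR_diff_right right_diff_distrib)
    also have "\<dots> = ((\<integral>z. k (y - z) *\<^sub>R f z - k (x - z) *\<^sub>R f z - D (x - z) (y - x) *\<^sub>R f z \<partial>lborel)) /\<^sub>R norm (y - x)"
      by (rule integral_scaleR_right)
    also have "\<dots> = (mollify k f y - mollify k f x - mollify (\<lambda>z. D z (y - x)) f x) /\<^sub>R norm (y - x)"
      unfolding mollify_def
      by (simp add: Bochner_Integration.integral_diff[OF Bochner_Integration.integrable_diff[OF intk intk] intD]
          Bochner_Integration.integral_diff[OF intk intk])
    finally show ?thesis
      by simp
  qed
  have QC: "\<bar>Q y z\<bar> \<le> C + C" if "y \<noteq> x" for y z
  proof -
    have "\<bar>k (y - z) - k (x - z) - D (x - z) (y - x)\<bar> \<le> C * norm (y - x) + C * norm (y - x)"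
      using k(7)[of "y - z" "x - z"] k(6)[of "x - z" "y - x"] by simp
    then show ?thesis
      using that by (simp add: Q_def field_simps)
  qed
  have meas: "Q y \<in> borel_measurable borel" for y
    unfolding Q_def
    by (intro borel_measurable_continuous_onI continuous_intros continuous_on_compose2[OF ck]
        continuous_on_compose2[OF k(2)]) auto
  show "((\<lambda>y. (mollify k f y - mollify k f x - mollify (\<lambda>z. D z (y - x)) f x) /\<^sub>R norm (y - x)) \<longlongrightarrow> 0) (at x)"
    unfolding quot tendsto_at_iff_sequentially
  proof (intro allI impI)
    fix X assume ne: "\<forall>i. X i \<in> UNIV - {x}" and X: "X \<longlonglongrightarrow> x"
    obtain S where S: "\<And>n. norm (X n) \<le> S"
      using convergent_imp_Bseq[OF convergentI[OF X]] by (auto simp: Bseq_def)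
    have Sx: "norm x \<le> S"
      using Lim_bounded[OF tendsto_norm[OF X]] S by blast
    have "(\<lambda>n. Q (X n) z) \<longlonglongrightarrow> 0" for z
    proof -
      have "((\<lambda>u. (k u - k (x - z) - D (x - z) (u - (x - z))) /\<^sub>R norm (u - (x - z))) \<longlongrightarrow> 0) (at (x - z))"
        using k(1)[of "x - z"] unfolding has_derivative_at_within by simp
      moreover have "filterlim (\<lambda>n. X n - z) (at (x - z)) sequentially"
        using ne X by (auto simp: filterlim_at intro!: tendsto_intros always_eventually)
      ultimately have "(\<lambda>n. (k (X n - z) - k (x - z) - D (x - z) (X n - z - (x - z)))
          /\<^sub>R norm (X n - z - (x - z))) \<longlonglongrightarrow> 0"
        by (rule filterlim_compose)
      then show ?thesis
        by (simp add: comp_def Q_def)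
    qed
    moreover have "Q (X n) z = 0" if "z \<notin> cball 0 (R + S)" for n z
      using shift_outside[OF R S that] shift_outside[OF R Sx that] k(4,5) by (simp add: Q_def)
    ultimately have "(\<lambda>n. \<integral>z. Q (X n) z *\<^sub>R f z \<partial>lborel) \<longlonglongrightarrow> (\<integral>z. 0 *\<^sub>R f z \<partial>lborel)"
      using ne by (intro tendsto_integral_bounded_compact[of _ _ "C + C" "cball 0 (R + S)" f M] meas f QC) auto
    then show "((\<lambda>y. \<integral>z. Q y z *\<^sub>R f z \<partial>lborel) \<circ> X) \<longlonglongrightarrow> 0"
      by (simp add: comp_def)
  qed
qed

lemma C1_map_mollify:
  fixes k :: "'a::euclidean_space \<Rightarrow> real" and f :: "'a \<Rightarrow> 'b::euclidean_space"
  assumes "k \<in> C1c UNIV" and f: "f \<in> borel_measurable borel" "\<And>x. norm (f x) \<le> M"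
  shows "C1_map (mollify k f)"
proof -
  obtain D K C where k: "\<And>z. (k has_derivative D z) (at z)" "\<And>h. continuous_on UNIV (\<lambda>z. D z h)"
      "compact K" "\<And>z. z \<notin> K \<Longrightarrow> k z = 0" "\<And>z h. z \<notin> K \<Longrightarrow> D z h = 0"
      "\<And>z h. \<bar>D z h\<bar> \<le> C * norm h" "\<And>y z. \<bar>k y - k z\<bar> \<le> C * norm (y - z)"
    using C1c_derivE[OF assms(1)] unfolding real_norm_def by metis
  show ?thesis
    by (rule C1_mapI[OF has_derivative_mollify[OF k f]])
      (auto intro!: continuous_on_mollify[OF k(2,3,5) f])
qed

lemma mollify_zero:
  assumes "\<And>z. r \<le> norm z \<Longrightarrow> k z = 0" "\<And>y. dist x y < r \<Longrightarrow> f y = 0"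
  shows "mollify k f x = 0"
proof -
  have "(\<lambda>y. k (x - y) *\<^sub>R f y) = (\<lambda>_. 0)"
    using assms by (auto simp: fun_eq_iff dist_norm) (meson not_le)
  then show ?thesis
    by (simp add: mollify_def)
qed

lemma divergence_mollify:
  fixes k :: "'a::euclidean_space \<Rightarrow> real" and f :: "'a \<Rightarrow> 'a"
  assumes k: "\<And>z. (k has_derivative D z) (at z)" "\<And>h. continuous_on UNIV (\<lambda>z. D z h)"
      "compact K" "\<And>z. z \<notin> K \<Longrightarrow> k z = 0" "\<And>z h. z \<notin> K \<Longrightarrow> D z h = 0"
      "\<And>z h. \<bar>D z h\<bar> \<le> C * norm h" "\<And>y z. \<bar>k y - k z\<bar> \<le> C * norm (y - z)"
    and f: "f \<in> borel_measurable borel" "\<And>x. norm (f x) \<le> M"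
  shows "divergence (mollify k f) x = (\<integral>y. D (x - y) (f y) \<partial>lborel)"
proof -
  note intD = integrable_shift[OF k(2,3,5) f]
  have "divergence (mollify k f) x = (\<Sum>i\<in>Basis. mollify (\<lambda>z. D z i) f x \<bullet> i)"
    by (rule divergence_eq[OF has_derivative_mollify[OF k f]])
  also have "\<dots> = (\<Sum>i\<in>Basis. \<integral>y. (D (x - y) i *\<^sub>R f y) \<bullet> i \<partial>lborel)"
    unfolding mollify_def
    by (intro sum.cong refl integral_inner_left[symmetric] intD)
  also have "\<dots> = (\<integral>y. (\<Sum>i\<in>Basis. (D (x - y) i *\<^sub>R f y) \<bullet> i) \<partial>lborel)"
    by (rule Bochner_Integration.integral_sum[symmetric]) (intro integrable_inner_left intD)
  also have "(\<lambda>y. \<Sum>i\<in>Basis. (D (x - y) i *\<^sub>R f y) \<bullet> i) = (\<lambda>y. D (x - y) (f y))"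
  proof
    fix y
    have lin: "linear (D (x - y))"
      using has_derivative_linear[OF k(1)] .
    have "D (x - y) (f y) = D (x - y) (\<Sum>i\<in>Basis. (f y \<bullet> i) *\<^sub>R i)"
      by (simp add: euclidean_representation)
    also have "\<dots> = (\<Sum>i\<in>Basis. (f y \<bullet> i) * D (x - y) i)"
      by (simp add: linear_sum[OF lin] linear_scale[OF lin])
    finally show "(\<Sum>i\<in>Basis. (D (x - y) i *\<^sub>R f y) \<bullet> i) = D (x - y) (f y)"
      by (simp add: mult.commute)
  qed
  finally show ?thesis .
qed

lemma lborel_distr_reflect:
  fixes x :: "'a::euclidean_space"
  shows "distr lborel borel (\<lambda>y. x - y) = lborel"
  using lborel_affine[of "-1" x] by (simp add: density_1)

lemma integral_reflect:
  fixes k :: "'a::euclidean_space \<Rightarrow> 'b::euclidean_space"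
  assumes "k \<in> borel_measurable borel"
  shows "(\<integral>y. k (x - y) \<partial>lborel) = integral\<^sup>L lborel k"
  using integral_distr[of "\<lambda>y. x - y" lborel borel k] assms by (simp add: lborel_distr_reflect)


subsection \<open>Kernels close to the mean over a ball\<close>

text \<open>A kernel of this kind exceeds the density of the uniform distribution on the ball of radius \<open>r\<close>
  by a factor of at most \<open>1 + \<delta>\<close>. Its mollifications are therefore bounded by \<open>1 + \<delta>\<close> times ball means,
  which brings in the A1 constant without loss as \<open>\<delta> \<rightarrow> 0\<close>.\<close>

definition mollifier :: "real \<Rightarrow> real \<Rightarrow> ('a::euclidean_space \<Rightarrow> real) \<Rightarrow> bool" where
  "mollifier r \<delta> k \<longleftrightarrow> k \<in> C1c UNIV \<and> (\<forall>z. 0 \<le> k z \<and> k (- z) = k z) \<and>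
     (\<forall>z. r \<le> norm z \<longrightarrow> k z = 0) \<and> (\<forall>z. k z * measure lborel (ball (0::'a) r) \<le> 1 + \<delta>) \<and>
     integral\<^sup>L lborel k = 1"

lemma has_real_derivative_max_0_square:
  "((\<lambda>t. (max 0 t)\<^sup>2) has_real_derivative 2 * max 0 t) (at (t::real))"
proof -
  consider "t < 0" | "t = 0" | "0 < t"
    by linarith
  then show ?thesis
  proof cases
    case 1
    have "((\<lambda>t. 0) has_real_derivative 0) (at t)"
      by simp
    then have "((\<lambda>t. (max 0 t)\<^sup>2) has_real_derivative 0) (at t)"
      by (rule has_field_derivative_transform_within_open[of _ _ _ "{..<0}"]) (use 1 in \<open>auto simp: max_def\<close>)
    then show ?thesis
      using 1 by (simp add: max_def)
  next
    case 2
    have "isCont (\<lambda>z::real. max 0 z) 0"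
      by (intro continuous_intros)
    then show ?thesis
      unfolding 2 CARAT_DERIV
      by (intro exI[of _ "\<lambda>z. max 0 z"]) (auto simp: power2_eq_square max_def)
  next
    case 3
    have "((\<lambda>t. t\<^sup>2) has_real_derivative 2 * t) (at t)"
      by (auto intro!: derivative_eq_intros)
    then have "((\<lambda>t. (max 0 t)\<^sup>2) has_real_derivative 2 * t) (at t)"
      by (rule has_field_derivative_transform_within_open[of _ _ _ "{0<..}"]) (use 3 in \<open>auto simp: max_def\<close>)
    then show ?thesis
      using 3 by (simp add: max_def)
  qed
qed

text \<open>With the bump \<open>b z = (max 0 (1 - norm z ^ 2 / r ^ 2)) ^ 2\<close>, the functions \<open>1 - (1 - b) ^ m\<close>
  increase to the indicator of the ball as \<open>m\<close> grows.\<close>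

lemma ex_mollifier:
  assumes r: "0 < r" and \<delta>: "0 < \<delta>"
  shows "\<exists>k::'a::euclidean_space \<Rightarrow> real. mollifier r \<delta> k"
proof -
  define V where "V = measure lborel (ball (0::'a) r)"
  have V: "0 < V"
    using r by (simp add: V_def content_ball_pos)
  define b where "b z = (max 0 (1 - (z \<bullet> z) / r\<^sup>2))\<^sup>2" for z :: 'a
  have arg: "((\<lambda>z. 1 - (z \<bullet> z) / r\<^sup>2) has_derivative (\<lambda>h. - (2 * (z \<bullet> h)) / r\<^sup>2)) (at z)" for z :: 'a
  proof -
    have "((\<lambda>z. 1 - c * (z \<bullet> z)) has_derivative (\<lambda>h. - (c * (z \<bullet> h + h \<bullet> z)))) (at z)" for c
      by (auto intro!: derivative_eq_intros)
    from this[of "1 / r\<^sup>2"] show ?thesis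
      by (simp add: inner_commute)
  qed
  have "(b has_derivative (\<lambda>h. 2 * max 0 (1 - (z \<bullet> z) / r\<^sup>2) * (- (2 * (z \<bullet> h)) / r\<^sup>2))) (at z)" for z
    unfolding b_def
    using has_derivative_compose[OF arg
        has_real_derivative_max_0_square[unfolded has_field_derivative_def], of z] .
  then have C1b: "C1_map b"
    by (rule C1_mapI) (use r in \<open>auto intro!: continuous_intros\<close>)
  have lt1: "(z \<bullet> z) / r\<^sup>2 < 1 \<longleftrightarrow> norm z < r" for z :: 'a
    using r by (auto simp: dot_square_norm divide_less_eq power_strict_mono intro: power2_less_imp_less)
  have b_pos: "0 < b z" if "norm z < r" for z
  proof -
    have "0 < max 0 (1 - (z \<bullet> z) / r\<^sup>2)"
      using that lt1[of z] by simp
    then show ?thesis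
      unfolding b_def by (rule zero_less_power)
  qed
  have b_zero: "b z = 0" if "r \<le> norm z" for z
    using that lt1[of z] by (simp add: b_def max_def)
  have b01: "0 \<le> b z" "b z \<le> 1" for z
    by (auto simp: b_def power_le_one)
  define e where "e m z = 1 - (1 - b z) ^ m" for m and z :: 'a
  have C1e: "C1_map (e m)" for m
    unfolding e_def by (intro C1_map_diff C1_map_power C1_map_const C1b)
  have e01: "0 \<le> e m z" "e m z \<le> 1" for m z
    using b01[of z] by (auto simp: e_def power_le_one)
  have e_zero: "e m z = 0" if "r \<le> norm z" for m z
    using b_zero[OF that] by (simp add: e_def)
  have [measurable]: "e m \<in> borel_measurable borel" for m
    by (intro borel_measurable_continuous_onI C1_map_continuous C1e)
  have [measurable]: "ball (0::'a) r \<in> sets borel"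
    by simp
  have "(\<lambda>m. integral\<^sup>L lborel (e m)) \<longlonglongrightarrow> integral\<^sup>L lborel (indicat_real (ball (0::'a) r))"
  proof (rule integral_dominated_convergence)
    show "integrable lborel (indicat_real (ball (0::'a) r))"
      using emeasure_bounded_finite[of "ball (0::'a) r"] by (intro integrable_real_indicator) auto
    show "AE z in lborel. norm (e m z) \<le> indicat_real (ball (0::'a) r) z" for m
      using e01 e_zero by (auto simp: indicator_def)
    show "AE z in lborel. (\<lambda>m. e m z) \<longlonglongrightarrow> indicat_real (ball (0::'a) r) z"
    proof (intro AE_I2)
      fix z :: 'a
      show "(\<lambda>m. e m z) \<longlonglongrightarrow> indicat_real (ball (0::'a) r) z"
      proof (cases "norm z < r")
        case True
        have "(\<lambda>m. (1 - b z) ^ m) \<longlonglongrightarrow> 0"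
          using b_pos[OF True] b01[of z] by (intro LIMSEQ_realpow_zero) auto
        from tendsto_diff[OF tendsto_const[of 1] this] show ?thesis
          using True by (simp add: e_def)
      qed (simp add: e_zero)
    qed
  qed measurable
  then have "(\<lambda>m. integral\<^sup>L lborel (e m)) \<longlonglongrightarrow> V"
    by (simp add: V_def)
  moreover have "V / (1 + \<delta>) < V"
    using V \<delta> by (simp add: divide_less_eq)
  ultimately obtain m where m: "V / (1 + \<delta>) < integral\<^sup>L lborel (e m)"
    using order_tendstoD(1) eventually_happens by (metis sequentially_bot)
  define I where "I = integral\<^sup>L lborel (e m)"
  have I: "0 < I" "V / I \<le> 1 + \<delta>"
  proof -
    show "0 < I"
      using m V \<delta> by (simp add: I_def) (meson divide_pos_pos less_trans add_pos_pos zero_less_one)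
    then show "V / I \<le> 1 + \<delta>"
      using m \<delta> by (simp add: I_def field_simps)
  qed
  have "mollifier r \<delta> (\<lambda>z. (1 / I) *\<^sub>R e m z)"
    unfolding mollifier_def V_def[symmetric]
  proof (intro conjI allI impI)
    show "(\<lambda>z. (1 / I) *\<^sub>R e m z) \<in> C1c UNIV"
      by (rule C1cI[OF C1_map_scaleR[OF C1_map_const C1e], of "cball 0 r"]) (auto simp: e_zero)
    fix z :: 'a
    show "0 \<le> (1 / I) *\<^sub>R e m z"
      using I e01 by simp
    show "(1 / I) *\<^sub>R e m (- z) = (1 / I) *\<^sub>R e m z"
      by (simp add: e_def b_def)
    show "(1 / I) *\<^sub>R e m z = 0" if "r \<le> norm z"
      using e_zero[OF that] by simp
    have "e m z * V \<le> 1 * V"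
      using e01[of m z] V by (intro mult_right_mono) auto
    then have "e m z * V / I \<le> V / I"
      using I(1) by (simp add: divide_right_mono)
    then show "(1 / I) *\<^sub>R e m z * V \<le> 1 + \<delta>"
      using I(2) by simp
  next
    show "integral\<^sup>L lborel (\<lambda>z. (1 / I) *\<^sub>R e m z) = 1"
      using I(1) by (simp add: I_def)
  qed
  then show ?thesis
    by blast
qed

lemma mollifier_has_integral_shift:
  assumes "mollifier r \<delta> k"
  shows "(\<integral>y. k (x - y) \<partial>lborel) = 1" "(\<integral>\<^sup>+y. ennreal (k (x - y)) \<partial>lborel) = 1"
proof -
  have k: "k \<in> C1c UNIV" "\<And>z. 0 \<le> k z" "integral\<^sup>L lborel k = 1"
    using assms by (auto simp: mollifier_def)
  obtain K where K: "C1_map k" "compact K" "\<And>x. x \<notin> K \<Longrightarrow> k x = 0"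
    using C1cE[OF k(1)] by metis
  have ck: "continuous_on UNIV k"
    by (rule C1_map_continuous[OF K(1)])
  show int: "(\<integral>y. k (x - y) \<partial>lborel) = 1"
    using integral_reflect[of k x] borel_measurable_continuous_onI[OF ck] k(3) by simp
  have "integrable lborel (\<lambda>y. k (x - y) *\<^sub>R (1::real))"
    by (rule integrable_shift[OF ck K(2,3), of _ 1]) auto
  then show "(\<integral>\<^sup>+y. ennreal (k (x - y)) \<partial>lborel) = 1"
    using nn_integral_eq_integral[of lborel "\<lambda>y. k (x - y)"] k(2) int by simp
qed

lemma C1_cutoff:
  fixes K U :: "'a::euclidean_space set"
  assumes K: "compact K" and U: "open U" "K \<subseteq> U"
  obtains \<zeta> W where "\<zeta> \<in> C1c U" "\<And>x. 0 \<le> \<zeta> x \<and> \<zeta> x \<le> (1::real)" "open W" "K \<subseteq> W"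
    "\<And>x. x \<in> W \<Longrightarrow> \<zeta> x = 1"
proof (cases "K = {}")
  case True
  show ?thesis
    by (rule that[of "\<lambda>_. 0" "{}"]) (auto simp: True C1c_zero)
next
  case False
  obtain e where e: "0 < e" "{x. infdist x K \<le> e} \<subseteq> U"
    using compact_in_open_separated[OF False K U] by metis
  \<comment> \<open>The indicator of the closed \<open>2 * d\<close>-neighbourhood is mollified at scale \<open>d\<close>: the result is \<open>1\<close> within
    distance \<open>d\<close> of \<open>K\<close> and vanishes beyond distance \<open>3 * d = e\<close>.\<close>
  define d where "d = e / 3"
  have d: "0 < d"
    using e by (simp add: d_def)
  obtain k :: "'a \<Rightarrow> real" where k: "mollifier d 1 k"
    using ex_mollifier[OF d, of 1] by auto
  then have k': "k \<in> C1c UNIV" "\<And>z. 0 \<le> k z" "\<And>z. d \<le> norm z \<Longrightarrow> k z = 0"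
    by (auto simp: mollifier_def)
  define F where "F = {x. infdist x K \<le> 2 * d}"
  have "closed F"
    unfolding F_def by (intro closed_Collect_le continuous_intros)
  then have mF: "indicat_real F \<in> borel_measurable borel"
    by simp
  define \<zeta> where "\<zeta> = mollify k (indicat_real F)"
  have C1: "C1_map \<zeta>"
    unfolding \<zeta>_def by (rule C1_map_mollify[OF k'(1) mF, of 1]) auto
  obtain L where L: "compact L" "\<And>x. x \<notin> L \<Longrightarrow> k x = 0"
    using C1cE[OF k'(1)] by metis
  have intk: "integrable lborel (\<lambda>y. k (x - y) *\<^sub>R f y)"
    if "f \<in> borel_measurable borel" "\<And>x. norm (f x) \<le> 1" for f :: "'a \<Rightarrow> real" and x
    using integrable_shift[OF C1_map_continuous L that] k'(1) by (auto simp: C1c_iff)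
  have bounds: "0 \<le> \<zeta> x \<and> \<zeta> x \<le> 1" for x
  proof
    show "0 \<le> \<zeta> x"
      unfolding \<zeta>_def mollify_def using k'(2) by (intro integral_nonneg_AE) auto
    have "\<zeta> x \<le> (\<integral>y. k (x - y) *\<^sub>R 1 \<partial>lborel)"
      unfolding \<zeta>_def mollify_def
      by (intro integral_mono intk mF) (auto simp: k' indicator_def)
    then show "\<zeta> x \<le> 1"
      using mollifier_has_integral_shift(1)[OF k] by simp
  qed
  show ?thesis
  proof (rule that[of \<zeta> "{x. infdist x K < d}"])
    show "open {x. infdist x K < d}"
      by (intro open_Collect_less continuous_intros)
    show "K \<subseteq> {x. infdist x K < d}"
      using d by auto
    have tri: "infdist x K \<le> infdist y K + dist x y" for x y
      by (rule infdist_triangle)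
    show "\<zeta> x = 1" if "x \<in> {x. infdist x K < d}" for x
    proof -
      have "(\<lambda>y. k (x - y) *\<^sub>R indicat_real F y) = (\<lambda>y. k (x - y))"
      proof
        fix y
        show "k (x - y) *\<^sub>R indicat_real F y = k (x - y)"
          using that tri[of y x] k'(3)[of "x - y"]
          by (cases "y \<in> F") (auto simp: F_def dist_norm norm_minus_commute)
      qed
      then show ?thesis
        unfolding \<zeta>_def mollify_def using mollifier_has_integral_shift(1)[OF k] by simp
    qed
    show "\<zeta> \<in> C1c U"
    proof (rule C1cI[OF C1, of "{x. infdist x K \<le> e}"])
      show "compact {x. infdist x K \<le> e}"
        using compact_infdist_le[OF False K e(1)] .
      show "\<zeta> x = 0" if "x \<notin> {x. infdist x K \<le> e}" for x
        unfolding \<zeta>_def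
      proof (rule mollify_zero[OF k'(3)])
        show "indicat_real F y = 0" if "dist x y < d" for y
          using \<open>x \<notin> {x. infdist x K \<le> e}\<close> that tri[of x y] by (auto simp: F_def d_def)
      qed
    qed (rule e(2))
  qed (rule bounds)
qed


section \<open>Integration by parts and duality\<close>

text \<open>Difference quotients of an integrable function have integral \<open>0\<close> by translation invariance, and for
  a compactly supported \<open>h\<close> they converge dominatedly to the partial derivative.\<close>

lemma integral_partial_deriv_eq_0:
  fixes h :: "'a::euclidean_space \<Rightarrow> real"
  assumes "h \<in> C1c UNIV"
  shows "(\<integral>x. partial_deriv i h x \<partial>lborel) = 0"
proof -
  obtain D K C where D: "\<And>x. (h has_derivative D x) (at x)" "\<And>h. continuous_on UNIV (\<lambda>x. D x h)"
      and K: "compact K" "\<And>x. x \<notin> K \<Longrightarrow> h x = 0"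
      and C: "0 \<le> C" "\<And>x y. \<bar>h x - h y\<bar> \<le> C * norm (x - y)"
    using C1c_derivE[OF assms] unfolding real_norm_def by metis
  obtain R where R: "K \<subseteq> cball 0 R"
    using compact_subset_cball[OF K(1)] by blast
  define s where "s n = 1 / real (Suc n)" for n
  have s: "0 < s n" "s n \<le> 1" for n
    by (auto simp: s_def)
  define q where "q n x = (h (x + s n *\<^sub>R i) - h x) / s n" for n x
  have ch: "continuous_on UNIV h"
    using assms by (simp add: C1c_iff C1_map_continuous)
  have chs: "continuous_on UNIV (\<lambda>x. h (x + s n *\<^sub>R i))" for n
    by (rule continuous_on_compose2[OF ch]) (auto intro!: continuous_intros)
  have inth: "integrable lborel h"
    using integrable_continuous_compact[OF ch K, of "\<lambda>_. 1::real" 1] by simp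
  have "(\<lambda>n. \<integral>x. q n x *\<^sub>R (1::real) \<partial>lborel) \<longlonglongrightarrow> (\<integral>x. D x i *\<^sub>R (1::real) \<partial>lborel)"
  proof (rule tendsto_integral_bounded_compact)
    show "q n \<in> borel_measurable borel" for n
      unfolding q_def
      by (intro borel_measurable_continuous_onI continuous_intros chs ch)
        (use s(1)[of n] in \<open>auto simp: less_imp_neq[symmetric]\<close>)
    show "(\<lambda>x. D x i) \<in> borel_measurable borel"
      by (intro borel_measurable_continuous_onI D)
    show "\<bar>q n x\<bar> \<le> C * norm i" for n x
      using C(2)[of "x + s n *\<^sub>R i" x] s[of n] by (simp add: q_def divide_le_eq ac_simps)
    show "q n x = 0" if "x \<notin> cball 0 (R + norm i)" for n x
    proof -
      have "norm (s n *\<^sub>R i) \<le> norm i"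
        using s[of n] by (simp add: mult_left_le_one_le)
      then have "norm x \<le> norm (x + s n *\<^sub>R i) + norm i"
        using norm_triangle_ineq4[of "x + s n *\<^sub>R i" "s n *\<^sub>R i"] by simp
      then have "R < norm (x + s n *\<^sub>R i)" "R < norm x"
        using \<open>x \<notin> cball 0 (R + norm i)\<close> norm_ge_zero[of i] unfolding mem_cball_0 by linarith+
      then have "x + s n *\<^sub>R i \<notin> K" "x \<notin> K"
        using R by (auto simp: subset_iff)
      then show ?thesis
        using K(2) by (simp add: q_def)
    qed
    show "(\<lambda>n. q n x) \<longlonglongrightarrow> D x i" for x
    proof -
      have "((\<lambda>t. (h (x + t *\<^sub>R i) - h x) / t) \<longlongrightarrow> D x i) (at 0)"
        using directional_derivative[OF D(1), of x i] by (simp add: has_field_derivative_iff)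
      moreover have "filterlim s (at 0) sequentially"
      proof -
        have "s \<longlonglongrightarrow> 0"
          unfolding s_def using LIMSEQ_inverse_real_of_nat by (simp add: inverse_eq_divide)
        then show ?thesis
          using s by (auto simp: filterlim_at less_imp_neq[symmetric] intro!: always_eventually)
      qed
      ultimately show ?thesis
        unfolding q_def by (rule filterlim_compose)
    qed
  qed auto
  moreover have "(\<integral>x. q n x *\<^sub>R (1::real) \<partial>lborel) = 0" for n
  proof -
    have eq: "(\<integral>x. h (s n *\<^sub>R i + x) \<partial>lborel) = integral\<^sup>L lborel h"
      using integral_distr[of "(+) (s n *\<^sub>R i)" lborel borel h] borel_measurable_continuous_onI[OF ch]
      by (simp add: lborel_distr_plus)
    have "integrable lborel (\<lambda>x. h (s n *\<^sub>R i + x))"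
      using integrable_distr_eq[of "(+) (s n *\<^sub>R i)" lborel borel h]
        borel_measurable_continuous_onI[OF ch] inth
      by (simp add: lborel_distr_plus)
    then have "(\<integral>x. h (s n *\<^sub>R i + x) - h x \<partial>lborel) = 0"
      using eq inth by (subst Bochner_Integration.integral_diff) auto
    then show ?thesis
      by (simp add: q_def add.commute)
  qed
  ultimately have "(\<integral>x. D x i \<partial>lborel) = 0"
    by (simp add: LIMSEQ_const_iff)
  then show ?thesis
    by (simp add: partial_deriv_eq[OF D(1)])
qed

definition grad :: "('a::euclidean_space \<Rightarrow> real) \<Rightarrow> 'a \<Rightarrow> 'a" where
  "grad g x = (\<Sum>i\<in>Basis. partial_deriv i g x *\<^sub>R i)"

lemma grad_inner_Basis: "i \<in> Basis \<Longrightarrow> grad g x \<bullet> i = partial_deriv i g x"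
  by (simp add: grad_def)

lemma continuous_partial_deriv:
  assumes "C1_map g"
  shows "continuous_on UNIV (partial_deriv i g)"
proof -
  obtain D where D: "\<And>x. (g has_derivative D x) (at x)" "\<And>h. continuous_on UNIV (\<lambda>x. D x h)"
    using C1_mapE[OF assms] by metis
  have "partial_deriv i g = (\<lambda>x. D x i)"
    using partial_deriv_eq[OF D(1)] by auto
  then show ?thesis
    using D(2) by simp
qed

lemma continuous_grad: "C1_map g \<Longrightarrow> continuous_on UNIV (grad g)"
  unfolding grad_def by (intro continuous_intros continuous_partial_deriv)

lemma locally_integrable_continuous:
  fixes f :: "'a::euclidean_space \<Rightarrow> 'b::euclidean_space"
  assumes "continuous_on UNIV f"
  shows "locally_integrable f"
  unfolding locally_integrable_def
proof (intro allI impI)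
  fix K :: "'a set" assume K: "compact K"
  then have "integrable lborel (\<lambda>x. indicator K x *\<^sub>R f x)"
    using assms by (intro borel_integrable_compact) (auto elim: continuous_on_subset)
  then show "set_integrable lebesgue K f"
    unfolding set_integrable_def using K assms
    by (subst integrable_completion)
      (auto intro!: borel_measurable_continuous_onI simp: compact_imp_closed)
qed

lemma locally_integrable_indicator:
  fixes E :: "'a::euclidean_space set"
  assumes "E \<in> sets lebesgue"
  shows "locally_integrable (indicat_real E)"
  unfolding locally_integrable_def
proof (intro allI impI)
  fix K :: "'a set" assume K: "compact K"
  then have Kl: "K \<in> lmeasurable"
    by (rule lmeasurable_compact)
  have "emeasure lebesgue (K \<inter> E) \<le> emeasure lebesgue K"
    using Kl by (intro emeasure_mono) auto
  also have "\<dots> < \<infinity>"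
    unfolding infinity_ennreal_def by (rule top.not_eq_extremum[THEN iffD1, OF fmeasurableD2[OF Kl]])
  finally have "integrable lebesgue (indicat_real (K \<inter> E))"
    using Kl assms by (intro integrable_real_indicator) auto
  moreover have "(\<lambda>x. indicat_real K x *\<^sub>R indicat_real E x) = indicat_real (K \<inter> E)"
    by (auto simp: indicator_def)
  ultimately show "set_integrable lebesgue K (indicat_real E)"
    unfolding set_integrable_def by simp
qed

lemma has_weak_gradient_C1:
  fixes g :: "'a::euclidean_space \<Rightarrow> real"
  assumes g: "C1_map g"
  shows "has_weak_gradient g (grad g)"
  unfolding has_weak_gradient_def
proof (intro conjI ballI)
  show "locally_integrable g" "locally_integrable (grad g)"
    by (intro locally_integrable_continuous C1_map_continuous continuous_grad g)+
  fix \<phi> :: "'a \<Rightarrow> real" and i :: 'a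
  assume \<phi>: "\<phi> \<in> C1c UNIV" and i: "i \<in> Basis"
  obtain D K where D: "\<And>x. (\<phi> has_derivative D x) (at x)" "\<And>h. continuous_on UNIV (\<lambda>x. D x h)"
      and K: "compact K" "\<And>x. x \<notin> K \<Longrightarrow> \<phi> x = 0" "\<And>x h. x \<notin> K \<Longrightarrow> D x h = 0"
    using C1c_derivE[OF \<phi>] by metis
  obtain G where G: "\<And>x. (g has_derivative G x) (at x)" "\<And>h. continuous_on UNIV (\<lambda>x. G x h)"
    using C1_mapE[OF g] by metis
  have cont: "continuous_on UNIV g" "continuous_on UNIV \<phi>"
    using g \<phi> by (auto simp: C1c_iff intro: C1_map_continuous)
  have "(\<lambda>x. g x *\<^sub>R \<phi> x) \<in> C1c UNIV"
    by (rule C1c_scaleR[OF g \<phi>])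
  then have "(\<integral>x. partial_deriv i (\<lambda>x. g x *\<^sub>R \<phi> x) x \<partial>lborel) = 0"
    by (rule integral_partial_deriv_eq_0)
  then have "(\<integral>x. g x * D x i + G x i * \<phi> x \<partial>lborel) = 0"
    by (simp add: partial_deriv_eq[OF has_derivative_mult[OF G(1) D(1)]])
  moreover have "integrable lborel (\<lambda>x. (g x * D x i) *\<^sub>R (1::real))"
    using K by (intro integrable_continuous_compact[of _ K _ 1] continuous_intros cont D) auto
  moreover have "integrable lborel (\<lambda>x. (G x i * \<phi> x) *\<^sub>R (1::real))"
    using K by (intro integrable_continuous_compact[of _ K _ 1] continuous_intros cont G) auto
  ultimately have "(\<integral>x. g x * D x i \<partial>lborel) = - (\<integral>x. G x i * \<phi> x \<partial>lborel)"
    by (simp add: Bochner_Integration.integral_add)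
  then show "(\<integral>x. g x * partial_deriv i \<phi> x \<partial>lebesgue) = - (\<integral>x. (grad g x \<bullet> i) * \<phi> x \<partial>lebesgue)"
    using i by (simp add: grad_inner_Basis partial_deriv_eq[OF D(1)] partial_deriv_eq[OF G(1)]
        integral_completion borel_measurable_continuous_onI cont D G continuous_intros)
qed

definition div_pairing :: "('a::euclidean_space \<Rightarrow> real) \<Rightarrow> ('a \<Rightarrow> 'a) \<Rightarrow> real" where
  "div_pairing f \<phi> = (\<integral>x. f x * divergence \<phi> x \<partial>lebesgue)"

definition emollify :: "('a::euclidean_space \<Rightarrow> real) \<Rightarrow> ('a \<Rightarrow> ennreal) \<Rightarrow> 'a \<Rightarrow> ennreal" where
  "emollify k v x = (\<integral>\<^sup>+y. ennreal (k (x - y)) * v y \<partial>lborel)"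

lemma borel_measurable_truncation:
  fixes v :: "'a::euclidean_space \<Rightarrow> ennreal"
  assumes [measurable]: "v \<in> borel_measurable borel"
  shows "(\<lambda>x. min (v x) (of_nat N) * indicator (cball 0 (real N)) x) \<in> borel_measurable borel"
proof -
  have [measurable]: "cball (0::'a) (real N) \<in> sets borel"
    by simp
  show ?thesis
    by measurable
qed

lemma SUP_truncation:
  fixes v :: "'a::euclidean_space \<Rightarrow> ennreal"
  shows "(SUP N. min (v x) (of_nat N) * indicator (cball 0 (real N)) x) = v x"
proof (rule antisym)
  show "(SUP N. min (v x) (of_nat N) * indicator (cball 0 (real N)) x) \<le> v x"
    by (intro SUP_least) (auto simp: indicator_def)
  show "v x \<le> (SUP N. min (v x) (of_nat N) * indicator (cball 0 (real N)) x)"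
  proof (rule dense_le)
    fix y assume y: "y < v x"
    then obtain z where z: "y = ennreal z" "0 \<le> z"
      by (cases y) auto
    obtain N where N: "max z (norm x) < real N"
      using reals_Archimedean2 by blast
    then have "y < of_nat N"
      using z by (simp add: ennreal_less_iff ennreal_of_nat_eq_real_of_nat)
    then have "y \<le> min (v x) (of_nat N) * indicator (cball 0 (real N)) x"
      using y N by auto
    then show "y \<le> (SUP N. min (v x) (of_nat N) * indicator (cball 0 (real N)) x)"
      by (rule SUP_upper2[OF UNIV_I])
  qed
qed

text \<open>For a bounded field \<open>\<psi>\<close> of compact support, Fubini's theorem and the symmetry of the kernel
  turn the integral of \<open>grad g \<bullet> \<psi>\<close>, where \<open>g\<close> is the mollified indicator of \<open>E\<close>, into minus the integral
  over \<open>E\<close> of the divergence of the mollification of \<open>\<psi>\<close>.\<close>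

lemma div_pairing_mollify:
  fixes E :: "'a::euclidean_space set" and \<psi> :: "'a \<Rightarrow> 'a"
  assumes k: "mollifier r \<delta> k" and E: "E \<in> sets borel"
    and \<psi>: "\<psi> \<in> borel_measurable borel" "\<And>x. norm (\<psi> x) \<le> M" "compact L" "\<And>x. x \<notin> L \<Longrightarrow> \<psi> x = 0"
  shows "div_pairing (indicat_real E) (mollify k \<psi>)
      = - (\<integral>x. grad (mollify k (indicat_real E)) x \<bullet> \<psi> x \<partial>lborel)"
    and "integrable lborel (\<lambda>x. grad (mollify k (indicat_real E)) x \<bullet> \<psi> x)"
proof -
  have kC: "k \<in> C1c UNIV" and even: "\<And>z. k (- z) = k z"
    using k by (auto simp: mollifier_def)
  obtain D K C where D: "\<And>z. (k has_derivative D z) (at z)" "\<And>h. continuous_on UNIV (\<lambda>z. D z h)"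
      "compact K" "\<And>z. z \<notin> K \<Longrightarrow> k z = 0" "\<And>z h. z \<notin> K \<Longrightarrow> D z h = 0"
      "\<And>z h. \<bar>D z h\<bar> \<le> C * norm h" "\<And>y z. \<bar>k y - k z\<bar> \<le> C * norm (y - z)" and C0: "0 \<le> C"
    using C1c_derivE[OF kC] unfolding real_norm_def by metis
  have lin: "linear (D z)" for z
    using has_derivative_linear[OF D(1)] .
  have odd: "D (- z) h = - D z h" for z h
  proof -
    have "((\<lambda>z. k (- z)) has_derivative (\<lambda>h. D (- z) (- h))) (at z)"
      by (rule has_derivative_compose[of uminus uminus z UNIV k "D (- z)"])
        (auto intro!: derivative_eq_intros D(1))
    then have "(k has_derivative (\<lambda>h. D (- z) (- h))) (at z)"
      by (simp add: even)
    then have "D z = (\<lambda>h. D (- z) (- h))"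
      using D(1) has_derivative_unique by blast
    then show ?thesis
      by (simp add: linear_neg[OF lin])
  qed
  have mE: "indicat_real E \<in> borel_measurable borel" "\<And>x. norm (indicat_real E x) \<le> 1"
    using E by (auto simp: indicator_def)
  define F where "F y x = indicat_real E y * D (y - x) (\<psi> x)" for y x
  have expand: "D z h = (\<Sum>i\<in>Basis. (h \<bullet> i) * D z i)" for z h
  proof -
    have "D z h = D z (\<Sum>i\<in>Basis. (h \<bullet> i) *\<^sub>R i)"
      by (simp add: euclidean_representation)
    also have "\<dots> = (\<Sum>i\<in>Basis. (h \<bullet> i) * D z i)"
      by (simp add: linear_sum[OF lin] linear_scale[OF lin])
    finally show ?thesis .
  qed
  have grad: "grad (mollify k (indicat_real E)) x \<bullet> \<psi> x = - (\<integral>y. F y x \<partial>lborel)" for x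
  proof -
    have intD: "integrable lborel (\<lambda>y. D (x - y) i * indicat_real E y)" for i
      using integrable_shift[OF D(2,3,5) mE] by simp
    have pd: "partial_deriv i (mollify k (indicat_real E)) x = (\<integral>y. D (x - y) i * indicat_real E y \<partial>lborel)" for i
      using partial_deriv_eq[OF has_derivative_mollify[OF D(1-7) mE], of i x] by (simp add: mollify_def)
    have "grad (mollify k (indicat_real E)) x \<bullet> \<psi> x
        = (\<Sum>i\<in>Basis. (\<psi> x \<bullet> i) * (\<integral>y. D (x - y) i * indicat_real E y \<partial>lborel))"
      unfolding grad_def pd inner_sum_left by (simp add: inner_commute mult.commute)
    also have "\<dots> = (\<Sum>i\<in>Basis. (\<integral>y. (\<psi> x \<bullet> i) * (D (x - y) i * indicat_real E y) \<partial>lborel))"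
      by simp
    also have "\<dots> = (\<integral>y. (\<Sum>i\<in>Basis. (\<psi> x \<bullet> i) * (D (x - y) i * indicat_real E y)) \<partial>lborel)"
      by (rule Bochner_Integration.integral_sum[symmetric]) (intro integrable_mult_right intD)
    also have "\<dots> = (\<integral>y. - F y x \<partial>lborel)"
    proof (intro Bochner_Integration.integral_cong refl)
      fix y
      have "D (y - x) (\<psi> x) = - D (x - y) (\<psi> x)"
        using odd[of "x - y"] by simp
      then show "(\<Sum>i\<in>Basis. (\<psi> x \<bullet> i) * (D (x - y) i * indicat_real E y)) = - F y x"
        by (simp add: F_def expand[of "x - y" "\<psi> x"] sum_distrib_left mult_ac)
    qed
    finally show ?thesis
      by simp
  qed
  obtain R where R: "K \<subseteq> cball 0 R"
    using compact_subset_cball[OF D(3)] by blast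
  obtain S where S: "L \<subseteq> cball 0 S"
    using compact_subset_cball[OF \<psi>(3)] by blast
  have "integrable (lborel :: ('a \<times> 'a) measure) (\<lambda>(y, x). F y x)"
  proof (rule integrable_bounded_compact)
    show "compact (cball 0 (R + S) \<times> cball 0 S :: ('a \<times> 'a) set)"
      by (intro compact_Times compact_cball)
    have [measurable]: "(\<lambda>z. D z i) \<in> borel_measurable borel" for i
      by (intro borel_measurable_continuous_onI D)
    note [measurable] = E \<psi>(1)
    show "(\<lambda>(y, x). F y x) \<in> borel_measurable borel"
      unfolding F_def expand[of _ "\<psi> _"] borel_prod[symmetric] by measurable
    show "norm (case p of (y, x) \<Rightarrow> F y x) \<le> C * M" for p
    proof (cases p)
      case (Pair y x)
      have DM: "\<bar>D (y - x) (\<psi> x)\<bar> \<le> C * M"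
        using D(6)[of "y - x" "\<psi> x"] mult_left_mono[OF \<psi>(2)[of x] C0] by linarith
      then show ?thesis
        using Pair DM order_trans[OF abs_ge_zero DM] by (auto simp: F_def indicator_def)
    qed
    show "(case p of (y, x) \<Rightarrow> F y x) = 0" if "p \<notin> cball 0 (R + S) \<times> cball 0 S" for p
    proof (cases p)
      case (Pair y x)
      show ?thesis
      proof (cases "x \<in> cball 0 S")
        case True
        then have "y \<notin> cball 0 (R + S)"
          using that Pair by auto
        then have "x - y \<notin> K"
          using shift_outside[OF R _ , of x S y] True by simp
        then have "D (x - y) (\<psi> x) = 0"
          by (rule D(5))
        then show ?thesis
          using Pair odd[of "x - y" "\<psi> x"] by (simp add: F_def)
      next
        case False
        then have "\<psi> x = 0"
          using S \<psi>(4) by blast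
        then show ?thesis
          using Pair linear_0[OF lin] by (simp add: F_def)
      qed
    qed
  qed
  then have int: "integrable (lborel \<Otimes>\<^sub>M lborel) (case_prod F)"
    by (simp add: lborel_prod)
  show "integrable lborel (\<lambda>x. grad (mollify k (indicat_real E)) x \<bullet> \<psi> x)"
    unfolding grad using lborel_pair.integrable_snd[OF int] by simp
  have "div_pairing (indicat_real E) (mollify k \<psi>)
      = (\<integral>y. indicat_real E y * divergence (mollify k \<psi>) y \<partial>lborel)"
    unfolding div_pairing_def
    by (intro integral_completion borel_measurable_times)
      (simp_all add: mE(1) borel_measurable_continuous_onI continuous_divergence
        C1_map_mollify[OF kC \<psi>(1,2)])
  also have "\<dots> = (\<integral>y. (\<integral>x. F y x \<partial>lborel) \<partial>lborel)"
    by (simp add: divergence_mollify[OF D(1-7) \<psi>(1,2)] F_def)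
  also have "\<dots> = (\<integral>x. (\<integral>y. F y x \<partial>lborel) \<partial>lborel)"
    by (rule lborel_pair.Fubini_integral[OF int, symmetric])
  also have "\<dots> = - (\<integral>x. grad (mollify k (indicat_real E)) x \<bullet> \<psi> x \<partial>lborel)"
    by (simp add: grad)
  finally show "div_pairing (indicat_real E) (mollify k \<psi>)
      = - (\<integral>x. grad (mollify k (indicat_real E)) x \<bullet> \<psi> x \<partial>lborel)" .
qed

text \<open>The integral of \<open>norm (grad g) * v\<close> is approached by testing \<open>grad g\<close> with the unit field along it,
  multiplied by truncations of \<open>v\<close> that are bounded and of compact support. Such a field \<open>\<psi>\<close> is merely
  measurable, but what is paired with \<open>E\<close> is its mollification, a smooth field that is pointwise
  bounded by the mollification of \<open>v\<close>.\<close>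

lemma gradient_integral_dual:
  fixes E :: "'a::euclidean_space set" and v :: "'a \<Rightarrow> ennreal"
  assumes k: "mollifier r \<delta> k" and E: "E \<in> sets borel" and v: "v \<in> borel_measurable borel"
    and a: "a < (\<integral>\<^sup>+x. ennreal (norm (grad (mollify k (indicat_real E)) x)) * v x \<partial>lborel)"
  obtains \<phi> where "\<phi> \<in> C1c UNIV" "a < ennreal (div_pairing (indicat_real E) \<phi>)"
    "\<And>x. ennreal (norm (\<phi> x)) \<le> emollify k v x"
proof -
  define G where "G = grad (mollify k (indicat_real E))"
  define T where "T N x = min (v x) (of_nat N) * indicator (cball 0 (real N)) x" for N x
  have k': "k \<in> C1c UNIV" "\<And>z. 0 \<le> k z" "\<And>z. r \<le> norm z \<Longrightarrow> k z = 0"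
    using k by (auto simp: mollifier_def)
  have mE: "indicat_real E \<in> borel_measurable borel" "\<And>x. norm (indicat_real E x) \<le> 1"
    using E by (auto simp: indicator_def)
  have mG: "G \<in> borel_measurable borel"
    unfolding G_def by (intro borel_measurable_continuous_onI continuous_grad C1_map_mollify[OF k'(1) mE])
  note [measurable] = mG v
  have mT [measurable]: "T N \<in> borel_measurable borel" for N
    unfolding T_def by (rule borel_measurable_truncation[OF v])
  have "(\<integral>\<^sup>+x. ennreal (norm (G x)) * v x \<partial>lborel)
      = (\<integral>\<^sup>+x. (SUP N. ennreal (norm (G x)) * T N x) \<partial>lborel)"
    unfolding T_def by (simp add: SUP_truncation flip: SUP_mult_left_ennreal)
  also have "\<dots> = (SUP N. \<integral>\<^sup>+x. ennreal (norm (G x)) * T N x \<partial>lborel)"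
  proof (rule nn_integral_monotone_convergence_SUP)
    show "incseq (\<lambda>N x. ennreal (norm (G x)) * T N x)"
      unfolding T_def
      by (auto simp: incseq_def le_fun_def indicator_def intro!: mult_left_mono min.mono of_nat_mono)
  qed measurable
  finally obtain N where N: "a < (\<integral>\<^sup>+x. ennreal (norm (G x)) * T N x \<partial>lborel)"
    using a unfolding G_def[symmetric] by (auto simp: less_SUP_iff)
  define U where "U x = enn2real (T N x)" for x
  have T_le: "T N x \<le> of_nat N" for x
    by (auto simp: T_def indicator_def)
  then have T_fin: "T N x < \<infinity>" for x
    by (rule le_less_trans) (simp add: of_nat_less_top)
  have U: "ennreal (U x) = T N x" "0 \<le> U x" for x
    using T_fin[of x] by (auto simp: U_def ennreal_enn2real_if)
  have "ennreal (U x) \<le> ennreal (real N)" for x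
    using T_le[of x] by (simp add: U(1) ennreal_of_nat_eq_real_of_nat)
  then have U_le: "U x \<le> real N" for x
    by (simp add: ennreal_le_iff)
  have U_out: "U x = 0" if "x \<notin> cball 0 (real N)" for x
    using that by (simp add: U_def T_def)
  define \<psi> where "\<psi> x = - (U x *\<^sub>R sgn (G x))" for x
  have \<psi>m: "\<psi> \<in> borel_measurable borel"
    unfolding \<psi>_def U_def sgn_div_norm by measurable
  have n\<psi>: "norm (\<psi> x) \<le> U x" for x
    using U(2)[of x] by (simp add: \<psi>_def norm_sgn)
  have \<psi>N: "norm (\<psi> x) \<le> real N" for x
    using n\<psi> U_le order_trans by blast
  have \<psi>0: "\<psi> x = 0" if "x \<notin> cball 0 (real N)" for x
    using U_out[OF that] by (simp add: \<psi>_def)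
  have G\<psi>: "G x \<bullet> \<psi> x = - (norm (G x) * U x)" for x
    by (cases "G x = 0") (auto simp: \<psi>_def sgn_div_norm dot_square_norm power2_eq_square)
  note pairing = div_pairing_mollify[OF k E \<psi>m \<psi>N compact_cball[of 0 "real N"] \<psi>0, folded G_def]
  have "a < (\<integral>\<^sup>+x. ennreal (norm (G x) * U x) \<partial>lborel)"
    using N by (simp add: ennreal_mult U)
  also have "\<dots> = ennreal (\<integral>x. norm (G x) * U x \<partial>lborel)"
    using pairing(2) U(2) by (intro nn_integral_eq_integral) (auto simp: G\<psi>)
  also have "\<dots> = ennreal (div_pairing (indicat_real E) (mollify k \<psi>))"
    using pairing(1) unfolding G\<psi> by simp
  finally have less: "a < ennreal (div_pairing (indicat_real E) (mollify k \<psi>))" .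
  show ?thesis
  proof (rule that[OF _ less])
    show "mollify k \<psi> \<in> C1c UNIV"
    proof (rule C1cI[OF C1_map_mollify[OF k'(1) \<psi>m \<psi>N], of "cball 0 (r + real N)"])
      fix x :: 'a assume x: "x \<notin> cball 0 (r + real N)"
      show "mollify k \<psi> x = 0"
      proof (rule mollify_zero[OF k'(3)])
        fix y assume "dist x y < r"
        then have "y \<notin> cball 0 (real N)"
          using x norm_triangle_ineq2[of x y] by (simp add: dist_norm)
        then show "\<psi> y = 0"
          by (rule \<psi>0)
      qed
    qed auto
    fix x
    obtain L where L: "compact L" "\<And>x. x \<notin> L \<Longrightarrow> k x = 0"
      using C1cE[OF k'(1)] by metis
    have "integrable lborel (\<lambda>y. k (x - y) *\<^sub>R \<psi> y)"
      using k'(1) by (intro integrable_shift[OF C1_map_continuous L \<psi>m \<psi>N]) (auto simp: C1c_iff)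
    then have "ennreal (norm (mollify k \<psi> x)) \<le> (\<integral>\<^sup>+y. ennreal (norm (k (x - y) *\<^sub>R \<psi> y)) \<partial>lborel)"
      unfolding mollify_def by (rule integral_norm_bound_ennreal)
    also have "\<dots> \<le> emollify k v x"
      unfolding emollify_def
    proof (intro nn_integral_mono)
      fix y
      have "ennreal (norm (\<psi> y)) \<le> ennreal (U y)"
        using n\<psi> by (simp add: ennreal_leI)
      also have "\<dots> \<le> v y"
        unfolding U(1) by (auto simp: T_def indicator_def)
      finally show "ennreal (norm (k (x - y) *\<^sub>R \<psi> y)) \<le> ennreal (k (x - y)) * v y"
        using k'(2) by (simp add: ennreal_mult mult_left_mono)
    qed
    finally show "ennreal (norm (mollify k \<psi> x)) \<le> emollify k v x" .
  qed
qed


section \<open>The total variation measure\<close>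

lemma integrable_div_pairing:
  fixes f :: "'a::euclidean_space \<Rightarrow> real"
  assumes f: "locally_integrable f" and \<phi>: "\<phi> \<in> C1c U"
  shows "integrable lebesgue (\<lambda>x. f x * divergence \<phi> x)"
proof -
  obtain K where K: "compact K" "\<And>x. x \<notin> K \<Longrightarrow> divergence \<phi> x = 0"
    using divergence_zero_outside[OF \<phi>] by metis
  have cont: "continuous_on UNIV (divergence \<phi>)"
    using \<phi> by (simp add: C1c_iff continuous_divergence)
  have "bounded (divergence \<phi> ` K)"
    using cont K by (intro compact_imp_bounded compact_continuous_image) (auto elim: continuous_on_subset)
  then obtain B where B: "\<And>x. x \<in> K \<Longrightarrow> \<bar>divergence \<phi> x\<bar> \<le> B"
    by (metis bounded_iff imageI real_norm_def)
  have int: "integrable lebesgue (\<lambda>x. indicat_real K x * f x)"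
    using f K(1) by (simp add: locally_integrable_def set_integrable_def)
  have [measurable]: "divergence \<phi> \<in> borel_measurable lebesgue"
    using borel_measurable_continuous_onI[OF cont] by (simp add: measurable_completion)
  have eq: "f x * divergence \<phi> x = (indicat_real K x * f x) * divergence \<phi> x" for x
    using K(2)[of x] by (cases "x \<in> K") auto
  show ?thesis
  proof (rule Bochner_Integration.integrable_bound)
    show "integrable lebesgue (\<lambda>x. B * (indicat_real K x * f x))"
      using int by simp
    show "(\<lambda>x. f x * divergence \<phi> x) \<in> borel_measurable lebesgue"
      unfolding eq using borel_measurable_integrable[OF int] by measurable
    show "AE x in lebesgue. norm (f x * divergence \<phi> x) \<le> norm (B * (indicat_real K x * f x))"
    proof (intro AE_I2)
      fix x
      show "norm (f x * divergence \<phi> x) \<le> norm (B * (indicat_real K x * f x))"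
        using B[of x] K(2)[of x]
        by (cases "x \<in> K") (auto simp: abs_mult mult.commute[of B] intro!: mult_left_mono)
    qed
  qed
qed

lemma div_pairing_add:
  assumes "locally_integrable f" "\<phi> \<in> C1c U" "\<psi> \<in> C1c W"
  shows "div_pairing f (\<lambda>x. \<phi> x + \<psi> x) = div_pairing f \<phi> + div_pairing f \<psi>"
proof -
  have "C1_map \<phi>" "C1_map \<psi>"
    using assms by (auto simp: C1c_iff)
  then show ?thesis
    unfolding div_pairing_def
    using Bochner_Integration.integral_add[OF integrable_div_pairing[OF assms(1,2)] integrable_div_pairing[OF assms(1,3)]]
    by (simp add: divergence_add distrib_left)
qed

lemma div_pairing_cmult:
  assumes "\<phi> \<in> C1c U"
  shows "div_pairing f (\<lambda>x. c *\<^sub>R \<phi> x) = c * div_pairing f \<phi>"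
proof -
  have "C1_map \<phi>"
    using assms by (auto simp: C1c_iff)
  then have "div_pairing f (\<lambda>x. c *\<^sub>R \<phi> x) = (\<integral>x. c * (f x * divergence \<phi> x) \<partial>lebesgue)"
    unfolding div_pairing_def by (simp add: divergence_scaleR mult_ac)
  then show ?thesis
    by (simp add: div_pairing_def)
qed

lemma div_pairing_zero [simp]: "div_pairing f (\<lambda>x. 0) = 0"
  using div_pairing_cmult[OF C1c_zero, of f 0] by simp

lemma div_pairing_sum:
  assumes f: "locally_integrable f" and "finite I" and "\<And>i. i \<in> I \<Longrightarrow> \<phi> i \<in> C1c U"
  shows "div_pairing f (\<lambda>x. \<Sum>i\<in>I. \<phi> i x) = (\<Sum>i\<in>I. div_pairing f (\<phi> i))"
  using assms(2,3)
proof (induction I rule: finite_induct)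
  case (insert j I)
  have "(\<lambda>x. \<Sum>i\<in>I. \<phi> i x) \<in> C1c U"
    by (rule C1c_sum) (use insert in auto)
  then have "div_pairing f (\<lambda>x. \<phi> j x + (\<Sum>i\<in>I. \<phi> i x)) = div_pairing f (\<phi> j) + div_pairing f (\<lambda>x. \<Sum>i\<in>I. \<phi> i x)"
    using div_pairing_add[OF f] insert.prems[of j] by blast
  then show ?case
    using insert by simp
qed simp

lemma variation_on_eq:
  "variation_on f U = (SUP \<phi> \<in> {\<phi> \<in> C1c U. \<forall>x. norm (\<phi> x) \<le> 1}. ennreal (div_pairing f \<phi>))"
  by (simp add: variation_on_def div_pairing_def)

lemma div_pairing_le_variation_on:
  assumes \<phi>: "\<phi> \<in> C1c U" and c: "0 \<le> c" "\<And>x. norm (\<phi> x) \<le> c"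
  shows "ennreal (div_pairing f \<phi>) \<le> ennreal c * variation_on f U"
proof (cases "c = 0")
  case True
  then have "\<phi> = (\<lambda>x. 0)"
    using c(2) by auto
  then show ?thesis
    by simp
next
  case False
  then have c0: "0 < c"
    using c by simp
  have "ennreal (div_pairing f (\<lambda>x. (1 / c) *\<^sub>R \<phi> x)) \<le> variation_on f U"
    unfolding variation_on_eq
    by (intro SUP_upper) (use c0 c C1c_cmult[OF \<phi>, of "1 / c"] in \<open>auto simp: divide_le_eq\<close>)
  then have "ennreal c * ennreal (div_pairing f (\<lambda>x. (1 / c) *\<^sub>R \<phi> x)) \<le> ennreal c * variation_on f U"
    by (rule mult_left_mono) simp
  then show ?thesis
    using c0 by (simp add: div_pairing_cmult[OF \<phi>] flip: ennreal_mult')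
qed

lemma variation_on_mono: "U \<subseteq> W \<Longrightarrow> variation_on f U \<le> variation_on f W"
  unfolding variation_on_eq by (intro SUP_subset_mono) (auto intro: C1c_mono)

lemma variation_on_empty [simp]: "variation_on f {} = 0"
proof -
  have "\<phi> = (\<lambda>x. 0)" if "\<phi> \<in> C1c {}" for \<phi> :: "'a \<Rightarrow> 'a"
    using C1c_zero_outside[OF that] by auto
  then have "variation_on f {} \<le> 0"
    unfolding variation_on_eq by (intro SUP_least) force
  then show ?thesis
    by simp
qed

text \<open>The cutoff equals \<open>1\<close> near the part of the support of \<open>\<phi>\<close> that \<open>W\<close> misses.\<close>

lemma C1c_split:
  fixes \<phi> :: "'a::euclidean_space \<Rightarrow> 'b::euclidean_space"
  assumes \<phi>: "\<phi> \<in> C1c (U \<union> W)" and UW: "open U" "open W"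
  obtains \<zeta> where "\<And>x. 0 \<le> \<zeta> x \<and> \<zeta> x \<le> (1::real)" "(\<lambda>x. \<zeta> x *\<^sub>R \<phi> x) \<in> C1c U"
    "(\<lambda>x. (1 - \<zeta> x) *\<^sub>R \<phi> x) \<in> C1c W"
proof -
  obtain K where K: "C1_map \<phi>" "compact K" "K \<subseteq> U \<union> W" "\<And>x. x \<notin> K \<Longrightarrow> \<phi> x = 0"
    using C1cE[OF \<phi>] by metis
  have "compact (K - W)" "K - W \<subseteq> U"
    using K UW by (auto intro: compact_diff)
  then obtain \<zeta> V where \<zeta>: "\<zeta> \<in> C1c U" "\<And>x. 0 \<le> \<zeta> x \<and> \<zeta> x \<le> (1::real)" "open V" "K - W \<subseteq> V"
      "\<And>x. x \<in> V \<Longrightarrow> \<zeta> x = 1"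
    using C1_cutoff[OF _ UW(1)] by metis
  obtain L where L: "C1_map \<zeta>" "compact L" "L \<subseteq> U" "\<And>x. x \<notin> L \<Longrightarrow> \<zeta> x = 0"
    using C1cE[OF \<zeta>(1)] by metis
  show ?thesis
  proof (rule that[OF \<zeta>(2)])
    show "(\<lambda>x. \<zeta> x *\<^sub>R \<phi> x) \<in> C1c U"
      by (rule C1cI[OF C1_map_scaleR[OF L(1) K(1)] L(2,3)]) (simp add: L(4))
    show "(\<lambda>x. (1 - \<zeta> x) *\<^sub>R \<phi> x) \<in> C1c W"
      by (rule C1cI[OF C1_map_scaleR[OF C1_map_diff[OF C1_map_const L(1)] K(1)], of "K - V"])
        (use K \<zeta> in \<open>auto intro: compact_diff\<close>)
  qed
qed

text \<open>Splitting \<open>\<phi>\<close> by a partition of unity subordinate to a finite open cover of its support gives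
  both the subadditivity of the variation and, with different bounds \<open>c i\<close>, an upper Riemann sum.\<close>

lemma div_pairing_le_sum:
  assumes f: "locally_integrable f" and "finite I" and "\<phi> \<in> C1c (\<Union>i\<in>I. U i)"
    and "\<And>i. i \<in> I \<Longrightarrow> open (U i)" "\<And>i. i \<in> I \<Longrightarrow> 0 \<le> c i"
    and "\<And>i x. i \<in> I \<Longrightarrow> x \<in> U i \<Longrightarrow> norm (\<phi> x) \<le> c i"
  shows "ennreal (div_pairing f \<phi>) \<le> (\<Sum>i\<in>I. ennreal (c i) * variation_on f (U i))"
  using assms(2-)
proof (induction I arbitrary: \<phi> rule: finite_induct)
  case empty
  then have "\<phi> = (\<lambda>x. 0)"
    using C1c_zero_outside[of \<phi> "{}"] by auto
  then show ?case
    by simp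
next
  case (insert j I)
  have op: "open (U j)" "open (\<Union>i\<in>I. U i)"
    using insert.prems(2) by auto
  have "\<phi> \<in> C1c (U j \<union> (\<Union>i\<in>I. U i))"
    using insert.prems(1) by simp
  then obtain \<zeta> where \<zeta>: "\<And>x. 0 \<le> \<zeta> x \<and> \<zeta> x \<le> (1::real)" "(\<lambda>x. \<zeta> x *\<^sub>R \<phi> x) \<in> C1c (U j)"
      "(\<lambda>x. (1 - \<zeta> x) *\<^sub>R \<phi> x) \<in> C1c (\<Union>i\<in>I. U i)"
    using C1c_split[OF _ op] by metis
  have less: "norm (s *\<^sub>R \<phi> x) \<le> b" if "norm (\<phi> x) \<le> b" "0 \<le> s" "s \<le> 1" for s b x
    using that mult_left_le_one_le[of "norm (\<phi> x)" s] by simp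
  have "norm (\<zeta> x *\<^sub>R \<phi> x) \<le> c j" for x
  proof (cases "x \<in> U j")
    case True
    then show ?thesis
      using insert.prems(4) \<zeta>(1) by (intro less) auto
  next
    case False
    then show ?thesis
      unfolding C1c_zero_outside[OF \<zeta>(2) False] using insert.prems(3)[of j] by simp
  qed
  then have 1: "ennreal (div_pairing f (\<lambda>x. \<zeta> x *\<^sub>R \<phi> x)) \<le> ennreal (c j) * variation_on f (U j)"
    using insert.prems(3)[of j] by (intro div_pairing_le_variation_on \<zeta>(2)) auto
  have 2: "ennreal (div_pairing f (\<lambda>x. (1 - \<zeta> x) *\<^sub>R \<phi> x)) \<le> (\<Sum>i\<in>I. ennreal (c i) * variation_on f (U i))"
    using insert.prems \<zeta>(1) by (intro insert.IH \<zeta>(3) less) auto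
  have "div_pairing f \<phi> = div_pairing f (\<lambda>x. \<zeta> x *\<^sub>R \<phi> x) + div_pairing f (\<lambda>x. (1 - \<zeta> x) *\<^sub>R \<phi> x)"
    using div_pairing_add[OF f \<zeta>(2,3)] by (simp flip: scaleR_add_left)
  then have "ennreal (div_pairing f \<phi>)
      \<le> ennreal (div_pairing f (\<lambda>x. \<zeta> x *\<^sub>R \<phi> x)) + ennreal (div_pairing f (\<lambda>x. (1 - \<zeta> x) *\<^sub>R \<phi> x))"
    by (simp add: ennreal_plus_if ennreal_leI)
  also have "\<dots> \<le> ennreal (c j) * variation_on f (U j) + (\<Sum>i\<in>I. ennreal (c i) * variation_on f (U i))"
    by (rule add_mono[OF 1 2])
  finally show ?case
    using insert.hyps by simp
qed

lemma variation_on_UN: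
  fixes U :: "nat \<Rightarrow> 'a::euclidean_space set"
  assumes f: "locally_integrable f" and U: "\<And>n. open (U n)"
  shows "variation_on f (\<Union>n. U n) \<le> (\<Sum>n. variation_on f (U n))"
proof -
  have "ennreal (div_pairing f \<phi>) \<le> (\<Sum>n. variation_on f (U n))"
    if \<phi>: "\<phi> \<in> C1c (\<Union>n. U n)" and le: "\<forall>x. norm (\<phi> x) \<le> 1" for \<phi>
  proof -
    obtain K where K: "C1_map \<phi>" "compact K" "K \<subseteq> (\<Union>n. U n)" "\<And>x. x \<notin> K \<Longrightarrow> \<phi> x = 0"
      using C1cE[OF \<phi>] by metis
    obtain I where I: "finite I" "K \<subseteq> (\<Union>n\<in>I. U n)"
      using compactE_image[OF K(2), of UNIV U] U K(3) by auto
    have "\<phi> \<in> C1c (\<Union>n\<in>I. U n)"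
      by (rule C1cI[OF K(1,2) I(2) K(4)])
    then have "ennreal (div_pairing f \<phi>) \<le> (\<Sum>n\<in>I. ennreal 1 * variation_on f (U n))"
      using U le I(1) by (intro div_pairing_le_sum f) auto
    also have "\<dots> \<le> (\<Sum>n. variation_on f (U n))"
      using I(1) by (simp add: sum_le_suminf)
    finally show ?thesis .
  qed
  then show ?thesis
    unfolding variation_on_eq[of f "\<Union>n. U n"] by (intro SUP_least) auto
qed

definition outer_variation :: "('a::euclidean_space \<Rightarrow> real) \<Rightarrow> 'a set \<Rightarrow> ennreal" where
  "outer_variation f A = (INF U \<in> {U. open U \<and> A \<subseteq> U}. variation_on f U)"

lemma outer_variation_le: "open U \<Longrightarrow> A \<subseteq> U \<Longrightarrow> outer_variation f A \<le> variation_on f U"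
  unfolding outer_variation_def by (intro INF_lower) auto

lemma outer_variation_open: "open U \<Longrightarrow> outer_variation f U = variation_on f U"
  by (intro antisym outer_variation_le) (auto simp: outer_variation_def intro!: INF_greatest variation_on_mono)

lemma outer_variation_approx:
  assumes "outer_variation f A < \<infinity>" "0 < e"
  obtains U where "open U" "A \<subseteq> U" "variation_on f U \<le> outer_variation f A + ennreal e"
proof -
  have "outer_variation f A < outer_variation f A + ennreal e"
    using assms by (cases "outer_variation f A") (auto simp: ennreal_less_iff simp flip: ennreal_plus)
  then show ?thesis
    using that unfolding outer_variation_def[of f A] by (force simp: INF_less_iff)
qed

lemma outer_measure_space_outer_variation:
  fixes f :: "'a::euclidean_space \<Rightarrow> real"
  assumes f: "locally_integrable f"
  shows "outer_measure_space (Pow UNIV) (outer_variation f)"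
  unfolding outer_measure_space_def
proof (intro conjI)
  show "positive (Pow UNIV) (outer_variation f)"
    by (simp add: positive_def outer_variation_open)
  show "increasing (Pow UNIV) (outer_variation f)"
    unfolding increasing_def outer_variation_def by (auto intro!: INF_superset_mono)
  have "outer_variation f (\<Union>n. A n) \<le> (\<Sum>n. outer_variation f (A n))" for A :: "nat \<Rightarrow> 'a set"
  proof (rule ennreal_le_epsilon)
    fix e :: real assume e: "0 < e" and fin: "(\<Sum>n. outer_variation f (A n)) < top"
    have "\<exists>U. open U \<and> A n \<subseteq> U \<and> variation_on f U \<le> outer_variation f (A n) + ennreal (e * (1/2) ^ Suc n)" for n
    proof -
      have "outer_variation f (A n) < \<infinity>"
        using ennreal_suminf_lessD[OF fin, of n] by simp
      then show ?thesis
        by (rule outer_variation_approx[of f "A n" "e * (1/2) ^ Suc n"]) (use e in auto)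
    qed
    then obtain U where U: "\<And>n. open (U n)" "\<And>n. A n \<subseteq> U n"
        "\<And>n. variation_on f (U n) \<le> outer_variation f (A n) + ennreal (e * (1/2) ^ Suc n)"
      by metis
    have "outer_variation f (\<Union>n. A n) \<le> variation_on f (\<Union>n. U n)"
      using U by (intro outer_variation_le) blast+
    also have "\<dots> \<le> (\<Sum>n. variation_on f (U n))"
      by (rule variation_on_UN[OF f U(1)])
    also have "\<dots> \<le> (\<Sum>n. outer_variation f (A n) + ennreal (e * (1/2) ^ Suc n))"
      by (intro suminf_le U) auto
    also have "\<dots> = (\<Sum>n. outer_variation f (A n)) + (\<Sum>n. ennreal e * ennreal ((1/2) ^ Suc n))"
      using e by (subst suminf_add[symmetric])
        (auto simp del: ennreal_suminf_cmult simp add: ennreal_mult[symmetric])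
    also have "\<dots> = (\<Sum>n. outer_variation f (A n)) + ennreal e"
      unfolding ennreal_suminf_cmult
      by (subst suminf_ennreal_eq[OF zero_le_power power_half_series]) auto
    finally show "outer_variation f (\<Union>n. A n) \<le> (\<Sum>n. outer_variation f (A n)) + ennreal e" .
  qed
  then show "countably_subadditive (Pow UNIV) (outer_variation f)"
    by (simp add: countably_subadditive_def)
qed

text \<open>De Giorgi--Letta: given \<open>W \<supseteq> A\<close> open, a field of compact support \<open>K\<close> in \<open>W \<inter> U\<close> and a field
  supported in \<open>W - K\<close> add up to an admissible field on \<open>W\<close>, which separates \<open>A \<inter> U\<close> from \<open>A - U\<close>.\<close>

lemma open_in_lambda_system:
  fixes f :: "'a::euclidean_space \<Rightarrow> real"
  assumes f: "locally_integrable f" and U: "open U"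
  shows "U \<in> lambda_system UNIV (Pow UNIV) (outer_variation f)"
proof -
  interpret sigma_algebra UNIV "Pow UNIV :: 'a set set"
    by (rule sigma_algebra_Pow)
  have oms: "outer_measure_space (Pow UNIV) (outer_variation f)"
    by (rule outer_measure_space_outer_variation[OF f])
  then have sub: "subadditive (Pow UNIV) (outer_variation f)"
    unfolding outer_measure_space_def by (blast intro: countably_subadditive_subadditive)
  have "outer_variation f (A \<inter> U) + outer_variation f (A - U) = outer_variation f A" for A
  proof (rule antisym)
    have "outer_variation f ((A \<inter> U) \<union> (A - U)) \<le> outer_variation f (A \<inter> U) + outer_variation f (A - U)"
      by (rule subadditiveD[OF sub]) auto
    then show "outer_variation f A \<le> outer_variation f (A \<inter> U) + outer_variation f (A - U)"
      by (simp add: Int_Diff_Un)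
    have "outer_variation f (A \<inter> U) + outer_variation f (A - U) \<le> variation_on f W"
      if W: "open W" "A \<subseteq> W" for W
    proof -
      have "ennreal (div_pairing f \<phi>) + outer_variation f (A - U) \<le> variation_on f W"
        if \<phi>: "\<phi> \<in> C1c (W \<inter> U)" "\<forall>x. norm (\<phi> x) \<le> 1" for \<phi>
      proof -
        obtain K where K: "C1_map \<phi>" "compact K" "K \<subseteq> W \<inter> U" "\<And>x. x \<notin> K \<Longrightarrow> \<phi> x = 0"
          using C1cE[OF \<phi>(1)] by metis
        have opK: "open (W - K)"
          using W(1) K(2) by (simp add: compact_imp_closed open_Diff)
        have "ennreal (div_pairing f \<phi>) + ennreal (div_pairing f \<psi>) \<le> variation_on f W"
          if \<psi>: "\<psi> \<in> C1c (W - K)" "\<forall>x. norm (\<psi> x) \<le> 1" for \<psi>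
        proof -
          have one: "ennreal (div_pairing f \<xi>) \<le> variation_on f W"
            if "\<xi> \<in> C1c W" "\<forall>x. norm (\<xi> x) \<le> 1" for \<xi>
            unfolding variation_on_eq using that by (intro SUP_upper) auto
          have W\<phi>: "\<phi> \<in> C1c W" and W\<psi>: "\<psi> \<in> C1c W"
            using C1c_mono[OF \<phi>(1)] C1c_mono[OF \<psi>(1)] by auto
          have "norm (\<phi> x + \<psi> x) \<le> 1" for x
            using \<phi>(2) \<psi>(2) K(4)[of x] C1c_zero_outside[OF \<psi>(1), of x] by (cases "x \<in> K") auto
          then have "ennreal (div_pairing f \<phi> + div_pairing f \<psi>) \<le> variation_on f W"
            using one[OF C1c_add[OF W\<phi> W\<psi>]] div_pairing_add[OF f W\<phi> W\<psi>] by simp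
          moreover have "ennreal (div_pairing f \<phi>) \<le> variation_on f W" "ennreal (div_pairing f \<psi>) \<le> variation_on f W"
            using one W\<phi> W\<psi> \<phi>(2) \<psi>(2) by auto
          ultimately show ?thesis
            by (cases "0 \<le> div_pairing f \<phi>"; cases "0 \<le> div_pairing f \<psi>") (auto simp: ennreal_neg)
        qed
        then have "ennreal (div_pairing f \<phi>) + variation_on f (W - K) \<le> variation_on f W"
          unfolding variation_on_eq[of f "W - K"]
          by (subst ennreal_SUP_add_right) (auto intro!: SUP_least exI[of _ "\<lambda>x. 0"] C1c_zero)
        moreover have "outer_variation f (A - U) \<le> variation_on f (W - K)"
          using opK W K(3) by (intro outer_variation_le) auto
        ultimately show ?thesis
          by (meson add_left_mono order_trans)
      qed
      then have "variation_on f (W \<inter> U) + outer_variation f (A - U) \<le> variation_on f W"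
        unfolding variation_on_eq[of f "W \<inter> U"]
        by (subst ennreal_SUP_add_left[symmetric]) (auto intro!: SUP_least exI[of _ "\<lambda>x. 0"] C1c_zero)
      moreover have "outer_variation f (A \<inter> U) \<le> variation_on f (W \<inter> U)"
        using W U by (intro outer_variation_le) auto
      ultimately show ?thesis
        by (meson add_right_mono order_trans)
    qed
    then show "outer_variation f (A \<inter> U) + outer_variation f (A - U) \<le> outer_variation f A"
      unfolding outer_variation_def[of f A] by (intro INF_greatest) auto
  qed
  then show ?thesis
    unfolding lambda_system_eq by simp
qed

lemma variation_measure_props:
  fixes f :: "'a::euclidean_space \<Rightarrow> real"
  assumes f: "locally_integrable f"
  shows "sets (variation_measure f) = sets borel" "space (variation_measure f) = UNIV"
    "A \<in> sets borel \<Longrightarrow> emeasure (variation_measure f) A = outer_variation f A"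
proof -
  interpret P: sigma_algebra UNIV "Pow UNIV :: 'a set set"
    by (rule sigma_algebra_Pow)
  interpret B: sigma_algebra UNIV "sets (borel :: 'a measure)"
    using sets.sigma_algebra_axioms[of borel] by simp
  define \<Lambda> where "\<Lambda> = lambda_system UNIV (Pow UNIV) (outer_variation f)"
  have ms: "measure_space UNIV \<Lambda> (outer_variation f)"
    unfolding \<Lambda>_def by (rule P.caratheodory_lemma[OF outer_measure_space_outer_variation[OF f]])
  have "sigma_sets UNIV {U. open U} \<subseteq> \<Lambda>"
    using ms open_in_lambda_system[OF f]
    by (intro sigma_algebra.sigma_sets_subset) (auto simp: measure_space_def \<Lambda>_def)
  then have "sets borel \<subseteq> \<Lambda>"
    by (simp add: borel_def)
  then have msb: "measure_space UNIV (sets borel) (outer_variation f)"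
    using measure_down[OF ms B.sigma_algebra_axioms] by simp
  have eq: "variation_measure f = measure_of UNIV (sets borel) (outer_variation f)"
    unfolding variation_measure_def outer_variation_def ..
  show "sets (variation_measure f) = sets borel" "space (variation_measure f) = UNIV"
    unfolding eq by (simp_all add: B.sigma_sets_eq)
  show "emeasure (variation_measure f) A = outer_variation f A" if "A \<in> sets borel"
    unfolding eq using msb that B.sigma_algebra_axioms
    by (intro emeasure_measure_of_sigma) (auto simp: measure_space_def)
qed


text \<open>Layers of width \<open>d\<close> in the values of \<open>norm \<phi>\<close> are enlarged to open sets by outer regularity, and
  the resulting upper sums converge to the integral as \<open>d \<rightarrow> 0\<close>.\<close>

lemma div_pairing_le_integral:
  fixes f :: "'a::euclidean_space \<Rightarrow> real"
  assumes f: "locally_integrable f" and fin: "\<And>R. variation_on f (ball 0 R) < \<infinity>"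
    and \<phi>: "\<phi> \<in> C1c UNIV"
  shows "ennreal (div_pairing f \<phi>) \<le> (\<integral>\<^sup>+x. ennreal (norm (\<phi> x)) \<partial>variation_measure f)"
proof (rule ennreal_le_epsilon)
  fix e :: real assume e: "0 < e"
  define \<mu> where "\<mu> = variation_measure f"
  note \<mu> = variation_measure_props[OF f, folded \<mu>_def]
  obtain K where K: "C1_map \<phi>" "compact K" "\<And>x. x \<notin> K \<Longrightarrow> \<phi> x = 0"
    using C1cE[OF \<phi>] by metis
  have cont: "continuous_on UNIV \<phi>"
    by (rule C1_map_continuous[OF K(1)])
  obtain R where R: "K \<subseteq> cball 0 R"
    using compact_subset_cball[OF K(2)] by blast
  define B where "B = ball (0::'a) (R + 1)"
  have KB: "K \<subseteq> B"
    using R by (auto simp: B_def)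
  have Bm: "B \<in> sets borel" "open B"
    by (auto simp: B_def)
  have "emeasure \<mu> B < \<infinity>"
    using fin[of "R + 1"] by (simp add: \<mu>(3)[OF Bm(1)] outer_variation_open[OF Bm(2)] B_def[symmetric])
  then obtain b where b: "emeasure \<mu> B = ennreal b" "0 \<le> b"
    by (cases "emeasure \<mu> B") auto
  \<comment> \<open>The layer width costs \<open>d * b\<close> and outer regularity costs \<open>d\<close>.\<close>
  define d where "d = e / (b + 1)"
  have d: "0 < d"
    using e b by (simp add: d_def)
  have "d * (b + 1) = e"
    using b by (simp add: d_def)
  then have db: "d * b + d = e"
    by (simp add: distrib_left)
  obtain C where C: "\<And>x. norm (\<phi> x) \<le> C"
    using C1c_derivE[OF \<phi>] by metis
  obtain N where N: "C / d < real N"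
    using reals_Archimedean2 by blast
  define j where "j x = nat \<lfloor>norm (\<phi> x) / d\<rfloor>" for x
  have j: "real (j x) * d \<le> norm (\<phi> x)" "norm (\<phi> x) < (real (j x) + 1) * d" for x
  proof -
    have "0 \<le> norm (\<phi> x) / d"
      using d by simp
    then have "real (j x) = of_int \<lfloor>norm (\<phi> x) / d\<rfloor>"
      by (simp add: j_def)
    then have "real (j x) \<le> norm (\<phi> x) / d" "norm (\<phi> x) / d < real (j x) + 1"
      by linarith+
    then show "real (j x) * d \<le> norm (\<phi> x)" "norm (\<phi> x) < (real (j x) + 1) * d"
      using d by (simp_all add: pos_le_divide_eq pos_divide_less_eq)
  qed
  have jN: "j x < N" for x
  proof -
    have "C < real N * d"
      using N d by (simp add: pos_divide_less_eq)
    then have "real (j x) * d < real N * d"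
      using j(1)[of x] C[of x] by linarith
    then show ?thesis
      using d by simp
  qed
  define A where "A i = {x \<in> B. j x = i}" for i
  have [measurable]: "\<phi> \<in> borel_measurable borel"
    by (rule borel_measurable_continuous_onI[OF cont])
  have Am: "A i \<in> sets borel" for i
  proof -
    have "{x \<in> space borel. j x = i} \<in> sets borel"
      unfolding j_def by measurable
    then show ?thesis
      using Bm(1) by (auto simp: A_def Collect_conj_eq)
  qed
  have A_fin: "outer_variation f (A i) < \<infinity>" for i
  proof -
    have "outer_variation f (A i) \<le> variation_on f B"
      by (rule outer_variation_le[OF Bm(2)]) (auto simp: A_def)
    then show ?thesis
      using fin[of "R + 1"] by (auto simp: B_def intro: le_less_trans)
  qed
  \<comment> \<open>Each of the \<open>N\<close> layers has height at most \<open>N * d\<close>, so this measure error costs at most \<open>d\<close> in total.\<close>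
  define \<eta> where "\<eta> = 1 / (real N * real N + 1)"
  have \<eta>: "0 < \<eta>"
    by (simp add: \<eta>_def add_nonneg_pos)
  have "\<exists>W. open W \<and> A i \<subseteq> W \<and> variation_on f W \<le> outer_variation f (A i) + ennreal \<eta>" for i
    by (rule outer_variation_approx[OF A_fin[of i] \<eta>]) blast
  then obtain W where W: "\<And>i. open (W i)" "\<And>i. A i \<subseteq> W i"
      "\<And>i. variation_on f (W i) \<le> outer_variation f (A i) + ennreal \<eta>"
    by metis
  define U where "U i = W i \<inter> {x. norm (\<phi> x) < (real i + 1) * d}" for i
  have U_op: "open (U i)" for i
    unfolding U_def using cont by (intro open_Int W open_Collect_less continuous_intros) auto
  have AU: "A i \<subseteq> U i" for i
    using W(2) j(2) by (auto simp: U_def A_def)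
  have VU: "variation_on f (U i) \<le> outer_variation f (A i) + ennreal \<eta>" for i
    using W(3)[of i] variation_on_mono[of "U i" "W i" f] by (auto simp: U_def)
  have "B \<subseteq> (\<Union>i\<in>{..<N}. U i)"
    using AU jN by (fastforce simp: A_def)
  then have "\<phi> \<in> C1c (\<Union>i\<in>{..<N}. U i)"
    using KB by (intro C1cI[OF K(1,2) _ K(3)]) auto
  then have "ennreal (div_pairing f \<phi>) \<le> (\<Sum>i<N. ennreal ((real i + 1) * d) * variation_on f (U i))"
    using U_op d by (intro div_pairing_le_sum f) (auto simp: U_def less_imp_le)
  also have "\<dots> \<le> (\<Sum>i<N. ennreal ((real i + 1) * d) * emeasure \<mu> (A i) + ennreal (real N * d * \<eta>))"
  proof (rule sum_mono)
    fix i assume "i \<in> {..<N}"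
    then have iN: "(real i + 1) * d \<le> real N * d"
      using d by (intro mult_right_mono) auto
    have "ennreal ((real i + 1) * d) * variation_on f (U i)
        \<le> ennreal ((real i + 1) * d) * (emeasure \<mu> (A i) + ennreal \<eta>)"
      using VU[of i] by (intro mult_left_mono) (auto simp: \<mu>(3)[OF Am])
    also have "\<dots> = ennreal ((real i + 1) * d) * emeasure \<mu> (A i) + ennreal ((real i + 1) * d * \<eta>)"
      using d \<eta> by (simp add: distrib_left ennreal_mult)
    also have "\<dots> \<le> ennreal ((real i + 1) * d) * emeasure \<mu> (A i) + ennreal (real N * d * \<eta>)"
      using mult_right_mono[OF iN, of \<eta>] \<eta> by (intro add_left_mono ennreal_leI) auto
    finally show "ennreal ((real i + 1) * d) * variation_on f (U i)
        \<le> ennreal ((real i + 1) * d) * emeasure \<mu> (A i) + ennreal (real N * d * \<eta>)" .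
  qed
  also have "\<dots> = (\<Sum>i<N. ennreal ((real i + 1) * d) * emeasure \<mu> (A i)) + of_nat N * ennreal (real N * d * \<eta>)"
    by (simp add: sum.distrib)
  also have "\<dots> \<le> ((\<integral>\<^sup>+x. ennreal (norm (\<phi> x)) \<partial>\<mu>) + ennreal (d * b)) + ennreal d"
  proof (rule add_mono)
    have "(\<Sum>i<N. ennreal ((real i + 1) * d) * emeasure \<mu> (A i))
        = (\<Sum>i<N. \<integral>\<^sup>+x. ennreal ((real i + 1) * d) * indicator (A i) x \<partial>\<mu>)"
      using Am \<mu>(1) by (simp add: nn_integral_cmult_indicator)
    also have "\<dots> = (\<integral>\<^sup>+x. (\<Sum>i<N. ennreal ((real i + 1) * d) * indicator (A i) x) \<partial>\<mu>)"
      using Am \<mu>(1) by (intro nn_integral_sum[symmetric]) auto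
    also have "\<dots> \<le> (\<integral>\<^sup>+x. ennreal (norm (\<phi> x)) + ennreal d * indicator B x \<partial>\<mu>)"
    proof (rule nn_integral_mono)
      fix x
      have "(\<Sum>i<N. ennreal ((real i + 1) * d) * indicator (A i) x)
          = (\<Sum>i<N. if i = j x then ennreal ((real i + 1) * d) * indicator B x else 0)"
        by (intro sum.cong) (auto simp: A_def indicator_def)
      also have "\<dots> = ennreal ((real (j x) + 1) * d) * indicator B x"
        using jN[of x] by simp
      also have "\<dots> \<le> (ennreal (norm (\<phi> x)) + ennreal d) * indicator B x"
        using j(1)[of x] d by (intro mult_right_mono) (auto simp: distrib_right ennreal_leI simp flip: ennreal_plus)
      also have "\<dots> \<le> ennreal (norm (\<phi> x)) + ennreal d * indicator B x"
        by (auto simp: indicator_def)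
      finally show "(\<Sum>i<N. ennreal ((real i + 1) * d) * indicator (A i) x)
          \<le> ennreal (norm (\<phi> x)) + ennreal d * indicator B x" .
    qed
    also have "\<dots> = (\<integral>\<^sup>+x. ennreal (norm (\<phi> x)) \<partial>\<mu>) + (\<integral>\<^sup>+x. ennreal d * indicator B x \<partial>\<mu>)"
      using Bm(1) \<mu>(1) by (intro nn_integral_add) (auto simp: measurable_cong_sets[OF \<mu>(1) refl])
    also have "(\<integral>\<^sup>+x. ennreal d * indicator B x \<partial>\<mu>) = ennreal (d * b)"
      using Bm(1) \<mu>(1) d b by (simp add: nn_integral_cmult_indicator ennreal_mult)
    finally show "(\<Sum>i<N. ennreal ((real i + 1) * d) * emeasure \<mu> (A i))
        \<le> (\<integral>\<^sup>+x. ennreal (norm (\<phi> x)) \<partial>\<mu>) + ennreal (d * b)" .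
    have "real N * (real N * d * \<eta>) = d * (real N * real N * \<eta>)"
      by simp
    also have "real N * real N * \<eta> \<le> 1"
      by (simp add: \<eta>_def divide_le_eq add_nonneg_pos)
    then have "d * (real N * real N * \<eta>) \<le> d * 1"
      using d by (intro mult_left_mono) auto
    finally show "of_nat N * ennreal (real N * d * \<eta>) \<le> ennreal d"
      using d \<eta> by (simp add: ennreal_of_nat_eq_real_of_nat flip: ennreal_mult)
  qed
  also have "\<dots> = (\<integral>\<^sup>+x. ennreal (norm (\<phi> x)) \<partial>\<mu>) + ennreal e"
    using d b db by (simp add: add.assoc flip: ennreal_plus)
  finally show "ennreal (div_pairing f \<phi>)
      \<le> (\<integral>\<^sup>+x. ennreal (norm (\<phi> x)) \<partial>variation_measure f) + ennreal e"
    unfolding \<mu>_def .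
qed

lemma div_pairing_le_weighted_variation:
  assumes "\<phi> \<in> C1c U" "\<And>x. ennreal (norm (\<phi> x)) \<le> v x"
  shows "ennreal (div_pairing f \<phi>) \<le> weighted_variation v f"
  unfolding weighted_variation_def div_pairing_def
  using assms C1c_subset_Lipc[OF assms(1)] by (intro SUP_upper) auto

lemma variation_on_le_weighted_variation:
  assumes m: "0 < m" "\<And>x. x \<in> U \<Longrightarrow> ennreal m \<le> v x"
  shows "variation_on f U \<le> weighted_variation v f / ennreal m"
proof -
  have "ennreal (div_pairing f \<phi>) \<le> weighted_variation v f / ennreal m"
    if \<phi>: "\<phi> \<in> C1c U" "\<forall>x. norm (\<phi> x) \<le> 1" for \<phi>
  proof -
    have "ennreal (norm (m *\<^sub>R \<phi> x)) \<le> v x" for x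
    proof (cases "x \<in> U")
      case True
      have "norm (m *\<^sub>R \<phi> x) \<le> m * 1"
        using m(1) \<phi>(2) by (simp add: mult_left_le)
      then have "ennreal (norm (m *\<^sub>R \<phi> x)) \<le> ennreal m"
        by (intro ennreal_leI) simp
      also have "\<dots> \<le> v x"
        by (rule m(2)[OF True])
      finally show ?thesis .
    next
      case False
      then show ?thesis
        using C1c_zero_outside[OF \<phi>(1) False] by simp
    qed
    then have "ennreal (div_pairing f (\<lambda>x. m *\<^sub>R \<phi> x)) \<le> weighted_variation v f"
      by (intro div_pairing_le_weighted_variation[OF C1c_cmult[OF \<phi>(1)]])
    then have "ennreal (div_pairing f \<phi>) * ennreal m \<le> weighted_variation v f"
      using m(1) by (simp add: div_pairing_cmult[OF \<phi>(1)] ennreal_mult' mult.commute)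
    then show ?thesis
      using m(1) by (simp add: ennreal_le_divide_iff)
  qed
  then show ?thesis
    unfolding variation_on_eq by (intro SUP_least) auto
qed

text \<open>A lower semicontinuous weight is approximated from below by \<open>h\<close> times a sum of indicators of the
  open sets \<open>{v > i * h}\<close>. The next two lemmas count the levels \<open>i * h\<close> below a value \<open>t\<close>.\<close>

lemma layer_count_le:
  fixes t :: ennreal
  assumes h: "0 < h"
  shows "(\<Sum>i\<in>{1..M::nat}. ennreal h * (if ennreal (real i * h) < t then 1 else 0)) \<le> t"
proof -
  define S where "S = {i \<in> {1..M}. ennreal (real i * h) < t}"
  have fin: "finite S"
    by (simp add: S_def)
  have "(\<Sum>i\<in>{1..M}. ennreal h * (if ennreal (real i * h) < t then 1 else 0)) = (\<Sum>i\<in>S. ennreal h)"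
    unfolding S_def by (intro sum.mono_neutral_cong_right) auto
  also have "\<dots> = ennreal (real (card S) * h)"
    using h by (simp add: ennreal_mult ennreal_of_nat_eq_real_of_nat)
  also have "\<dots> \<le> t"
  proof (cases "S = {}")
    case False
    have "S \<subseteq> {1..Max S}"
      using Max_ge[OF fin] by (auto simp: S_def)
    then have "card S \<le> Max S"
      using card_mono[of "{1..Max S}" S] by simp
    then have "ennreal (real (card S) * h) \<le> ennreal (real (Max S) * h)"
      using h by (intro ennreal_leI mult_right_mono) auto
    also have "\<dots> \<le> t"
      using Max_in[OF fin False] by (auto simp: S_def less_imp_le)
    finally show ?thesis .
  qed simp
  finally show ?thesis .
qed

lemma layer_count_ge:
  fixes t :: ennreal
  assumes z: "0 \<le> z" "ennreal z < t" and N: "z \<le> real (Suc N)"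
  shows "ennreal (z - 1 / real (Suc N))
    \<le> (\<Sum>i\<in>{1..Suc N * Suc N}. ennreal (1 / real (Suc N)) *
        (if ennreal (real i * (1 / real (Suc N))) < t then 1 else 0))"
proof -
  define h where "h = 1 / real (Suc N)"
  have h: "0 < h"
    by (simp add: h_def)
  define m where "m = nat \<lfloor>z / h\<rfloor>"
  have "0 \<le> z / h"
    using z h by simp
  then have "real m = of_int \<lfloor>z / h\<rfloor>"
    by (simp add: m_def)
  then have m: "real m \<le> z / h" "z / h < real m + 1"
    by linarith+
  have zh: "z / h = z * real (Suc N)"
    by (simp add: h_def)
  have "z * real (Suc N) \<le> real (Suc N) * real (Suc N)"
    using N by (intro mult_right_mono) auto
  then have "real m \<le> real (Suc N * Suc N)"
    using m(1) unfolding zh by (simp only: of_nat_mult)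
  then have mM: "m \<le> Suc N * Suc N"
    by (simp only: of_nat_le_iff)
  have "z - h \<le> real m * h"
    using m(2) h by (simp add: pos_divide_less_eq algebra_simps less_imp_le)
  then have "ennreal (z - h) \<le> ennreal (real m * h)"
    by (rule ennreal_leI)
  also have "\<dots> = (\<Sum>i\<in>{1..m}. ennreal h)"
    using h by (simp add: ennreal_mult ennreal_of_nat_eq_real_of_nat)
  also have "\<dots> \<le> (\<Sum>i\<in>{1..m}. ennreal h * (if ennreal (real i * h) < t then 1 else 0))"
  proof (rule sum_mono)
    fix i assume "i \<in> {1..m}"
    then have "real i * h \<le> z"
      using m(1) h by (simp add: pos_le_divide_eq) (meson mult_right_mono of_nat_mono order_trans less_imp_le)
    then have "ennreal (real i * h) < t"
      using z(2) by (meson ennreal_leI le_less_trans)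
    then show "ennreal h \<le> ennreal h * (if ennreal (real i * h) < t then 1 else 0)"
      by simp
  qed
  also have "\<dots> \<le> (\<Sum>i\<in>{1..Suc N * Suc N}. ennreal h * (if ennreal (real i * h) < t then 1 else 0))"
    using mM by (intro sum_mono2) auto
  finally show ?thesis
    unfolding h_def .
qed

text \<open>Nearly optimal fields on the open layers, scaled by \<open>h\<close>, add up to one field bounded by \<open>v\<close>, because
  only layers with \<open>i * h < v x\<close> contribute at \<open>x\<close>.\<close>

lemma sum_layers_le_weighted_variation:
  fixes f :: "'a::euclidean_space \<Rightarrow> real"
  assumes f: "locally_integrable f" and v: "lower_semicontinuous v" and h: "0 < h"
  shows "(\<Sum>i\<in>{1..M::nat}. ennreal h * variation_on f {x. ennreal (real i * h) < v x})
    \<le> weighted_variation v f"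
proof (rule ennreal_le_epsilon)
  fix e :: real assume e: "0 < e" and fin: "weighted_variation v f < top"
  define U where "U i = {x. ennreal (real i * h) < v x}" for i
  define \<eta> where "\<eta> = e / (real M * h + 1)"
  have pos: "0 < real M * h + 1"
    using h by (simp add: add_nonneg_pos)
  have \<eta>: "0 < \<eta>" "real M * h * \<eta> \<le> e"
  proof -
    show "0 < \<eta>"
      using e pos by (simp add: \<eta>_def)
    have "real M * h * e \<le> (real M * h + 1) * e"
      using e by (intro mult_right_mono) auto
    then show "real M * h * \<eta> \<le> e"
      using pos by (simp add: \<eta>_def divide_le_eq mult_ac)
  qed
  have "\<exists>\<phi>. \<phi> \<in> C1c (U i) \<and> (\<forall>x. norm (\<phi> x) \<le> 1) \<and> 0 \<le> div_pairing f \<phi> \<and>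
      variation_on f (U i) \<le> ennreal (div_pairing f \<phi>) + ennreal \<eta>" if i: "i \<in> {1..M}" for i
  proof -
    have "0 < real i * h"
      using i h by simp
    then have "variation_on f (U i) \<le> weighted_variation v f / ennreal (real i * h)"
      by (rule variation_on_le_weighted_variation) (auto simp: U_def less_imp_le)
    also have "\<dots> < \<infinity>"
      using fin \<open>0 < real i * h\<close> i h by (simp add: ennreal_divide_eq_top_iff less_top[symmetric])
    finally have "variation_on f (U i) < \<infinity>" .
    then obtain \<phi> where \<phi>: "\<phi> \<in> C1c (U i)" "\<forall>x. norm (\<phi> x) \<le> 1"
        "variation_on f (U i) < ennreal (div_pairing f \<phi>) + ennreal \<eta>"
      using SUP_approx_ennreal[OF \<eta>(1) _ variation_on_eq[of f "U i"]] C1c_zero[of "U i"] by force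
    \<comment> \<open>A negative pairing is cut off by \<^const>\<open>ennreal\<close>, and then the zero field is as good.\<close>
    show ?thesis
    proof (cases "0 \<le> div_pairing f \<phi>")
      case True
      then show ?thesis
        using \<phi> by (auto simp: less_imp_le)
    next
      case False
      then show ?thesis
        using \<phi>(3) by (intro exI[of _ "\<lambda>x. 0"]) (auto simp: C1c_zero ennreal_neg less_imp_le)
    qed
  qed
  then obtain \<phi> where \<phi>: "\<And>i. i \<in> {1..M} \<Longrightarrow> \<phi> i \<in> C1c (U i)" "\<And>i x. i \<in> {1..M} \<Longrightarrow> norm (\<phi> i x) \<le> 1"
      "\<And>i. i \<in> {1..M} \<Longrightarrow> 0 \<le> div_pairing f (\<phi> i)"
      "\<And>i. i \<in> {1..M} \<Longrightarrow> variation_on f (U i) \<le> ennreal (div_pairing f (\<phi> i)) + ennreal \<eta>"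
    by metis
  define \<Phi> where "\<Phi> x = (\<Sum>i\<in>{1..M}. h *\<^sub>R \<phi> i x)" for x
  have C1: "(\<lambda>x. h *\<^sub>R \<phi> i x) \<in> C1c UNIV" if "i \<in> {1..M}" for i
    using C1c_mono[OF C1c_cmult[OF \<phi>(1)[OF that]]] by simp
  have \<Phi>C: "\<Phi> \<in> C1c UNIV"
    unfolding \<Phi>_def by (intro C1c_sum C1) auto
  have "ennreal (norm (\<Phi> x)) \<le> v x" for x
  proof -
    have "norm (\<Phi> x) \<le> (\<Sum>i\<in>{1..M}. h * (if x \<in> U i then 1 else 0))"
      unfolding \<Phi>_def
    proof (rule sum_norm_le)
      fix i assume i: "i \<in> {1..M}"
      show "norm (h *\<^sub>R \<phi> i x) \<le> h * (if x \<in> U i then 1 else 0)"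
        using \<phi>(2)[OF i, of x] h C1c_zero_outside[OF \<phi>(1)[OF i], of x] by (auto simp: mult_left_le)
    qed
    then have "ennreal (norm (\<Phi> x)) \<le> ennreal (\<Sum>i\<in>{1..M}. h * (if x \<in> U i then 1 else 0))"
      by (rule ennreal_leI)
    also have "\<dots> = (\<Sum>i\<in>{1..M}. ennreal (h * (if x \<in> U i then 1 else 0)))"
      by (rule sum_ennreal[symmetric]) (use h in auto)
    also have "\<dots> = (\<Sum>i\<in>{1..M}. ennreal h * (if ennreal (real i * h) < v x then 1 else 0))"
      by (intro sum.cong) (auto simp: U_def)
    also have "\<dots> \<le> v x"
      by (rule layer_count_le[OF h])
    finally show ?thesis .
  qed
  then have \<Phi>_le: "ennreal (div_pairing f \<Phi>) \<le> weighted_variation v f"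
    by (rule div_pairing_le_weighted_variation[OF \<Phi>C])
  have "div_pairing f \<Phi> = (\<Sum>i\<in>{1..M}. div_pairing f (\<lambda>x. h *\<^sub>R \<phi> i x))"
    unfolding \<Phi>_def by (rule div_pairing_sum[OF f finite_atLeastAtMost C1])
  also have "\<dots> = (\<Sum>i\<in>{1..M}. h * div_pairing f (\<phi> i))"
    by (intro sum.cong refl div_pairing_cmult[OF \<phi>(1)])
  finally have sum: "div_pairing f \<Phi> = (\<Sum>i\<in>{1..M}. h * div_pairing f (\<phi> i))" .
  have "(\<Sum>i\<in>{1..M}. ennreal h * variation_on f (U i))
      \<le> (\<Sum>i\<in>{1..M}. ennreal (h * div_pairing f (\<phi> i)) + ennreal (h * \<eta>))"
  proof (rule sum_mono)
    fix i assume i: "i \<in> {1..M}"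
    have "ennreal h * variation_on f (U i) \<le> ennreal h * (ennreal (div_pairing f (\<phi> i)) + ennreal \<eta>)"
      by (rule mult_left_mono[OF \<phi>(4)[OF i]]) simp
    then show "ennreal h * variation_on f (U i) \<le> ennreal (h * div_pairing f (\<phi> i)) + ennreal (h * \<eta>)"
      using h \<eta>(1) \<phi>(3)[OF i] by (simp add: distrib_left ennreal_mult)
  qed
  also have "\<dots> = ennreal (div_pairing f \<Phi>) + ennreal (real M * h * \<eta>)"
  proof -
    have "(\<Sum>i\<in>{1..M}. ennreal (h * div_pairing f (\<phi> i))) = ennreal (div_pairing f \<Phi>)"
      unfolding sum using h \<phi>(3) by (intro sum_ennreal) auto
    moreover have "(\<Sum>i\<in>{1..M}. ennreal (h * \<eta>)) = ennreal (real M * h * \<eta>)"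
      using h \<eta>(1) by (simp add: ennreal_mult ennreal_of_nat_eq_real_of_nat mult.assoc)
    ultimately show ?thesis
      by (simp only: sum.distrib)
  qed
  also have "\<dots> \<le> weighted_variation v f + ennreal e"
    by (intro add_mono \<Phi>_le ennreal_leI \<eta>(2))
  finally show "(\<Sum>i\<in>{1..M}. ennreal h * variation_on f {x. ennreal (real i * h) < v x})
      \<le> weighted_variation v f + ennreal e"
    unfolding U_def .
qed

lemma integral_le_weighted_variation:
  fixes f :: "'a::euclidean_space \<Rightarrow> real"
  assumes f: "locally_integrable f" and v: "lower_semicontinuous v"
  shows "(\<integral>\<^sup>+x. v x \<partial>variation_measure f) \<le> weighted_variation v f"
proof -
  define \<mu> where "\<mu> = variation_measure f"
  note \<mu> = variation_measure_props[OF f, folded \<mu>_def]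
  define s where "s N x = (\<Sum>i\<in>{1..Suc N * Suc N}. ennreal (1 / real (Suc N)) *
      (if ennreal (real i * (1 / real (Suc N))) < v x then 1 else 0))" for N x
  have U: "open {x. ennreal t < v x}" for t
    using v by (simp add: lower_semicontinuous_def)
  have s_eq: "s N x = (\<Sum>i\<in>{1..Suc N * Suc N}. ennreal (1 / real (Suc N)) *
      indicator {x. ennreal (real i * (1 / real (Suc N))) < v x} x)" for N x
    unfolding s_def by (intro sum.cong) (auto simp: indicator_def)
  have Um: "{x. ennreal t < v x} \<in> sets \<mu>" for t
    using U \<mu>(1) by simp
  have sm: "s N \<in> borel_measurable \<mu>" for N
    unfolding s_eq using Um by (intro borel_measurable_sum borel_measurable_times) auto
  have int: "(\<integral>\<^sup>+x. s N x \<partial>\<mu>) \<le> weighted_variation v f" for N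
  proof -
    have "(\<integral>\<^sup>+x. s N x \<partial>\<mu>) = (\<Sum>i\<in>{1..Suc N * Suc N}. \<integral>\<^sup>+x. ennreal (1 / real (Suc N)) *
        indicator {x. ennreal (real i * (1 / real (Suc N))) < v x} x \<partial>\<mu>)"
      unfolding s_eq using Um by (intro nn_integral_sum borel_measurable_times) auto
    also have "\<dots> = (\<Sum>i\<in>{1..Suc N * Suc N}. ennreal (1 / real (Suc N)) *
        variation_on f {x. ennreal (real i * (1 / real (Suc N))) < v x})"
      using U by (intro sum.cong refl, subst nn_integral_cmult_indicator[OF Um])
        (simp add: \<mu>(3) outer_variation_open)
    also have "\<dots> \<le> weighted_variation v f"
      by (rule sum_layers_le_weighted_variation[OF f v]) simp
    finally show ?thesis .
  qed
  have liminf: "v x \<le> liminf (\<lambda>N. s N x)" for x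
  proof (rule dense_le)
    fix y assume "y < v x"
    then obtain y' where y': "y < y'" "y' < v x"
      using dense by blast
    obtain z where z: "y' = ennreal z" "0 \<le> z"
      using y'(2) by (cases y') auto
    obtain z0 where z0: "y = ennreal z0" "0 \<le> z0"
      using y' by (cases y) auto
    have "z0 < z"
      using y'(1) z z0 by (simp add: ennreal_less_iff)
    then have "eventually (\<lambda>N. 1 / real (Suc N) < z - z0) sequentially"
      using order_tendstoD(2)[OF LIMSEQ_inverse_real_of_nat, of "z - z0"] by (simp add: inverse_eq_divide)
    moreover have "eventually (\<lambda>N. z \<le> real (Suc N)) sequentially"
      using eventually_ge_at_top[of "nat \<lceil>z\<rceil>"] by eventually_elim linarith
    ultimately have "eventually (\<lambda>N. y \<le> s N x) sequentially"
    proof eventually_elim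
      case (elim N)
      have "ennreal z0 \<le> ennreal (z - 1 / real (Suc N))"
        using elim(1) by (intro ennreal_leI) simp
      also have "\<dots> \<le> s N x"
        unfolding s_def using y'(2) z elim(2) by (intro layer_count_ge) auto
      finally show ?case
        unfolding z0(1) .
    qed
    then show "y \<le> liminf (\<lambda>N. s N x)"
      by (rule Liminf_bounded)
  qed
  have "(\<integral>\<^sup>+x. v x \<partial>\<mu>) \<le> (\<integral>\<^sup>+x. liminf (\<lambda>N. s N x) \<partial>\<mu>)"
    by (intro nn_integral_mono liminf)
  also have "\<dots> \<le> liminf (\<lambda>N. \<integral>\<^sup>+x. s N x \<partial>\<mu>)"
    by (rule nn_integral_liminf[OF sm])
  also have "\<dots> \<le> weighted_variation v f"
    using int by (intro Liminf_le) (auto intro: always_eventually)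
  finally show ?thesis
    unfolding \<mu>_def .
qed


section \<open>Mollified weights\<close>

lemma mollifier_le:
  fixes k :: "'a::euclidean_space \<Rightarrow> real"
  assumes k: "mollifier r \<delta> k" and r: "0 < r"
  shows "k (x - y) \<le> (1 + \<delta>) / measure lborel (ball (0::'a) r) * indicator (ball x r) y"
proof (cases "y \<in> ball x r")
  case True
  have "k (x - y) * measure lborel (ball (0::'a) r) \<le> 1 + \<delta>"
    using k by (simp add: mollifier_def)
  then show ?thesis
    using True content_ball_pos[OF r, of "0::'a"] by (simp add: pos_le_divide_eq)
next
  case False
  then have "k (x - y) = 0"
    using k by (simp add: mollifier_def dist_norm)
  then show ?thesis
    using False by simp
qed

lemma borel_measurable_mollifier:
  "mollifier r \<delta> k \<Longrightarrow> k \<in> borel_measurable borel"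
  by (auto simp: mollifier_def C1c_iff intro!: borel_measurable_continuous_onI C1_map_continuous)

lemma emollify_le_ball_mean:
  fixes u :: "'a::euclidean_space \<Rightarrow> ennreal"
  assumes k: "mollifier r \<delta> k" and r: "0 < r" and \<delta>: "0 \<le> \<delta>"
    and u [measurable]: "u \<in> borel_measurable borel"
  shows "emollify k u x \<le> ennreal (1 + \<delta>) * ball_mean u x r"
proof -
  define V where "V = measure lborel (ball (0::'a) r)"
  have V: "0 < V"
    using r by (simp add: V_def content_ball_pos)
  have [measurable]: "ball x r \<in> sets borel"
    by simp
  have "emollify k u x \<le> (\<integral>\<^sup>+y. ennreal ((1 + \<delta>) / V) * (u y * indicator (ball x r) y) \<partial>lborel)"
    unfolding emollify_def
  proof (rule nn_integral_mono)
    fix y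
    show "ennreal (k (x - y)) * u y \<le> ennreal ((1 + \<delta>) / V) * (u y * indicator (ball x r) y)"
      using mollifier_le[OF k r, of x y] mult_right_mono[OF ennreal_leI, of "k (x - y)" _ "u y"]
      by (cases "y \<in> ball x r") (auto simp: V_def ennreal_neg)
  qed
  also have "\<dots> = ennreal ((1 + \<delta>) / V) * (\<integral>\<^sup>+y\<in>ball x r. u y \<partial>lborel)"
    by (rule nn_integral_cmult) measurable
  also have "\<dots> \<le> ennreal ((1 + \<delta>) / V) * (ball_mean u x r * ennreal V)"
    using ball_mean_le_iff[OF r, of u x "ball_mean u x r"] by (intro mult_left_mono) (auto simp: V_def)
  also have "\<dots> = (ennreal ((1 + \<delta>) / V) * ennreal V) * ball_mean u x r"
    by (simp add: mult_ac)
  also have "ennreal ((1 + \<delta>) / V) * ennreal V = ennreal (1 + \<delta>)"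
    using V \<delta> by (simp flip: ennreal_mult)
  finally show ?thesis .
qed

lemma emollify_le_A1:
  fixes v :: "'a::euclidean_space \<Rightarrow> ennreal"
  assumes k: "mollifier r \<delta> k" and r: "0 < r" and \<delta>: "0 \<le> \<delta>"
    and v: "v \<in> borel_measurable borel" and C: "A1_bound v C"
  shows "emollify k v x \<le> ennreal ((1 + \<delta>) * C) * v x"
proof -
  have "0 < C"
    using C by (simp add: A1_bound_def)
  have "emollify k v x \<le> ennreal (1 + \<delta>) * ball_mean v x r"
    by (rule emollify_le_ball_mean[OF k r \<delta> v])
  also have "\<dots> \<le> ennreal (1 + \<delta>) * (ennreal C * v x)"
    using r by (intro mult_left_mono A1_boundD[OF C]) auto
  finally show ?thesis
    using \<delta> \<open>0 < C\<close> by (simp add: ennreal_mult mult.assoc)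
qed

text \<open>The kernel has mass \<open>1\<close>, so the constant \<open>v x\<close> passes through unchanged and only the oscillation
  around it is multiplied by \<open>1 + \<delta>\<close>.\<close>

lemma emollify_le_edist:
  fixes v :: "'a::euclidean_space \<Rightarrow> ennreal"
  assumes k: "mollifier r \<delta> k" and r: "0 < r" and \<delta>: "0 \<le> \<delta>"
    and v [measurable]: "v \<in> borel_measurable borel"
  shows "emollify k v x \<le> v x + ennreal (1 + \<delta>) * ball_mean (\<lambda>y. edist (v y) (v x)) x r"
proof -
  note [measurable] = borel_measurable_mollifier[OF k]
  have "v y \<le> v x + edist (v y) (v x)" for y
  proof -
    have "v y \<le> v x + (v y - v x)"
      unfolding add_diff_self_ennreal by auto
    also have "\<dots> \<le> v x + edist (v y) (v x)"
      by (simp add: edist_def)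
    finally show ?thesis .
  qed
  then have "emollify k v x
      \<le> (\<integral>\<^sup>+y. ennreal (k (x - y)) * v x + ennreal (k (x - y)) * edist (v y) (v x) \<partial>lborel)"
    unfolding emollify_def by (intro nn_integral_mono) (simp flip: distrib_left add: mult_left_mono)
  also have "\<dots> = (\<integral>\<^sup>+y. ennreal (k (x - y)) * v x \<partial>lborel) + emollify k (\<lambda>y. edist (v y) (v x)) x"
    unfolding emollify_def edist_def by (rule nn_integral_add) measurable
  also have "(\<integral>\<^sup>+y. ennreal (k (x - y)) * v x \<partial>lborel) = v x"
    using mollifier_has_integral_shift(2)[OF k, of x] by (subst nn_integral_multc) auto
  also have "emollify k (\<lambda>y. edist (v y) (v x)) x
      \<le> ennreal (1 + \<delta>) * ball_mean (\<lambda>y. edist (v y) (v x)) x r"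
    unfolding edist_def by (rule emollify_le_ball_mean[OF k r \<delta>]) measurable
  finally show ?thesis
    by simp
qed

lemma borel_measurable_emollify:
  fixes v :: "'a::euclidean_space \<Rightarrow> ennreal"
  assumes k: "mollifier r \<delta> k" and v [measurable]: "v \<in> borel_measurable borel"
  shows "emollify k v \<in> borel_measurable borel"
proof -
  note [measurable] = borel_measurable_mollifier[OF k]
  have "(\<lambda>x. \<integral>\<^sup>+y. ennreal (k (x - y)) * v y \<partial>lborel) \<in> borel_measurable borel"
    by measurable
  then show ?thesis
    by (simp add: emollify_def[abs_def])
qed

text \<open>By the symmetry of the kernel, mollification is self-adjoint.\<close>

lemma emollify_adjoint:
  fixes u v :: "'a::euclidean_space \<Rightarrow> ennreal"
  assumes k: "mollifier r \<delta> k"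
    and u [measurable]: "u \<in> borel_measurable borel" and v [measurable]: "v \<in> borel_measurable borel"
  shows "(\<integral>\<^sup>+x. emollify k u x * v x \<partial>lborel) = (\<integral>\<^sup>+x. u x * emollify k v x \<partial>lborel)"
proof -
  note [measurable] = borel_measurable_mollifier[OF k]
  have even: "k (x - y) = k (y - x)" for x y
  proof -
    have "k (- (y - x)) = k (y - x)"
      using k unfolding mollifier_def by blast
    then show ?thesis
      by simp
  qed
  have "(\<integral>\<^sup>+x. emollify k u x * v x \<partial>lborel) = (\<integral>\<^sup>+x. (\<integral>\<^sup>+y. ennreal (k (x - y)) * u y * v x \<partial>lborel) \<partial>lborel)"
    unfolding emollify_def by (simp add: nn_integral_multc)
  also have "\<dots> = (\<integral>\<^sup>+y. (\<integral>\<^sup>+x. ennreal (k (x - y)) * u y * v x \<partial>lborel) \<partial>lborel)"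
    by (rule lborel_pair.Fubini') measurable
  also have "\<dots> = (\<integral>\<^sup>+y. (\<integral>\<^sup>+x. u y * (ennreal (k (y - x)) * v x) \<partial>lborel) \<partial>lborel)"
    by (intro nn_integral_cong) (subst even, simp add: mult_ac)
  also have "\<dots> = (\<integral>\<^sup>+y. u y * emollify k v y \<partial>lborel)"
    unfolding emollify_def by (simp add: nn_integral_cmult)
  finally show ?thesis .
qed


section \<open>Mollified indicators\<close>

lemma mollifier_shift_integrable:
  fixes f :: "'a::euclidean_space \<Rightarrow> real"
  assumes k: "mollifier r \<delta> k" and f: "f \<in> borel_measurable borel" "\<And>x. \<bar>f x\<bar> \<le> 1"
  shows "integrable lborel (\<lambda>y. k (x - y) * f y)"
proof -
  have kC: "k \<in> C1c UNIV"
    using k by (simp add: mollifier_def)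
  obtain L where L: "compact L" "\<And>x. x \<notin> L \<Longrightarrow> k x = 0"
    using C1cE[OF kC] by metis
  have "continuous_on UNIV k"
    using kC by (simp add: C1c_iff C1_map_continuous)
  from integrable_shift[OF this L f(1), of 1 x] show ?thesis
    using f(2) by simp
qed

context
  fixes k :: "'a::euclidean_space \<Rightarrow> real" and r \<delta> :: real and E :: "'a set"
  assumes k: "mollifier r \<delta> k" and E: "E \<in> sets borel"
begin

lemma C1_map_mollify_indicator: "C1_map (mollify k (indicat_real E))"
  using k E by (intro C1_map_mollify[of _ _ 1]) (auto simp: mollifier_def)

lemma mollify_indicator_bounds:
  "0 \<le> mollify k (indicat_real E) x" "mollify k (indicat_real E) x \<le> 1"
proof -
  have k0: "0 \<le> k z" for z
    using k by (simp add: mollifier_def)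
  show "0 \<le> mollify k (indicat_real E) x"
    unfolding mollify_def using k0 by (intro integral_nonneg_AE) auto
  have "mollify k (indicat_real E) x \<le> (\<integral>y. k (x - y) * 1 \<partial>lborel)"
    unfolding mollify_def real_scaleR_def using E k0
    by (intro integral_mono mollifier_shift_integrable[OF k]) (auto simp: indicator_def)
  then show "mollify k (indicat_real E) x \<le> 1"
    using mollifier_has_integral_shift(1)[OF k] by simp
qed

lemma ennreal_mollify_indicator:
  "ennreal (mollify k (indicat_real E) x) = emollify k (indicator E) x"
proof -
  have k0: "0 \<le> k z" for z
    using k by (simp add: mollifier_def)
  have "(\<integral>\<^sup>+y. ennreal (k (x - y) * indicat_real E y) \<partial>lborel) = ennreal (\<integral>y. k (x - y) * indicat_real E y \<partial>lborel)"
    using E k0 by (intro nn_integral_eq_integral mollifier_shift_integrable[OF k]) (auto simp: indicator_def)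
  moreover have "ennreal (k (x - y) * indicat_real E y) = ennreal (k (x - y)) * indicator E y" for y
    by (auto simp: indicator_def)
  ultimately show ?thesis
    by (simp add: mollify_def emollify_def)
qed

text \<open>The mollification of a field bounded by \<open>v\<close> is bounded by \<open>(1 + \<delta>) * C * v\<close>, hence becomes admissible
  for the weighted variation after division by \<open>(1 + \<delta>) * C\<close>.\<close>

lemma gradient_integral_le_A1:
  assumes r: "0 < r" and \<delta>: "0 \<le> \<delta>" and v: "v \<in> borel_measurable borel" "A1_bound v C"
  shows "(\<integral>\<^sup>+x. ennreal (norm (grad (mollify k (indicat_real E)) x)) * v x \<partial>lborel)
    \<le> ennreal ((1 + \<delta>) * C) * weighted_variation v (indicat_real E)"
proof (rule dense_le)
  fix a assume "a < (\<integral>\<^sup>+x. ennreal (norm (grad (mollify k (indicat_real E)) x)) * v x \<partial>lborel)"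
  then obtain \<phi> where \<phi>: "\<phi> \<in> C1c UNIV" "a < ennreal (div_pairing (indicat_real E) \<phi>)"
      "\<And>x. ennreal (norm (\<phi> x)) \<le> emollify k v x"
    using gradient_integral_dual[OF k E v(1)] by metis
  define c where "c = (1 + \<delta>) * C"
  have c: "0 < c"
    using \<delta> v(2) by (auto simp: c_def A1_bound_def add_pos_nonneg)
  have le: "ennreal (norm (\<phi> x)) \<le> ennreal c * v x" for x
    using order_trans[OF \<phi>(3) emollify_le_A1[OF k r \<delta> v]] by (simp add: c_def)
  have "ennreal (norm ((1 / c) *\<^sub>R \<phi> x)) \<le> v x" for x
  proof -
    have "ennreal (norm ((1 / c) *\<^sub>R \<phi> x)) = ennreal (norm (\<phi> x)) / ennreal c"
      using c by (simp add: divide_ennreal)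
    also have "\<dots> \<le> v x"
      using le[of x] c by (simp add: ennreal_divide_le_iff mult.commute)
    finally show ?thesis .
  qed
  then have "ennreal (div_pairing (indicat_real E) (\<lambda>x. (1 / c) *\<^sub>R \<phi> x)) \<le> weighted_variation v (indicat_real E)"
    by (intro div_pairing_le_weighted_variation[OF C1c_cmult[OF \<phi>(1)]])
  then have "ennreal (div_pairing (indicat_real E) \<phi> / c) \<le> weighted_variation v (indicat_real E)"
    by (simp add: div_pairing_cmult[OF \<phi>(1)])
  then have "ennreal c * ennreal (div_pairing (indicat_real E) \<phi> / c) \<le> ennreal c * weighted_variation v (indicat_real E)"
    by (rule mult_left_mono) simp
  then have "ennreal (div_pairing (indicat_real E) \<phi>) \<le> ennreal c * weighted_variation v (indicat_real E)"
    using c by (simp flip: ennreal_mult')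
  then show "a \<le> ennreal ((1 + \<delta>) * C) * weighted_variation v (indicat_real E)"
    using \<phi>(2) by (simp add: c_def)
qed

text \<open>Integrating the mollified field against the total variation measure, instead of bounding it by a
  multiple of \<open>v\<close>, loses no A1 constant.\<close>

lemma gradient_integral_le_variation_measure:
  assumes v: "v \<in> borel_measurable borel"
    and fin: "\<And>R. variation_on (indicat_real E) (ball 0 R) < \<infinity>"
  shows "(\<integral>\<^sup>+x. ennreal (norm (grad (mollify k (indicat_real E)) x)) * v x \<partial>lborel)
    \<le> (\<integral>\<^sup>+x. emollify k v x \<partial>variation_measure (indicat_real E))"
proof (rule dense_le)
  fix a assume "a < (\<integral>\<^sup>+x. ennreal (norm (grad (mollify k (indicat_real E)) x)) * v x \<partial>lborel)"
  then obtain \<phi> where \<phi>: "\<phi> \<in> C1c UNIV" "a < ennreal (div_pairing (indicat_real E) \<phi>)"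
      "\<And>x. ennreal (norm (\<phi> x)) \<le> emollify k v x"
    using gradient_integral_dual[OF k E v] by metis
  have "locally_integrable (indicat_real E)"
    by (rule locally_integrable_indicator) (use E in simp)
  then have "ennreal (div_pairing (indicat_real E) \<phi>)
      \<le> (\<integral>\<^sup>+x. ennreal (norm (\<phi> x)) \<partial>variation_measure (indicat_real E))"
    by (rule div_pairing_le_integral[OF _ fin \<phi>(1)])
  also have "\<dots> \<le> (\<integral>\<^sup>+x. emollify k v x \<partial>variation_measure (indicat_real E))"
    by (intro nn_integral_mono \<phi>(3))
  finally show "a \<le> (\<integral>\<^sup>+x. emollify k v x \<partial>variation_measure (indicat_real E))"
    using \<phi>(2) by simp
qed

end

text \<open>Let \<open>T\<close> be an open superset of \<open>F = E \<inter> ball 0 R\<close> of nearly the same measure. Where the \<open>r\<close>-ball lies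
  in \<open>T\<close>, the mollified indicator of \<open>E\<close> falls short of \<open>1\<close> by at most that of \<open>T - F\<close>, whose integral is
  the measure of \<open>T - F\<close>. For small \<open>r\<close> this covers a given compact subset of \<open>F\<close>.\<close>

lemma mollify_indicator_tendsto_L1:
  fixes E :: "'a::euclidean_space set" and k :: "nat \<Rightarrow> 'a \<Rightarrow> real"
  assumes k: "\<And>n. mollifier (r n) \<delta> (k n)" and r: "\<And>n. 0 < r n" "r \<longlonglongrightarrow> 0"
    and E: "E \<in> sets borel"
  shows "(\<lambda>n. \<integral>x. norm (indicat_real (E \<inter> ball 0 R) x * (1 - mollify (k n) (indicat_real E) x)) \<partial>lborel) \<longlonglongrightarrow> 0"
    and "\<And>n. integrable lborel (\<lambda>x. indicat_real (E \<inter> ball 0 R) x * (1 - mollify (k n) (indicat_real E) x))"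
proof -
  define F where "F = E \<inter> ball 0 R"
  define u where "u n x = indicat_real F x * (1 - mollify (k n) (indicat_real E) x)" for n x
  have F [measurable]: "F \<in> sets borel"
    using E by (auto simp: F_def)
  have b: "0 \<le> 1 - mollify (k n) (indicat_real E) x" "1 - mollify (k n) (indicat_real E) x \<le> 1" for n x
    using mollify_indicator_bounds[OF k E, of n x] by auto
  have mm [measurable]: "mollify (k n) (indicat_real E) \<in> borel_measurable borel" for n
    by (intro borel_measurable_continuous_onI C1_map_continuous C1_map_mollify_indicator[OF k E])
  have um: "u n \<in> borel_measurable borel" for n
    unfolding u_def by measurable
  have u01: "0 \<le> u n x" "u n x \<le> 1" for n x
    using b[where n = n and x = x] by (auto simp: u_def indicator_def)
  have int: "integrable lborel (u n)" for n
  proof (rule integrable_bounded_compact[OF um compact_cball[of 0 R]])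
    show "norm (u n x) \<le> 1" for x
      using u01 by simp
    show "u n x = 0" if "x \<notin> cball 0 R" for x
      using that by (auto simp: u_def F_def)
  qed
  have "(\<lambda>n. \<integral>x. norm (u n x) \<partial>lborel) \<longlonglongrightarrow> 0"
  proof (rule LIMSEQ_I)
    fix e :: real assume e: "0 < e"
    have Fl: "F \<in> sets lebesgue"
      using F by simp
    obtain T where T: "open T" "F \<subseteq> T" "emeasure lebesgue (T - F) < ennreal (e / 2)"
      using sets_lebesgue_outer_open[OF Fl half_gt_zero[OF e]] by metis
    obtain S where S: "closed S" "S \<subseteq> F" "emeasure lebesgue (F - S) < ennreal (e / 2)"
      using sets_lebesgue_inner_closed[OF Fl half_gt_zero[OF e]] by metis
    have Sm [measurable]: "S \<in> sets borel" and Tm [measurable]: "T \<in> sets borel"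
      using S T by auto
    have T': "emeasure lborel (T - F) < ennreal (e / 2)" and S': "emeasure lborel (F - S) < ennreal (e / 2)"
      using T(3) S(3) by (simp_all add: emeasure_completion)
    have "bounded S"
      using S(2) bounded_ball[of 0 R] by (rule_tac bounded_subset[of "ball 0 R"]) (auto simp: F_def)
    then have "compact S"
      using S(1) by (simp add: compact_eq_bounded_closed)
    obtain \<rho> where \<rho>: "0 < \<rho>" "\<And>x. x \<in> S \<Longrightarrow> ball x \<rho> \<subseteq> T"
    proof (cases "S = {}")
      case False
      obtain \<rho> where "0 < \<rho>" "{x. infdist x S \<le> \<rho>} \<subseteq> T"
        using compact_in_open_separated[OF False \<open>compact S\<close> T(1)] S(2) T(2) by blast
      moreover have "ball x \<rho> \<subseteq> {x. infdist x S \<le> \<rho>}" if "x \<in> S" for x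
      proof
        fix y assume "y \<in> ball x \<rho>"
        then have "infdist y S \<le> \<rho>"
          using infdist_le2[OF that, of y \<rho>] by (simp add: dist_commute less_imp_le)
        then show "y \<in> {x. infdist x S \<le> \<rho>}"
          by simp
      qed
      ultimately show ?thesis
        using that by blast
    qed (use that[of 1] in auto)
    have "eventually (\<lambda>n. r n < \<rho>) sequentially"
      using order_tendstoD(2)[OF r(2) \<rho>(1)] .
    then obtain n0 where n0: "\<And>n. n0 \<le> n \<Longrightarrow> r n < \<rho>"
      by (auto simp: eventually_sequentially)
    have "norm ((\<integral>x. norm (u n x) \<partial>lborel) - 0) < e" if n: "n0 \<le> n" for n
    proof -
      have TF: "T - F \<in> sets borel"
        by measurable
      have le: "ennreal (u n x) \<le> emollify (k n) (indicator (T - F)) x + indicator (F - S) x" for x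
      proof (cases "x \<in> S")
        case True
        have k0: "0 \<le> k n z" and kr: "r n \<le> norm z \<Longrightarrow> k n z = 0" for z
          using k[of n] by (auto simp: mollifier_def)
        have ball: "y \<in> T" if "dist x y < r n" for y
          using \<rho>(2)[OF True] n0[OF n] that by (auto simp: subset_iff)
        have int_k: "integrable lborel (\<lambda>y. k n (x - y) * 1)"
          by (rule mollifier_shift_integrable[OF k]) auto
        have int_kS: "integrable lborel (\<lambda>y. k n (x - y) * indicat_real S y)" if "S \<in> sets borel" for S
          by (rule mollifier_shift_integrable[OF k]) (use that in \<open>auto simp: indicator_def\<close>)
        have "u n x \<le> 1 - mollify (k n) (indicat_real E) x"
          using b[where n = n and x = x] by (auto simp: u_def indicator_def)
        also have "\<dots> = (\<integral>y. k n (x - y) * 1 - k n (x - y) * indicat_real E y \<partial>lborel)"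
          using mollifier_has_integral_shift(1)[OF k, of n x]
          by (subst Bochner_Integration.integral_diff[OF int_k int_kS[OF E]]) (simp add: mollify_def)
        also have "\<dots> \<le> (\<integral>y. k n (x - y) * indicat_real (T - F) y \<partial>lborel)"
        proof (rule integral_mono)
          fix y
          show "k n (x - y) * 1 - k n (x - y) * indicat_real E y \<le> k n (x - y) * indicat_real (T - F) y"
            using ball[of y] k0[of "x - y"] kr[of "x - y"]
            by (cases "dist x y < r n") (auto simp: indicator_def F_def dist_norm)
        qed (intro Bochner_Integration.integrable_diff int_k int_kS E TF)+
        finally have "u n x \<le> mollify (k n) (indicat_real (T - F)) x"
          by (simp add: mollify_def)
        then have "ennreal (u n x) \<le> ennreal (mollify (k n) (indicat_real (T - F)) x)"
          by (rule ennreal_leI)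
        also have "\<dots> = emollify (k n) (indicator (T - F)) x"
          by (rule ennreal_mollify_indicator[OF k TF])
        finally show ?thesis
          by (simp add: add_increasing2)
      next
        case False
        show ?thesis
        proof (cases "x \<in> F")
          case True
          have "ennreal (u n x) \<le> 1"
            using ennreal_leI[OF u01(2)[of n x]] by simp
          then show ?thesis
            using True False by (simp add: add_increasing)
        qed (simp add: u_def)
      qed
      have "ennreal (\<integral>x. norm (u n x) \<partial>lborel) = (\<integral>\<^sup>+x. ennreal (u n x) \<partial>lborel)"
        using nn_integral_eq_integral[OF int[of n]] u01 by simp
      also have "\<dots> \<le> (\<integral>\<^sup>+x. emollify (k n) (indicator (T - F)) x + indicator (F - S) x \<partial>lborel)"
        by (intro nn_integral_mono le)
      also have "\<dots> = (\<integral>\<^sup>+x. emollify (k n) (indicator (T - F)) x * 1 \<partial>lborel) + emeasure lborel (F - S)"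
        using borel_measurable_emollify[OF k, of "indicator (T - F)" n] TF
        by (subst nn_integral_add) auto
      also have "(\<integral>\<^sup>+x. emollify (k n) (indicator (T - F)) x * 1 \<partial>lborel)
          = (\<integral>\<^sup>+x. indicator (T - F) x * emollify (k n) (\<lambda>_. 1) x \<partial>lborel)"
        using TF by (intro emollify_adjoint[OF k]) auto
      also have "\<dots> = emeasure lborel (T - F)"
        using mollifier_has_integral_shift(2)[OF k[of n]] TF by (simp add: emollify_def)
      also have "\<dots> + emeasure lborel (F - S) < ennreal (e / 2) + ennreal (e / 2)"
        by (rule add_strict_mono[OF T' S'])
      also have "\<dots> = ennreal e"
        using e by (simp flip: ennreal_plus)
      finally have "(\<integral>x. norm (u n x) \<partial>lborel) < e"
        using e by (simp add: ennreal_less_iff)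
      then show ?thesis
        by simp
    qed
    then show "\<exists>no. \<forall>n\<ge>no. norm ((\<integral>x. norm (u n x) \<partial>lborel) - 0) < e"
      by blast
  qed
  then show "(\<lambda>n. \<integral>x. norm (indicat_real (E \<inter> ball 0 R) x * (1 - mollify (k n) (indicat_real E) x)) \<partial>lborel) \<longlonglongrightarrow> 0"
    unfolding u_def F_def .
  show "\<And>n. integrable lborel (\<lambda>x. indicat_real (E \<inter> ball 0 R) x * (1 - mollify (k n) (indicat_real E) x))"
    using int unfolding u_def F_def .
qed

text \<open>Along a subsequence the mollified indicators converge to \<open>1\<close> almost everywhere on a bounded part of
  \<open>E\<close>, so Fatou's lemma transfers a uniform bound on their weighted norms.\<close>

lemma weighted_measure_le_of_mollified:
  fixes E :: "'a::euclidean_space set" and k :: "nat \<Rightarrow> 'a \<Rightarrow> real"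
  assumes k: "\<And>n. mollifier (r n) \<delta> (k n)" and r: "\<And>n. 0 < r n" "r \<longlonglongrightarrow> 0"
    and E: "E \<in> sets borel" and w [measurable]: "w \<in> borel_measurable borel" and s: "0 < s"
    and X: "\<And>n. weighted_Lp_norm s w (mollify (k n) (indicat_real E)) \<le> X"
  shows "epowr (\<integral>\<^sup>+x\<in>E. w x \<partial>lborel) (1 / s) \<le> X"
proof -
  have mm [measurable]: "mollify (k n) (indicat_real E) \<in> borel_measurable borel" for n
    by (intro borel_measurable_continuous_onI C1_map_continuous C1_map_mollify_indicator[OF k E])
  have bound: "(\<integral>\<^sup>+x. ennreal (norm (mollify (k n) (indicat_real E) x) powr s) * w x \<partial>lborel) \<le> epowr X s" for n
    using X[of n] s by (simp add: weighted_Lp_norm_def epowr_le_iff nn_integral_completion)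
  have "(\<integral>\<^sup>+x\<in>E \<inter> ball 0 (real m). w x \<partial>lborel) \<le> epowr X s" for m :: nat
  proof -
    define F where "F = E \<inter> ball 0 (real m)"
    have F: "F \<in> sets borel"
      using E by (auto simp: F_def)
    have "\<exists>q. strict_mono q \<and>
        (AE x in lborel. (\<lambda>n. indicat_real F x * (1 - mollify (k (q n)) (indicat_real E) x)) \<longlonglongrightarrow> 0)"
      unfolding F_def by (rule tendsto_L1_AE_subseq[OF mollify_indicator_tendsto_L1(2,1)[OF k r E]])
    then obtain q where q: "strict_mono q"
        "AE x in lborel. (\<lambda>n. indicat_real F x * (1 - mollify (k (q n)) (indicat_real E) x)) \<longlonglongrightarrow> 0"
      by blast
    define g where "g n = mollify (k (q n)) (indicat_real E)" for n
    have "AE x in lborel. w x * indicator F x \<le> liminf (\<lambda>n. ennreal (norm (g n x) powr s) * w x)"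
      using q(2)
    proof eventually_elim
      fix x assume lim: "(\<lambda>n. indicat_real F x * (1 - mollify (k (q n)) (indicat_real E) x)) \<longlonglongrightarrow> 0"
      show "w x * indicator F x \<le> liminf (\<lambda>n. ennreal (norm (g n x) powr s) * w x)"
      proof (cases "x \<in> F")
        case True
        then have "(\<lambda>n. 1 - g n x) \<longlonglongrightarrow> 0"
          using lim by (simp add: g_def)
        from tendsto_diff[OF tendsto_const[of 1] this] have "(\<lambda>n. g n x) \<longlonglongrightarrow> 1"
          by simp
        then have "(\<lambda>n. norm (g n x) powr s) \<longlonglongrightarrow> norm (1::real) powr s"
          by (intro tendsto_intros) auto
        then have "(\<lambda>n. ennreal (norm (g n x) powr s)) \<longlonglongrightarrow> 1"
          using tendsto_ennrealI by fastforce
        then have "(\<lambda>n. ennreal (norm (g n x) powr s) * w x) \<longlonglongrightarrow> 1 * w x"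
          by (intro tendsto_mult_ennreal tendsto_const) auto
        then have "liminf (\<lambda>n. ennreal (norm (g n x) powr s) * w x) = w x"
          by (simp add: lim_imp_Liminf)
        then show ?thesis
          by (simp add: indicator_def)
      qed simp
    qed
    then have "(\<integral>\<^sup>+x\<in>F. w x \<partial>lborel) \<le> (\<integral>\<^sup>+x. liminf (\<lambda>n. ennreal (norm (g n x) powr s) * w x) \<partial>lborel)"
      by (rule nn_integral_mono_AE)
    also have "\<dots> \<le> liminf (\<lambda>n. \<integral>\<^sup>+x. ennreal (norm (g n x) powr s) * w x \<partial>lborel)"
      unfolding g_def by (intro nn_integral_liminf) measurable
    also have "\<dots> \<le> epowr X s"
      using bound unfolding g_def by (intro Liminf_le) (auto intro: always_eventually)
    finally show ?thesis
      unfolding F_def .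
  qed
  moreover have "(\<integral>\<^sup>+x\<in>E. w x \<partial>lborel) = (SUP m. \<integral>\<^sup>+x\<in>E \<inter> ball 0 (real m). w x \<partial>lborel)"
  proof -
    have SUP: "(SUP m. w x * indicator (E \<inter> ball 0 (real m)) x) = w x * indicator E x" for x
    proof (rule antisym)
      obtain m where "norm x < real m"
        using reals_Archimedean2 by blast
      then show "w x * indicator E x \<le> (SUP m. w x * indicator (E \<inter> ball 0 (real m)) x)"
        by (intro SUP_upper2[of m]) (auto simp: indicator_def)
    qed (auto intro!: SUP_least simp: indicator_def)
    have [measurable]: "E \<inter> ball 0 (real m) \<in> sets borel" for m
      using E by auto
    show ?thesis
      unfolding SUP[symmetric]
    proof (rule nn_integral_monotone_convergence_SUP)
      show "incseq (\<lambda>m x. w x * indicator (E \<inter> ball 0 (real m)) x)"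
        by (auto simp: incseq_def le_fun_def indicator_def)
    qed measurable
  qed
  ultimately have "(\<integral>\<^sup>+x\<in>E. w x \<partial>lborel) \<le> epowr X s"
    by (auto intro: SUP_least)
  then show ?thesis
    using s by (simp add: epowr_le_iff)
qed


section \<open>The isoperimetric inequality\<close>

text \<open>Two functions that agree almost everywhere are both Lebesgue measurable or both not, and in the
  latter case both integrals are \<open>0\<close>. Applied to the divergence of a Lipschitz field, this spares a
  proof of its measurability.\<close>

lemma lebesgue_integral_cong_AE:
  fixes f g :: "'a::euclidean_space \<Rightarrow> real"
  assumes "AE x in lebesgue. f x = g x"
  shows "(\<integral>x. f x \<partial>lebesgue) = (\<integral>x. g x \<partial>lebesgue)"
proof (cases "f \<in> borel_measurable lebesgue")
  case True
  then show ?thesis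
    using borel_measurable_AE[OF True assms] by (intro integral_cong_AE assms)
next
  case False
  have "AE x in lebesgue. g x = f x"
    using assms by eventually_elim simp
  then have "g \<notin> borel_measurable lebesgue"
    using False borel_measurable_AE by blast
  then have "\<not> integrable lebesgue f" "\<not> integrable lebesgue g"
    using False borel_measurable_integrable by blast+
  then show ?thesis
    by (simp add: not_integrable_integral_eq)
qed

lemma indicator_div_cong_AE:
  fixes E E' :: "'a::euclidean_space set"
  assumes "AE x in lebesgue. x \<in> E \<longleftrightarrow> x \<in> E'"
  shows "(\<integral>x. indicat_real E x * divergence \<phi> x \<partial>lebesgue) = (\<integral>x. indicat_real E' x * divergence \<phi> x \<partial>lebesgue)"
proof (rule lebesgue_integral_cong_AE)
  show "AE x in lebesgue. indicat_real E x * divergence \<phi> x = indicat_real E' x * divergence \<phi> x"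
    using assms by eventually_elim (simp add: indicator_def)
qed

lemma variation_measure_cong_AE:
  fixes E E' :: "'a::euclidean_space set"
  assumes "AE x in lebesgue. x \<in> E \<longleftrightarrow> x \<in> E'"
  shows "variation_measure (indicat_real E) = variation_measure (indicat_real E')"
  unfolding variation_measure_def variation_on_def indicator_div_cong_AE[OF assms] ..

lemma weighted_variation_cong_AE:
  fixes E E' :: "'a::euclidean_space set"
  assumes "AE x in lebesgue. x \<in> E \<longleftrightarrow> x \<in> E'"
  shows "weighted_variation v (indicat_real E) = weighted_variation v (indicat_real E')"
  unfolding weighted_variation_def indicator_div_cong_AE[OF assms] ..

lemma lebesgue_set_AE_eq_borel:
  fixes E :: "'a::euclidean_space set"
  assumes "E \<in> sets lebesgue"
  obtains E' where "E' \<in> sets borel" "AE x in lebesgue. x \<in> E \<longleftrightarrow> x \<in> E'"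
proof -
  obtain S N N' where S: "E = S \<union> N" "N \<subseteq> N'" "N' \<in> null_sets lborel" "S \<in> sets lborel"
    using sets_completionE[OF assms] by metis
  have "AE x in lebesgue. x \<in> E \<longleftrightarrow> x \<in> S"
    by (rule AE_I'[OF null_sets_completionI[OF S(3)]]) (use S in auto)
  then show ?thesis
    using that[of S] S(4) by simp
qed

lemma weighted_Lp_norm_1:
  "weighted_Lp_norm 1 u f = (\<integral>\<^sup>+x. ennreal (norm (f x)) * u x \<partial>lborel)"
  by (simp add: weighted_Lp_norm_def nn_integral_completion)

lemma ennreal_le_of_factors:
  fixes a Y :: ennreal
  assumes "\<And>\<delta>. 0 < \<delta> \<Longrightarrow> a \<le> ennreal (1 + \<delta>) * Y"
  shows "a \<le> Y"
proof (cases Y)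
  case (real y)
  show ?thesis
  proof (rule ennreal_le_epsilon)
    fix e :: real assume e: "0 < e"
    have "a \<le> ennreal (1 + e / (y + 1)) * Y"
      using e real by (intro assms) (simp add: add_nonneg_pos)
    also have "\<dots> = ennreal ((1 + e / (y + 1)) * y)"
      using e real by (simp add: ennreal_mult)
    also have "\<dots> \<le> ennreal (y + e)"
    proof (rule ennreal_leI)
      have "e * y / (y + 1) \<le> e"
        using e real by (simp add: pos_divide_le_eq add_nonneg_pos)
      then show "(1 + e / (y + 1)) * y \<le> y + e"
        by (simp add: distrib_right)
    qed
    also have "\<dots> = Y + ennreal e"
      using e real by simp
    finally show "a \<le> Y + ennreal e" .
  qed
qed simp

text \<open>Sobolev's inequality for the mollified indicators of \<open>E\<close>: it applies because mollification keeps
  the weighted integrals of \<open>\<chi>\<^sub>E\<close> and of its gradient finite, again by the A1 bound.\<close>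

lemma sobolev_mollified_indicator:
  fixes w :: "'a::euclidean_space \<Rightarrow> ennreal" and s C1 :: real
  assumes w: "A1_star_weight w" and c: "A1_bound w c" and p: "0 < p"
    and E: "E \<in> sets borel" and wE: "(\<integral>\<^sup>+x\<in>E. w x \<partial>lborel) < \<infinity>"
    and PE: "weighted_variation w (indicat_real E) < \<infinity>"
    and sobolev: "\<forall>g \<in> weighted_W11 w. \<forall>G. has_weak_gradient g G \<longrightarrow>
        weighted_Lp_norm s w g
          \<le> ennreal C1 * weighted_Lp_norm 1 (\<lambda>x. epowr (maximal_fun w x) p) G"
    and k: "mollifier r \<delta> k" and r: "0 < r" and \<delta>: "0 \<le> \<delta>"
  shows "weighted_Lp_norm s w (mollify k (indicat_real E)) \<le> ennreal C1 * (ennreal (c powr p) *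
    (\<integral>\<^sup>+x. ennreal (norm (grad (mollify k (indicat_real E)) x)) * epowr (w x) p \<partial>lborel))"
proof -
  define g where "g = mollify k (indicat_real E)"
  have wb: "w \<in> borel_measurable borel"
    using w by (auto simp: A1_star_weight_def intro: lower_semicontinuous_borel)
  have c0: "0 < c"
    using c by (simp add: A1_bound_def)
  have C1g: "C1_map g"
    unfolding g_def by (rule C1_map_mollify_indicator[OF k E])
  have mg: "g \<in> borel_measurable lebesgue" "grad g \<in> borel_measurable lebesgue"
    using borel_measurable_continuous_onI[OF C1_map_continuous[OF C1g]]
      borel_measurable_continuous_onI[OF continuous_grad[OF C1g]]
    by (simp_all add: measurable_completion)
  have "weighted_Lp_norm 1 w g = (\<integral>\<^sup>+x. emollify k (indicator E) x * w x \<partial>lborel)"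
    unfolding weighted_Lp_norm_1 g_def
    using mollify_indicator_bounds(1)[OF k E] by (simp add: ennreal_mollify_indicator[OF k E])
  also have "\<dots> = (\<integral>\<^sup>+x. indicator E x * emollify k w x \<partial>lborel)"
    using E by (intro emollify_adjoint[OF k _ wb]) auto
  also have "\<dots> \<le> (\<integral>\<^sup>+x. ennreal ((1 + \<delta>) * c) * (w x * indicator E x) \<partial>lborel)"
    using emollify_le_A1[OF k r \<delta> wb c] by (intro nn_integral_mono) (auto simp: indicator_def)
  also have "\<dots> = ennreal ((1 + \<delta>) * c) * (\<integral>\<^sup>+x\<in>E. w x \<partial>lborel)"
    using E wb by (intro nn_integral_cmult) auto
  also have "\<dots> < \<infinity>"
    using wE by (simp add: ennreal_mult_less_top)
  finally have g1: "g \<in> weighted_L1 w"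
    using mg by (simp add: weighted_L1_def)
  have "weighted_Lp_norm 1 w (grad g) \<le> ennreal ((1 + \<delta>) * c) * weighted_variation w (indicat_real E)"
    unfolding weighted_Lp_norm_1 g_def by (rule gradient_integral_le_A1[OF k E r \<delta> wb c])
  also have "\<dots> < \<infinity>"
    using PE by (simp add: ennreal_mult_less_top)
  finally have "grad g \<in> weighted_L1 w"
    using mg by (simp add: weighted_L1_def)
  then have "g \<in> weighted_W11 w"
    using g1 has_weak_gradient_C1[OF C1g] by (auto simp: weighted_W11_def)
  then have "weighted_Lp_norm s w g
      \<le> ennreal C1 * weighted_Lp_norm 1 (\<lambda>x. epowr (maximal_fun w x) p) (grad g)"
    using sobolev has_weak_gradient_C1[OF C1g] by blast
  also have "\<dots> \<le> ennreal C1 * (\<integral>\<^sup>+x. ennreal (c powr p) * (ennreal (norm (grad g x)) * epowr (w x) p) \<partial>lborel)"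
    unfolding weighted_Lp_norm_1
  proof (intro mult_left_mono nn_integral_mono)
    fix x
    have "epowr (maximal_fun w x) p \<le> ennreal (c powr p) * epowr (w x) p"
      using epowr_mono[OF p maximal_fun_le[OF c, of x]] by (simp add: epowr_cmult[OF c0])
    then have "ennreal (norm (grad g x)) * epowr (maximal_fun w x) p
        \<le> ennreal (norm (grad g x)) * (ennreal (c powr p) * epowr (w x) p)"
      by (rule mult_left_mono) simp
    then show "ennreal (norm (grad g x)) * epowr (maximal_fun w x) p
        \<le> ennreal (c powr p) * (ennreal (norm (grad g x)) * epowr (w x) p)"
      by (simp add: mult_ac)
  qed simp
  also have "(\<integral>\<^sup>+x. ennreal (c powr p) * (ennreal (norm (grad g x)) * epowr (w x) p) \<partial>lborel)
      = ennreal (c powr p) * (\<integral>\<^sup>+x. ennreal (norm (grad g x)) * epowr (w x) p \<partial>lborel)"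
  proof (rule nn_integral_cmult)
    have "lower_semicontinuous (\<lambda>x. epowr (w x) p)"
      using w p by (intro lower_semicontinuous_epowr) (auto simp: A1_star_weight_def)
    then have [measurable]: "(\<lambda>x. epowr (w x) p) \<in> borel_measurable borel"
      by (rule lower_semicontinuous_borel)
    have [measurable]: "grad g \<in> borel_measurable borel"
      by (rule borel_measurable_continuous_onI[OF continuous_grad[OF C1g]])
    show "(\<lambda>x. ennreal (norm (grad g x)) * epowr (w x) p) \<in> borel_measurable lborel"
      by measurable
  qed
  finally show ?thesis
    unfolding g_def .
qed

text \<open>Under approximability the mollified weights converge almost everywhere with respect to the total
  variation measure. They are dominated by an integrable multiple of \<open>v\<close>, so the reversed Fatou lemma
  bounds the limit of the gradient integrals by the integral of \<open>v\<close> itself.\<close>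

lemma gradient_integral_eventually_le:
  fixes v :: "'a::euclidean_space \<Rightarrow> ennreal" and k :: "nat \<Rightarrow> 'a \<Rightarrow> real"
  assumes E: "E \<in> sets borel" and v: "lower_semicontinuous v" "A1_bound v C"
    and low: "\<And>R. \<exists>m>0. \<forall>x\<in>ball 0 R. ennreal m \<le> v x"
    and P: "weighted_variation v (indicat_real E) < \<infinity>"
    and appr: "approximable v (indicat_real E)"
    and k: "\<And>n. mollifier (r n) \<delta> (k n)" and r: "\<And>n. 0 < r n" "r \<longlonglongrightarrow> 0" and \<delta>: "0 \<le> \<delta>"
    and \<tau>: "0 < \<tau>"
  shows "\<forall>\<^sub>F n in sequentially.
    (\<integral>\<^sup>+x. ennreal (norm (grad (mollify (k n) (indicat_real E)) x)) * v x \<partial>lborel)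
      \<le> weighted_variation v (indicat_real E) + ennreal \<tau>"
proof -
  define \<mu> where "\<mu> = variation_measure (indicat_real E)"
  define P where "P = weighted_variation v (indicat_real E)"
  have li: "locally_integrable (indicat_real E)"
    by (rule locally_integrable_indicator) (use E in simp)
  note \<mu> = variation_measure_props[OF li, folded \<mu>_def]
  have vb: "v \<in> borel_measurable borel"
    by (rule lower_semicontinuous_borel[OF v(1)])
  have fin: "variation_on (indicat_real E) (ball 0 R) < \<infinity>" for R
  proof -
    obtain m where m: "0 < m" "\<forall>x\<in>ball 0 R. ennreal m \<le> v x"
      using low by blast
    then have "variation_on (indicat_real E) (ball 0 R) \<le> P / ennreal m"
      unfolding P_def by (intro variation_on_le_weighted_variation) auto
    also have "\<dots> < \<infinity>"
      using assms(5) m(1) by (simp add: P_def ennreal_divide_eq_top_iff less_top[symmetric])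
    finally show ?thesis .
  qed
  have vP: "(\<integral>\<^sup>+x. v x \<partial>\<mu>) \<le> P"
    unfolding \<mu>_def P_def by (rule integral_le_weighted_variation[OF li v(1)])
  have meas: "v \<in> borel_measurable \<mu>" "emollify (k n) v \<in> borel_measurable \<mu>" for n
    using vb borel_measurable_emollify[OF k vb] by (simp_all add: measurable_cong_sets[OF \<mu>(1) refl])
  have "limsup (\<lambda>n. \<integral>\<^sup>+x. emollify (k n) v x \<partial>\<mu>) \<le> (\<integral>\<^sup>+x. limsup (\<lambda>n. emollify (k n) v x) \<partial>\<mu>)"
  proof (rule nn_integral_limsup)
    show "(\<lambda>x. ennreal ((1 + \<delta>) * C) * v x) \<in> borel_measurable \<mu>"
      using meas by measurable
    show "AE x in \<mu>. emollify (k n) v x \<le> ennreal ((1 + \<delta>) * C) * v x" for n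
      using emollify_le_A1[OF k r(1) \<delta> vb v(2)] by simp
    have "(\<integral>\<^sup>+x. ennreal ((1 + \<delta>) * C) * v x \<partial>\<mu>) = ennreal ((1 + \<delta>) * C) * (\<integral>\<^sup>+x. v x \<partial>\<mu>)"
      by (rule nn_integral_cmult[OF meas(1)])
    also have "\<dots> < \<infinity>"
      using le_less_trans[OF vP] assms(5) by (simp add: P_def ennreal_mult_less_top)
    finally show "(\<integral>\<^sup>+x. ennreal ((1 + \<delta>) * C) * v x \<partial>\<mu>) < \<infinity>" .
  qed (rule meas)
  also have "\<dots> \<le> (\<integral>\<^sup>+x. v x \<partial>\<mu>)"
  proof (rule nn_integral_mono_AE)
    have "AE x in \<mu>. ((\<lambda>\<epsilon>. ball_mean (\<lambda>y. edist (v y) (v x)) x \<epsilon>) \<longlongrightarrow> 0) (at_right 0)"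
      using appr unfolding approximable_def \<mu>_def .
    then show "AE x in \<mu>. limsup (\<lambda>n. emollify (k n) v x) \<le> v x"
    proof eventually_elim
      fix x assume lim: "((\<lambda>\<epsilon>. ball_mean (\<lambda>y. edist (v y) (v x)) x \<epsilon>) \<longlongrightarrow> 0) (at_right 0)"
      have "filterlim r (at_right 0) sequentially"
        using r by (intro tendsto_imp_filterlim_at_right always_eventually) auto
      then have "(\<lambda>n. ball_mean (\<lambda>y. edist (v y) (v x)) x (r n)) \<longlonglongrightarrow> 0"
        by (rule filterlim_compose[OF lim])
      then have "(\<lambda>n. v x + ennreal (1 + \<delta>) * ball_mean (\<lambda>y. edist (v y) (v x)) x (r n)) \<longlonglongrightarrow> v x + ennreal (1 + \<delta>) * 0"
        by (intro tendsto_add tendsto_const ennreal_tendsto_cmult) auto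
      then have "limsup (\<lambda>n. v x + ennreal (1 + \<delta>) * ball_mean (\<lambda>y. edist (v y) (v x)) x (r n)) = v x"
        by (simp add: lim_imp_Limsup)
      moreover have "limsup (\<lambda>n. emollify (k n) v x)
          \<le> limsup (\<lambda>n. v x + ennreal (1 + \<delta>) * ball_mean (\<lambda>y. edist (v y) (v x)) x (r n))"
        using emollify_le_edist[OF k r(1) \<delta> vb] by (intro Limsup_mono always_eventually) auto
      ultimately show "limsup (\<lambda>n. emollify (k n) v x) \<le> v x"
        by simp
    qed
  qed
  also have "\<dots> \<le> P"
    by (rule vP)
  also have "P < P + ennreal \<tau>"
    using assms(5) \<tau> by (cases P) (auto simp: P_def ennreal_less_iff simp flip: ennreal_plus)
  finally have "\<forall>\<^sub>F n in sequentially. (\<integral>\<^sup>+x. emollify (k n) v x \<partial>\<mu>) < P + ennreal \<tau>"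
    by (rule Limsup_lessD)
  then show ?thesis
  proof eventually_elim
    case (elim n)
    have "(\<integral>\<^sup>+x. ennreal (norm (grad (mollify (k n) (indicat_real E)) x)) * v x \<partial>lborel)
        \<le> (\<integral>\<^sup>+x. emollify (k n) v x \<partial>\<mu>)"
      unfolding \<mu>_def by (rule gradient_integral_le_variation_measure[OF k E vb fin])
    then show ?case
      using elim by (simp add: P_def)
  qed
qed

theorem corollary1p10:
  fixes w :: "real ^ 'n \<Rightarrow> ennreal"
    and E :: "(real ^ 'n) set"
    and C1 s :: real
  assumes dim: "CARD('n) \<ge> 2"
    and s: "s = real CARD('n) / (real CARD('n) - 1)"
    and w: "A1_star_weight w"
    and E: "finite_weighted_perimeter w E"
    and C1: "C1 > 0"
    and Perez_Rela: "\<forall>g \<in> weighted_W11 w. \<forall>G. has_weak_gradient g G \<longrightarrow>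
        weighted_Lp_norm s w g
          \<le> ennreal C1 * weighted_Lp_norm 1 (\<lambda>x. epowr (maximal_fun w x) (1 / s)) G"
  shows "epowr (\<integral>\<^sup>+x\<in>E. w x \<partial>lebesgue) (1 / s)
           \<le> ennreal C1 * ennreal (A1_const w powr (2 / s))
               * weighted_perimeter (\<lambda>x. epowr (w x) (1 / s)) E
      \<and> (approximable (\<lambda>x. epowr (w x) (1 / s)) (indicat_real E) \<longrightarrow>
         epowr (\<integral>\<^sup>+x\<in>E. w x \<partial>lebesgue) (1 / s)
           \<le> ennreal C1 * ennreal (A1_const w powr (1 / s))
               * weighted_perimeter (\<lambda>x. epowr (w x) (1 / s)) E)"
proof -
  define p where "p = 1 / s"
  define c where "c = A1_const w"
  define v where "v x = epowr (w x) p" for x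
  have s0: "0 < s" and p: "0 < p" "p < 1"
    using dim unfolding p_def s by (auto simp: field_simps)
  have lsc: "lower_semicontinuous w"
    using w by (simp add: A1_star_weight_def)
  then have wb: "w \<in> borel_measurable borel"
    by (rule lower_semicontinuous_borel)
  have c: "A1_bound w c" "1 \<le> c"
    using A1_bound_A1_const[OF w] by (simp_all add: c_def)
  have v: "lower_semicontinuous v" "A1_bound v (c powr p)"
    unfolding v_def using lower_semicontinuous_epowr[OF p(1) lsc]
      A1_bound_epowr[OF wb A1_star_weight_pos[OF w] p c(1)] by auto
  have vb: "v \<in> borel_measurable borel"
    by (rule lower_semicontinuous_borel[OF v(1)])

  have E_BV: "indicat_real E \<in> borel_measurable lebesgue" "weighted_Lp_norm 1 w (indicat_real E) < \<infinity>"
      "weighted_variation w (indicat_real E) < \<infinity>"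
    using E by (simp_all add: finite_weighted_perimeter_def weighted_BV_def weighted_L1_def)
  then have "E \<in> sets lebesgue"
    by (simp add: borel_measurable_indicator_iff)
  then obtain E' where E': "E' \<in> sets borel" "AE x in lebesgue. x \<in> E \<longleftrightarrow> x \<in> E'"
    by (rule lebesgue_set_AE_eq_borel)
  note cong = variation_measure_cong_AE[OF E'(2)] weighted_variation_cong_AE[OF E'(2)]
  have wE: "(\<integral>\<^sup>+x\<in>E. w x \<partial>lebesgue) = (\<integral>\<^sup>+x\<in>E'. w x \<partial>lborel)"
  proof -
    have "(\<integral>\<^sup>+x\<in>E. w x \<partial>lebesgue) = (\<integral>\<^sup>+x\<in>E'. w x \<partial>lebesgue)"
      by (rule nn_integral_cong_AE) (use E'(2) in eventually_elim, auto simp: indicator_def)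
    then show ?thesis
      by (simp add: nn_integral_completion)
  qed
  have "weighted_Lp_norm 1 w (indicat_real E) = (\<integral>\<^sup>+x\<in>E. w x \<partial>lebesgue)"
    unfolding weighted_Lp_norm_1 nn_integral_completion by (intro nn_integral_cong) (auto simp: indicator_def)
  then have fin: "(\<integral>\<^sup>+x\<in>E'. w x \<partial>lborel) < \<infinity>" "weighted_variation w (indicat_real E') < \<infinity>"
    using E_BV by (simp_all add: wE cong)
  define P where "P = weighted_variation v (indicat_real E')"
  define D where "D k = (\<integral>\<^sup>+x. ennreal (norm (grad (mollify k (indicat_real E')) x)) * v x \<partial>lborel)" for k
  define K where "K = ennreal C1 * ennreal (c powr p)"

  have sobolev: "weighted_Lp_norm s w (mollify k (indicat_real E')) \<le> K * D k"
    if "mollifier r \<delta> k" "0 < r" "0 \<le> \<delta>" for r \<delta> k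
    using sobolev_mollified_indicator[OF w c(1) p(1) E'(1) fin Perez_Rela[folded p_def] that]
    by (simp add: K_def D_def v_def mult.assoc)
  define r where "r n = 1 / real (Suc n)" for n
  have r: "0 < r n" for n
    by (simp add: r_def)
  have r_lim: "r \<longlonglongrightarrow> 0"
    unfolding r_def using LIMSEQ_inverse_real_of_nat by (simp add: inverse_eq_divide)
  have limit: "epowr (\<integral>\<^sup>+x\<in>E. w x \<partial>lebesgue) p \<le> K * B"
    if "0 < \<delta>" "\<And>n. mollifier (\<rho> n) \<delta> (k n)" "\<And>n. 0 < \<rho> n" "\<rho> \<longlonglongrightarrow> 0" "\<And>n. D (k n) \<le> B" for \<delta> \<rho> k B
    unfolding wE p_def
  proof (rule weighted_measure_le_of_mollified[OF that(2-4) E'(1) wb s0])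
    fix n
    have "weighted_Lp_norm s w (mollify (k n) (indicat_real E')) \<le> K * D (k n)"
      by (rule sobolev[OF that(2,3)]) (use that(1) in simp)
    also have "\<dots> \<le> K * B"
      by (intro mult_left_mono that(5)) simp
    finally show "weighted_Lp_norm s w (mollify (k n) (indicat_real E')) \<le> K * B" .
  qed

  \<comment> \<open>One factor \<open>c powr p\<close> comes from the maximal function, the other from mollifying the test fields.\<close>
  have first: "epowr (\<integral>\<^sup>+x\<in>E. w x \<partial>lebesgue) p \<le> K * (ennreal (c powr p) * P)"
  proof (rule ennreal_le_of_factors)
    fix \<delta> :: real assume \<delta>: "0 < \<delta>"
    have "\<forall>n. \<exists>k :: real ^ 'n \<Rightarrow> real. mollifier (r n) \<delta> k"
      using ex_mollifier[OF r \<delta>] by blast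
    then obtain k :: "nat \<Rightarrow> real ^ 'n \<Rightarrow> real" where k: "\<And>n. mollifier (r n) \<delta> (k n)"
      by metis
    have "epowr (\<integral>\<^sup>+x\<in>E. w x \<partial>lebesgue) p \<le> K * (ennreal ((1 + \<delta>) * c powr p) * P)"
    proof (rule limit[OF \<delta> k r r_lim])
      show "D (k n) \<le> ennreal ((1 + \<delta>) * c powr p) * P" for n
        unfolding D_def P_def using \<delta> by (intro gradient_integral_le_A1[OF k E'(1) r _ vb v(2)]) simp
    qed
    then show "epowr (\<integral>\<^sup>+x\<in>E. w x \<partial>lebesgue) p \<le> ennreal (1 + \<delta>) * (K * (ennreal (c powr p) * P))"
      using \<delta> by (simp add: ennreal_mult mult_ac)
  qed

  \<comment> \<open>Here the excess factor \<open>1 + \<delta>\<close> of the kernels disappears in the limit, so \<open>\<delta> = 1\<close> will do.\<close>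
  have second: "epowr (\<integral>\<^sup>+x\<in>E. w x \<partial>lebesgue) p \<le> K * P" if appr: "approximable v (indicat_real E)"
  proof (cases "P = \<infinity>")
    case True
    have "K \<noteq> 0"
      using C1 c(2) by (simp add: K_def)
    then show ?thesis
      using True by (simp add: ennreal_mult_top)
  next
    case False
    have appr': "approximable v (indicat_real E')"
      using appr unfolding approximable_def cong(1) .
    have low: "\<exists>m>0. \<forall>x\<in>ball 0 R. ennreal m \<le> v x" for R
    proof (cases "0 < R")
      case True
      obtain i where i: "(INF y\<in>ball (0::real^'n) R. w y) = ennreal i" "0 < i"
        using A1_star_weight_INF_ball(1,2)[OF w True, of 0]
        by (cases "INF y\<in>ball (0::real^'n) R. w y") auto
      have "ennreal (i powr p) \<le> v x" if "x \<in> ball 0 R" for x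
      proof -
        have "ennreal i \<le> w x"
          unfolding i(1)[symmetric] by (rule INF_lower[OF that])
        then have "epowr (ennreal i) p \<le> v x"
          unfolding v_def by (rule epowr_mono[OF p(1)])
        then show ?thesis
          using i(2) by (simp add: epowr_ennreal)
      qed
      then show ?thesis
        using i(2) by (intro exI[of _ "i powr p"]) auto
    next
      case False
      then show ?thesis
        by (intro exI[of _ 1]) (auto simp: ball_empty)
    qed
    have "\<forall>n. \<exists>k :: real ^ 'n \<Rightarrow> real. mollifier (r n) 1 k"
      using ex_mollifier[OF r zero_less_one] by blast
    then obtain k :: "nat \<Rightarrow> real ^ 'n \<Rightarrow> real" where k: "\<And>n. mollifier (r n) 1 (k n)"
      by metis
    have le: "epowr (\<integral>\<^sup>+x\<in>E. w x \<partial>lebesgue) p \<le> K * (P + ennreal \<tau>)" if \<tau>: "0 < \<tau>" for \<tau>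
    proof -
      have "\<forall>\<^sub>F n in sequentially. D (k n) \<le> P + ennreal \<tau>"
        unfolding D_def P_def using False
        by (intro gradient_integral_eventually_le[OF E'(1) v low _ appr' k r r_lim _ \<tau>])
          (auto simp: P_def less_top)
      then obtain n0 where n0: "\<And>n. n0 \<le> n \<Longrightarrow> D (k n) \<le> P + ennreal \<tau>"
        by (auto simp: eventually_sequentially)
      show ?thesis
        by (rule limit[of 1 "\<lambda>n. r (n + n0)" "\<lambda>n. k (n + n0)"])
          (auto intro: k r n0 LIMSEQ_ignore_initial_segment[OF r_lim])
    qed
    show ?thesis
    proof (rule ennreal_le_epsilon)
      fix e :: real assume e: "0 < e"
      have K: "K = ennreal (C1 * c powr p)" "0 < C1 * c powr p"
        using C1 c(2) by (simp_all add: K_def ennreal_mult)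
      have "epowr (\<integral>\<^sup>+x\<in>E. w x \<partial>lebesgue) p \<le> K * (P + ennreal (e / (C1 * c powr p)))"
        using K(2) e by (intro le) simp
      also have "\<dots> = K * P + K * ennreal (e / (C1 * c powr p))"
        by (rule distrib_left)
      also have "K * ennreal (e / (C1 * c powr p)) = ennreal e"
        using K(2) e unfolding K(1) by (subst ennreal_mult[symmetric]) auto
      finally show "epowr (\<integral>\<^sup>+x\<in>E. w x \<partial>lebesgue) p \<le> K * P + ennreal e" .
    qed
  qed

  have "ennreal (c powr (2 / s)) = ennreal (c powr p) * ennreal (c powr p)"
  proof -
    have "c powr (2 / s) = c powr p * c powr p"
      by (simp add: p_def flip: powr_add)
    then show ?thesis
      by (simp add: ennreal_mult)
  qed
  moreover have "weighted_perimeter (\<lambda>x. epowr (w x) (1 / s)) E = P"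
    by (simp add: weighted_perimeter_def P_def cong v_def[abs_def] p_def)
  ultimately show ?thesis
    using first second by (simp add: K_def c_def p_def v_def[abs_def] mult.assoc)
qed

end
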